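(* Let $(M,g_0)$ be a totally geodesic lightlike hypersurface of an $(n+2)$-dimensional Lorentzian manifold, with conformal structure $c=[g_0]_0$ and integrable screen distribution $S(TM)$, and let $D$ be a linear connection on $M$. The quadruplet $(M,c,S(TM),D)$ defines an Einstein-Weyl screen structure if and only if, for all $g\in c$, $D$ is given by $$D_XY=D^g_XY+\theta_g(X)Y+\theta_g(Y)X-g(X,Y)\theta_g^{\sharp_g}-S(X,Y)\xi$$ with $\theta_g$ a horizontal 1-form and $S$ the associated symmetric tensor described in the context, and the Ricci curvature of $g$ satisfies $$\mathrm{Ric}^g=d\varphi_g-\tfrac12\mathcal D(\theta_g)+\bar\Lambda\,g,$$ where $\bar\Lambda$ is related to the Einstein-Weyl function $\Lambda$ by $$\bar\Lambda=\tfrac12\Lambda-\left[(1-n)|\theta_g^{\sharp_g}|_g^2-\delta^g\theta_g+S(\xi,\theta_g^{\sharp_g})\right]$$ and $$\begin{aligned}\mathcal D(\theta_g)(X,Y)={}&(1-n)\left[(D^g_X\theta_g)(Y)+(D^g_Y\theta_g)(X)-2\theta_g(X)\theta_g(Y)\right]\\&+\left[(D^g_XS)(\xi,Y)+(D^g_YS)(\xi,X)\right]+\left[\varphi_g(X)S(\xi,Y)+\varphi_g(Y)S(\xi,X)\right]\\&-2\left[(D^g_\xi S)(X,Y)+S(\xi,X)S(\xi,Y)\right].\end{aligned}$$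
   Context: $M$ is a hypersurface of $(\bar M,\bar g)$ whose induced metric $g_0$ has constant rank $n$; $TM^\perp=\ker g_0$ has nowhere vanishing (local) section $\xi$. A screen distribution $S(TM)$ is a complement of $TM^\perp$ in $TM$; $P:TM\to S(TM)$ is the projection along $TM^\perp$. $\eta$ is the 1-form with $\eta(\xi)=1$, $\ker\eta=S(TM)$ (i.e. $\eta=\bar g(N,\cdot)$ for the null transversal field $N$ with $\bar g(N,\xi)=1$, $N\perp S(TM)$). Totally geodesic: $\bar g(\bar\nabla_XY,\xi)=0$ for all $X,Y$ tangent to $M$. $c=[g_0]_0$ is the set of metrics $g=e^{-2f}g_0$ with $X(f)=0$ for $X\in TM^\perp$. A 1-form is horizontal if it vanishes on $TM^\perp$. A Weyl structure on $(M,c)$ is a torsion-free connection $D$ such that for each $g\in c$ there is a unique 1-form $\theta_g$ with $Dg=-2\theta_g\otimes g$; it is a Weyl screen structure relative to $(M,c,S(TM))$ if $D_XPY\in\Gamma(S(TM))$ for all $X,Y\in\Gamma(TM)$. It is Einstein-Weyl if there is $\Lambda\in C^\infty(M)$ (depending on $g$; the Einstein-Weyl function) with $\mathrm{Ric}^D(X,Y)+\mathrm{Ric}^D(Y,X)=\Lambda g(X,Y)$ for all $X,Y$. For $g\in c$, $D^g$ is a torsion-free connection with $D^gg=0$ and (with $\xi$ suitably normalised so that $D_\xi\xi=0$) $D^g_\xi\xi=0$; $\varphi_g$ is defined by $D^g_X\xi=\varphi_g(X)\xi$; $C$ by $D^g_XPY=\overset{\star}{\nabla}_XPY+C(X,PY)\xi$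 with $\overset{\star}{\nabla}_XPY\in\Gamma(S(TM))$. $S$ is the symmetric $(0,2)$-tensor with $S(\xi,\xi)=0$ and $S(X,Y)=C(X,Y)+\eta(X)\theta_g(Y)$ for $X\in\Gamma(TM)$, $Y\in\Gamma(S(TM))$. $\tilde g(X,Y)=g(X,Y)+\eta(X)\eta(Y)$ is nondegenerate, $g^{[\alpha\beta]}$ its inverse; $\omega^{\sharp_g}$ is the vector field with $\tilde g(\omega^{\sharp_g},\cdot)=\omega$; $|X|_g^2=g(X,X)$; $\delta^g\theta_g=\mathrm{div}^g\theta_g^{\sharp_g}$ with $\mathrm{div}^gX=\sum g^{[\alpha\beta]}\tilde g(D^g_{X_\alpha}X,X_\beta)$ for a local frame $(X_\alpha)$. Curvature of a connection $\nabla$: $R^\nabla(X,Y)=\nabla_{[X,Y]}-[\nabla_X,\nabla_Y]$; $\mathrm{Ric}^\nabla(X,Y)$ is the trace of $Z\mapsto R^\nabla(X,Z)Y$; $\mathrm{Ric}^g$ is the Ricci tensor of $D^g$. Exterior derivative convention: $d\omega(X,Y)=\frac12[X\omega(Y)-Y\omega(X)-\omega([X,Y])]$.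
   Formalization: The sign of dφ_g in the Ricci equation is corrected to Ric^g = −dφ_g − ½𝒟(θ_g) + Λ̄g: with the stated curvature, Ricci and exterior derivative conventions the skew part of Ric^g is always −dφ_g, so the printed sign fails unless dφ_g = 0. *)

theory Defs
  imports "HOL-Analysis.Analysis"
begin

section \<open>Smooth manifolds\<close>

text \<open>Only used for open \<open>S\<close>, so that \<open>differentiable_on\<close> is differentiability at each point.\<close>

primrec Ck_on :: "nat \<Rightarrow> 'a::euclidean_space set \<Rightarrow> ('a \<Rightarrow> 'b::real_normed_vector) \<Rightarrow> bool" where
  "Ck_on 0 S f \<longleftrightarrow> continuous_on S f"
| "Ck_on (Suc k) S f \<longleftrightarrow> f differentiable_on S \<and> (\<forall>v. Ck_on k S (\<lambda>x. frechet_derivative f (at x) v))"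

definition smooth_on :: "'a::euclidean_space set \<Rightarrow> ('a \<Rightarrow> 'b::real_normed_vector) \<Rightarrow> bool" where
  "smooth_on S f \<longleftrightarrow> (\<forall>k. Ck_on k S f)"

text \<open>The manifold is the whole type \<open>'m\<close>. An atlas assigns to every point \<open>p\<close> a chart whose domain
  contains \<open>p\<close>. The tangent space at \<open>p\<close> is the model space \<open>'e\<close>, a tangent vector at \<open>p\<close> being
  represented by its coordinates in the chart assigned to \<open>p\<close>. A field that is only defined on an open
  set \<open>W\<close> is a total function whose values outside \<open>W\<close> are irrelevant.\<close>

record ('m, 'e) atlas =
  cdom :: "'m \<Rightarrow> 'm set"
  cmap :: "'m \<Rightarrow> 'm \<Rightarrow> 'e"

definition chart_inv :: "('m, 'e) atlas \<Rightarrow> 'm \<Rightarrow> 'e \<Rightarrow> 'm" where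
  "chart_inv A p = inv_into (cdom A p) (cmap A p)"

definition smooth_manifold :: "('m::topological_space, 'e::euclidean_space) atlas \<Rightarrow> bool" where
  "smooth_manifold A \<longleftrightarrow>
     (\<forall>p. p \<in> cdom A p \<and> open (cdom A p) \<and> open (cmap A p ` cdom A p) \<and>
          homeomorphism (cdom A p) (cmap A p ` cdom A p) (cmap A p) (chart_inv A p)) \<and>
     (\<forall>p q. smooth_on (cmap A p ` (cdom A p \<inter> cdom A q)) (cmap A q \<circ> chart_inv A p))"

definition smooth_funs ::
  "('m::topological_space, 'e::euclidean_space) atlas \<Rightarrow> 'm set \<Rightarrow> ('m \<Rightarrow> 'b::real_normed_vector) set" where
  "smooth_funs A W = {f. \<forall>p. smooth_on (cmap A p ` (cdom A p \<inter> W)) (f \<circ> chart_inv A p)}"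

text \<open>The differential at \<open>p\<close> of a function with values in a vector space.\<close>

definition dfun :: "('m, 'e::euclidean_space) atlas \<Rightarrow> ('m \<Rightarrow> 'b::real_normed_vector) \<Rightarrow> 'm \<Rightarrow> 'e \<Rightarrow> 'b" where
  "dfun A f p v = frechet_derivative (f \<circ> chart_inv A p) (at (cmap A p p)) v"

text \<open>Coordinate expression of a vector field in the chart assigned to \<open>p\<close>.\<close>

definition vrep :: "('m, 'e::euclidean_space) atlas \<Rightarrow> 'm \<Rightarrow> ('m \<Rightarrow> 'e) \<Rightarrow> 'e \<Rightarrow> 'e" where
  "vrep A p X y = (let q = chart_inv A p y in dfun A (cmap A p) q (X q))"

definition vfields :: "('m::topological_space, 'e::euclidean_space) atlas \<Rightarrow> 'm set \<Rightarrow> ('m \<Rightarrow> 'e) set" where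
  "vfields A W = {X. \<forall>p. smooth_on (cmap A p ` (cdom A p \<inter> W)) (vrep A p X)}"

text \<open>The vector field on \<open>cdom A p\<close> with constant coordinates \<open>v\<close> in the chart assigned to \<open>p\<close>; its
  value at \<open>p\<close> is \<open>v\<close>.\<close>

definition coord_field :: "('m, 'e::euclidean_space) atlas \<Rightarrow> 'm \<Rightarrow> 'e \<Rightarrow> 'm \<Rightarrow> 'e" where
  "coord_field A p v q = frechet_derivative (cmap A q \<circ> chart_inv A p) (at (cmap A p q)) v"

definition lie_bracket :: "('m, 'e::euclidean_space) atlas \<Rightarrow> ('m \<Rightarrow> 'e) \<Rightarrow> ('m \<Rightarrow> 'e) \<Rightarrow> 'm \<Rightarrow> 'e" where
  "lie_bracket A X Y p =
     frechet_derivative (vrep A p Y) (at (cmap A p p)) (X p) -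
     frechet_derivative (vrep A p X) (at (cmap A p p)) (Y p)"

definition one_form :: "('m::topological_space, 'e::euclidean_space) atlas \<Rightarrow> ('m \<Rightarrow> 'e \<Rightarrow> real) \<Rightarrow> bool" where
  "one_form A \<omega> \<longleftrightarrow> (\<forall>p. linear (\<omega> p)) \<and>
     (\<forall>W. open W \<longrightarrow> (\<forall>X\<in>vfields A W. (\<lambda>p. \<omega> p (X p)) \<in> smooth_funs A W))"

definition sym_tensor ::
  "('m::topological_space, 'e::euclidean_space) atlas \<Rightarrow> ('m \<Rightarrow> 'e \<Rightarrow> 'e \<Rightarrow> real) \<Rightarrow> bool" where
  "sym_tensor A T \<longleftrightarrow> (\<forall>p. bilinear (T p) \<and> (\<forall>u v. T p u v = T p v u)) \<and>
     (\<forall>W. open W \<longrightarrow> (\<forall>X\<in>vfields A W. \<forall>Y\<in>vfields A W. (\<lambda>p. T p (X p) (Y p)) \<in> smooth_funs A W))"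

definition ext_d ::
  "('m, 'e::euclidean_space) atlas \<Rightarrow> ('m \<Rightarrow> 'e \<Rightarrow> real) \<Rightarrow> ('m \<Rightarrow> 'e) \<Rightarrow> ('m \<Rightarrow> 'e) \<Rightarrow> 'm \<Rightarrow> real" where
  "ext_d A \<omega> X Y p =
     (dfun A (\<lambda>q. \<omega> q (Y q)) p (X p) - dfun A (\<lambda>q. \<omega> q (X q)) p (Y p) - \<omega> p (lie_bracket A X Y p)) / 2"


section \<open>Linear connections\<close>

text \<open>Connections act on local sections over every open set \<open>W\<close>. Since \<open>f\<close> below need not be smooth, or
  even continuous, outside \<open>W\<close>, the rules for products force \<open>D X Y\<close> on \<open>W\<close> to depend only on the
  restrictions of \<open>X\<close> and \<open>Y\<close> to \<open>W\<close>.\<close>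

definition connection ::
  "('m::topological_space, 'e::euclidean_space) atlas \<Rightarrow> (('m \<Rightarrow> 'e) \<Rightarrow> ('m \<Rightarrow> 'e) \<Rightarrow> 'm \<Rightarrow> 'e) \<Rightarrow> bool" where
  "connection A D \<longleftrightarrow>
     (\<forall>W. open W \<longrightarrow>
       (\<forall>X\<in>vfields A W. \<forall>Y\<in>vfields A W.
          D X Y \<in> vfields A W \<and>
          (\<forall>Z\<in>vfields A W. \<forall>p\<in>W. D (\<lambda>q. X q + Z q) Y p = D X Y p + D Z Y p) \<and>
          (\<forall>Z\<in>vfields A W. \<forall>p\<in>W. D X (\<lambda>q. Y q + Z q) p = D X Y p + D X Z p) \<and>
          (\<forall>f\<in>smooth_funs A W. \<forall>p\<in>W. D (\<lambda>q. f q *\<^sub>R X q) Y p = f p *\<^sub>R D X Y p) \<and>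
          (\<forall>f\<in>smooth_funs A W. \<forall>p\<in>W.
             D X (\<lambda>q. f q *\<^sub>R Y q) p = dfun A f p (X p) *\<^sub>R Y p + f p *\<^sub>R D X Y p)))"

definition torsion_free ::
  "('m::topological_space, 'e::euclidean_space) atlas \<Rightarrow> (('m \<Rightarrow> 'e) \<Rightarrow> ('m \<Rightarrow> 'e) \<Rightarrow> 'm \<Rightarrow> 'e) \<Rightarrow> bool" where
  "torsion_free A D \<longleftrightarrow>
     (\<forall>W. open W \<longrightarrow> (\<forall>X\<in>vfields A W. \<forall>Y\<in>vfields A W. \<forall>p\<in>W.
        D X Y p - D Y X p = lie_bracket A X Y p))"

text \<open>\<open>cov1 A D \<omega> X Y\<close> is \<open>(D\<^sub>X \<omega>)(Y)\<close> and \<open>cov2 A D T X Y Z\<close> is \<open>(D\<^sub>X T)(Y, Z)\<close>.\<close>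

definition cov1 ::
  "('m, 'e::euclidean_space) atlas \<Rightarrow> (('m \<Rightarrow> 'e) \<Rightarrow> ('m \<Rightarrow> 'e) \<Rightarrow> 'm \<Rightarrow> 'e) \<Rightarrow>
   ('m \<Rightarrow> 'e \<Rightarrow> real) \<Rightarrow> ('m \<Rightarrow> 'e) \<Rightarrow> ('m \<Rightarrow> 'e) \<Rightarrow> 'm \<Rightarrow> real" where
  "cov1 A D \<omega> X Y p = dfun A (\<lambda>q. \<omega> q (Y q)) p (X p) - \<omega> p (D X Y p)"

definition cov2 ::
  "('m, 'e::euclidean_space) atlas \<Rightarrow> (('m \<Rightarrow> 'e) \<Rightarrow> ('m \<Rightarrow> 'e) \<Rightarrow> 'm \<Rightarrow> 'e) \<Rightarrow>
   ('m \<Rightarrow> 'e \<Rightarrow> 'e \<Rightarrow> real) \<Rightarrow> ('m \<Rightarrow> 'e) \<Rightarrow> ('m \<Rightarrow> 'e) \<Rightarrow> ('m \<Rightarrow> 'e) \<Rightarrow> 'm \<Rightarrow> real" where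
  "cov2 A D T X Y Z p =
     dfun A (\<lambda>q. T q (Y q) (Z q)) p (X p) - T p (D X Y p) (Z p) - T p (Y p) (D X Z p)"

definition metric_connection ::
  "('m::topological_space, 'e::euclidean_space) atlas \<Rightarrow> ('m \<Rightarrow> 'e \<Rightarrow> 'e \<Rightarrow> real) \<Rightarrow>
   (('m \<Rightarrow> 'e) \<Rightarrow> ('m \<Rightarrow> 'e) \<Rightarrow> 'm \<Rightarrow> 'e) \<Rightarrow> bool" where
  "metric_connection A g D \<longleftrightarrow>
     (\<forall>W. open W \<longrightarrow> (\<forall>X\<in>vfields A W. \<forall>Y\<in>vfields A W. \<forall>Z\<in>vfields A W. \<forall>p\<in>W. cov2 A D g X Y Z p = 0))"

text \<open>Sign convention: \<open>R(X, Y) = D\<^bsub>[X,Y]\<^esub> - [D\<^sub>X, D\<^sub>Y]\<close>.\<close>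

definition curv ::
  "('m, 'e::euclidean_space) atlas \<Rightarrow> (('m \<Rightarrow> 'e) \<Rightarrow> ('m \<Rightarrow> 'e) \<Rightarrow> 'm \<Rightarrow> 'e) \<Rightarrow>
   ('m \<Rightarrow> 'e) \<Rightarrow> ('m \<Rightarrow> 'e) \<Rightarrow> ('m \<Rightarrow> 'e) \<Rightarrow> 'm \<Rightarrow> 'e" where
  "curv A D X Y Z p = D (lie_bracket A X Y) Z p - (D X (D Y Z) p - D Y (D X Z) p)"

text \<open>\<open>Ric(X, Y)\<close> is the trace of \<open>Z \<mapsto> R(X, Z) Y\<close>. With these conventions, a torsion-free connection
  \<open>D\<close> that satisfies \<open>D g = 0\<close> for a symmetric tensor \<open>g\<close> with kernel spanned by \<open>\<xi>\<close>, and
  \<open>D\<^sub>X \<xi> = \<phi>(X) \<xi>\<close>, has \<open>tr R(X, Y) = - 2 d\<phi>(X, Y)\<close>, and by the first Bianchi identity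
  \<open>Ric(X, Y) - Ric(Y, X) = - 2 d\<phi>(X, Y)\<close>: the skew part of \<open>Ric\<close> is \<open>- d\<phi>\<close>.\<close>

definition ricci ::
  "('m, 'e::euclidean_space) atlas \<Rightarrow> (('m \<Rightarrow> 'e) \<Rightarrow> ('m \<Rightarrow> 'e) \<Rightarrow> 'm \<Rightarrow> 'e) \<Rightarrow>
   ('m \<Rightarrow> 'e) \<Rightarrow> ('m \<Rightarrow> 'e) \<Rightarrow> 'm \<Rightarrow> real" where
  "ricci A D X Y p = (\<Sum>b\<in>Basis. curv A D X (coord_field A p b) Y p \<bullet> b)"


section \<open>Lightlike hypersurfaces\<close>

definition form_kernel :: "('e::euclidean_space \<Rightarrow> 'e \<Rightarrow> real) \<Rightarrow> 'e set" where
  "form_kernel h = {v. \<forall>w. h v w = 0}"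

definition form_rank :: "('e::euclidean_space \<Rightarrow> 'e \<Rightarrow> real) \<Rightarrow> nat" where
  "form_rank h = DIM('e) - dim (form_kernel h)"

definition form_index :: "('e::euclidean_space \<Rightarrow> 'e \<Rightarrow> real) \<Rightarrow> nat" where
  "form_index h = Max {dim V |V. subspace V \<and> (\<forall>v\<in>V. v \<noteq> 0 \<longrightarrow> h v v < 0)}"

definition lorentzian_metric ::
  "('m::topological_space, 'e::euclidean_space) atlas \<Rightarrow> ('m \<Rightarrow> 'e \<Rightarrow> 'e \<Rightarrow> real) \<Rightarrow> bool" where
  "lorentzian_metric A g \<longleftrightarrow> sym_tensor A g \<and> (\<forall>p. form_kernel (g p) = {0} \<and> form_index (g p) = 1)"

definition levi_civita ::
  "('m::topological_space, 'e::euclidean_space) atlas \<Rightarrow> ('m \<Rightarrow> 'e \<Rightarrow> 'e \<Rightarrow> real) \<Rightarrow>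
   (('m \<Rightarrow> 'e) \<Rightarrow> ('m \<Rightarrow> 'e) \<Rightarrow> 'm \<Rightarrow> 'e) \<Rightarrow> bool" where
  "levi_civita A g D \<longleftrightarrow> connection A D \<and> torsion_free A D \<and> metric_connection A g D"

definition smooth_map ::
  "('m::topological_space, 'e::euclidean_space) atlas \<Rightarrow> ('n::topological_space, 'f::euclidean_space) atlas \<Rightarrow>
   ('m \<Rightarrow> 'n) \<Rightarrow> bool" where
  "smooth_map A B F \<longleftrightarrow> continuous_on UNIV F \<and>
     (\<forall>p q. smooth_on (cmap A p ` (cdom A p \<inter> F -` cdom B q)) (cmap B q \<circ> F \<circ> chart_inv A p))"

definition differential ::
  "('m, 'e::euclidean_space) atlas \<Rightarrow> ('n, 'f::euclidean_space) atlas \<Rightarrow> ('m \<Rightarrow> 'n) \<Rightarrow> 'm \<Rightarrow> 'e \<Rightarrow> 'f" where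
  "differential A B F p = dfun A (cmap B (F p) \<circ> F) p"

definition immersion ::
  "('m::topological_space, 'e::euclidean_space) atlas \<Rightarrow> ('n::topological_space, 'f::euclidean_space) atlas \<Rightarrow>
   ('m \<Rightarrow> 'n) \<Rightarrow> bool" where
  "immersion A B F \<longleftrightarrow> smooth_map A B F \<and> (\<forall>p. inj (differential A B F p))"

definition induced_metric ::
  "('m, 'e::euclidean_space) atlas \<Rightarrow> ('n, 'f::euclidean_space) atlas \<Rightarrow> ('m \<Rightarrow> 'n) \<Rightarrow>
   ('n \<Rightarrow> 'f \<Rightarrow> 'f \<Rightarrow> real) \<Rightarrow> 'm \<Rightarrow> 'e \<Rightarrow> 'e \<Rightarrow> real" where
  "induced_metric A B F h p u v = h (F p) (differential A B F p u) (differential A B F p v)"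

text \<open>\<open>X'\<close> on \<open>V\<close> is a local extension to the ambient manifold of the tangent field \<open>X\<close> on \<open>W\<close>.\<close>

definition extends_field ::
  "('m::topological_space, 'e::euclidean_space) atlas \<Rightarrow> ('n::topological_space, 'f::euclidean_space) atlas \<Rightarrow>
   ('m \<Rightarrow> 'n) \<Rightarrow> 'm set \<Rightarrow> 'n set \<Rightarrow> ('m \<Rightarrow> 'e) \<Rightarrow> ('n \<Rightarrow> 'f) \<Rightarrow> bool" where
  "extends_field A B F W V X X' \<longleftrightarrow> X \<in> vfields A W \<and> X' \<in> vfields B V \<and>
     (\<forall>q\<in>W. X' (F q) = differential A B F q (X q))"

definition totally_geodesic ::
  "('m::topological_space, 'e::euclidean_space) atlas \<Rightarrow> ('n::topological_space, 'f::euclidean_space) atlas \<Rightarrow>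
   ('m \<Rightarrow> 'n) \<Rightarrow> ('n \<Rightarrow> 'f \<Rightarrow> 'f \<Rightarrow> real) \<Rightarrow> (('n \<Rightarrow> 'f) \<Rightarrow> ('n \<Rightarrow> 'f) \<Rightarrow> 'n \<Rightarrow> 'f) \<Rightarrow> ('m \<Rightarrow> 'e) \<Rightarrow> bool" where
  "totally_geodesic A B F h D \<xi> \<longleftrightarrow>
     (\<forall>W V X Y X' Y'. open W \<longrightarrow> open V \<longrightarrow> F ` W \<subseteq> V \<longrightarrow>
        extends_field A B F W V X X' \<longrightarrow> extends_field A B F W V Y Y' \<longrightarrow>
        (\<forall>p\<in>W. h (F p) (D X' Y' (F p)) (differential A B F p (\<xi> p)) = 0))"

definition screen_distribution ::
  "('m::topological_space, 'e::euclidean_space) atlas \<Rightarrow> ('m \<Rightarrow> 'e \<Rightarrow> 'e \<Rightarrow> real) \<Rightarrow> nat \<Rightarrow> ('m \<Rightarrow> 'e set) \<Rightarrow> bool" where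
  "screen_distribution A g n S \<longleftrightarrow>
     (\<forall>p. subspace (S p) \<and> dim (S p) = n \<and> S p \<inter> form_kernel (g p) = {0} \<and>
          {u + v |u v. u \<in> S p \<and> v \<in> form_kernel (g p)} = UNIV) \<and>
     (\<forall>p. \<exists>W E. open W \<and> p \<in> W \<and> (\<forall>i<n. E i \<in> vfields A W) \<and>
          (\<forall>q\<in>W. S q = span ((\<lambda>i. E i q) ` {..<n})))"

text \<open>Complete integrability: near every point there are coordinates \<open>y\<close> in which \<open>S\<close> is a constant
  subspace \<open>K\<close> of the model space, so that the integral manifolds are the slices \<open>y -` (a + K)\<close>.\<close>

definition integrable_distribution ::
  "('m::topological_space, 'e::euclidean_space) atlas \<Rightarrow> ('m \<Rightarrow> 'e set) \<Rightarrow> bool" where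
  "integrable_distribution A S \<longleftrightarrow>
     (\<forall>p. \<exists>W (y :: 'm \<Rightarrow> 'e) K. open W \<and> p \<in> W \<and> y \<in> smooth_funs A W \<and> inj_on y W \<and> subspace K \<and>
          (\<forall>q\<in>W. bij (dfun A y q) \<and> S q = {v. dfun A y q v \<in> K}))"

definition screen_proj :: "('m \<Rightarrow> 'e::euclidean_space \<Rightarrow> 'e \<Rightarrow> real) \<Rightarrow> ('m \<Rightarrow> 'e set) \<Rightarrow> ('m \<Rightarrow> 'e) \<Rightarrow> 'm \<Rightarrow> 'e" where
  "screen_proj g S X p = (THE s. s \<in> S p \<and> X p - s \<in> form_kernel (g p))"

definition conformal_class ::
  "('m::topological_space, 'e::euclidean_space) atlas \<Rightarrow> ('m \<Rightarrow> 'e \<Rightarrow> 'e \<Rightarrow> real) \<Rightarrow> ('m \<Rightarrow> 'e \<Rightarrow> 'e \<Rightarrow> real) set" where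
  "conformal_class A g0 =
     {g. \<exists>f\<in>smooth_funs A UNIV. (\<forall>p. \<forall>v\<in>form_kernel (g0 p). dfun A f p v = 0) \<and>
           (\<forall>p u v. g p u v = exp (- 2 * f p) * g0 p u v)}"


section \<open>Einstein-Weyl screen structures\<close>

definition weyl_structure ::
  "('m::topological_space, 'e::euclidean_space) atlas \<Rightarrow> ('m \<Rightarrow> 'e \<Rightarrow> 'e \<Rightarrow> real) set \<Rightarrow>
   (('m \<Rightarrow> 'e) \<Rightarrow> ('m \<Rightarrow> 'e) \<Rightarrow> 'm \<Rightarrow> 'e) \<Rightarrow> bool" where
  "weyl_structure A c D \<longleftrightarrow> connection A D \<and> torsion_free A D \<and>
     (\<forall>g\<in>c. \<exists>!\<theta>. one_form A \<theta> \<and>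
        (\<forall>W. open W \<longrightarrow> (\<forall>X\<in>vfields A W. \<forall>Y\<in>vfields A W. \<forall>Z\<in>vfields A W. \<forall>p\<in>W.
           cov2 A D g X Y Z p = - 2 * \<theta> p (X p) * g p (Y p) (Z p))))"

definition weyl_screen_structure ::
  "('m::topological_space, 'e::euclidean_space) atlas \<Rightarrow> ('m \<Rightarrow> 'e \<Rightarrow> 'e \<Rightarrow> real) set \<Rightarrow> ('m \<Rightarrow> 'e set) \<Rightarrow>
   (('m \<Rightarrow> 'e) \<Rightarrow> ('m \<Rightarrow> 'e) \<Rightarrow> 'm \<Rightarrow> 'e) \<Rightarrow> bool" where
  "weyl_screen_structure A c S D \<longleftrightarrow> weyl_structure A c D \<and>
     (\<forall>g\<in>c. \<forall>W. open W \<longrightarrow> (\<forall>X\<in>vfields A W. \<forall>Y\<in>vfields A W. \<forall>p\<in>W. D X (screen_proj g S Y) p \<in> S p))"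

definition einstein_weyl_function ::
  "('m::topological_space, 'e::euclidean_space) atlas \<Rightarrow> (('m \<Rightarrow> 'e) \<Rightarrow> ('m \<Rightarrow> 'e) \<Rightarrow> 'm \<Rightarrow> 'e) \<Rightarrow>
   ('m \<Rightarrow> 'e \<Rightarrow> 'e \<Rightarrow> real) \<Rightarrow> ('m \<Rightarrow> real) \<Rightarrow> bool" where
  "einstein_weyl_function A D g \<Lambda> \<longleftrightarrow> \<Lambda> \<in> smooth_funs A UNIV \<and>
     (\<forall>W. open W \<longrightarrow> (\<forall>X\<in>vfields A W. \<forall>Y\<in>vfields A W. \<forall>p\<in>W.
        ricci A D X Y p + ricci A D Y X p = \<Lambda> p * g p (X p) (Y p)))"

definition einstein_weyl_screen_structure ::
  "('m::topological_space, 'e::euclidean_space) atlas \<Rightarrow> ('m \<Rightarrow> 'e \<Rightarrow> 'e \<Rightarrow> real) set \<Rightarrow> ('m \<Rightarrow> 'e set) \<Rightarrow>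
   (('m \<Rightarrow> 'e) \<Rightarrow> ('m \<Rightarrow> 'e) \<Rightarrow> 'm \<Rightarrow> 'e) \<Rightarrow> bool" where
  "einstein_weyl_screen_structure A c S D \<longleftrightarrow>
     weyl_screen_structure A c S D \<and> (\<forall>g\<in>c. \<exists>\<Lambda>. einstein_weyl_function A D g \<Lambda>)"

definition gtilde :: "('m \<Rightarrow> 'e \<Rightarrow> 'e \<Rightarrow> real) \<Rightarrow> ('m \<Rightarrow> 'e \<Rightarrow> real) \<Rightarrow> 'm \<Rightarrow> 'e \<Rightarrow> 'e \<Rightarrow> real" where
  "gtilde g \<eta> p u v = g p u v + \<eta> p u * \<eta> p v"

definition sharp ::
  "('m \<Rightarrow> 'e \<Rightarrow> 'e \<Rightarrow> real) \<Rightarrow> ('m \<Rightarrow> 'e \<Rightarrow> real) \<Rightarrow> ('m \<Rightarrow> 'e \<Rightarrow> real) \<Rightarrow> 'm \<Rightarrow> 'e" where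
  "sharp g \<eta> \<omega> p = (THE t. \<forall>v. gtilde g \<eta> p t v = \<omega> p v)"

text \<open>The entry at \<open>(a, b)\<close> of the inverse matrix of \<open>gtilde\<close>, for \<open>a, b \<in> Basis\<close>.\<close>

definition ginv ::
  "('m \<Rightarrow> 'e::euclidean_space \<Rightarrow> 'e \<Rightarrow> real) \<Rightarrow> ('m \<Rightarrow> 'e \<Rightarrow> real) \<Rightarrow> 'm \<Rightarrow> 'e \<Rightarrow> 'e \<Rightarrow> real" where
  "ginv g \<eta> p a b = sharp g \<eta> (\<lambda>_ v. a \<bullet> v) p \<bullet> b"

definition divergence ::
  "('m, 'e::euclidean_space) atlas \<Rightarrow> ('m \<Rightarrow> 'e \<Rightarrow> 'e \<Rightarrow> real) \<Rightarrow> ('m \<Rightarrow> 'e \<Rightarrow> real) \<Rightarrow>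
   (('m \<Rightarrow> 'e) \<Rightarrow> ('m \<Rightarrow> 'e) \<Rightarrow> 'm \<Rightarrow> 'e) \<Rightarrow> ('m \<Rightarrow> 'e) \<Rightarrow> 'm \<Rightarrow> real" where
  "divergence A g \<eta> D X p =
     (\<Sum>a\<in>Basis. \<Sum>b\<in>Basis. ginv g \<eta> p a b * gtilde g \<eta> p (D (coord_field A p a) X p) b)"

definition codiff ::
  "('m, 'e::euclidean_space) atlas \<Rightarrow> ('m \<Rightarrow> 'e \<Rightarrow> 'e \<Rightarrow> real) \<Rightarrow> ('m \<Rightarrow> 'e \<Rightarrow> real) \<Rightarrow>
   (('m \<Rightarrow> 'e) \<Rightarrow> ('m \<Rightarrow> 'e) \<Rightarrow> 'm \<Rightarrow> 'e) \<Rightarrow> ('m \<Rightarrow> 'e \<Rightarrow> real) \<Rightarrow> 'm \<Rightarrow> real" where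
  "codiff A g \<eta> D \<theta> = divergence A g \<eta> D (sharp g \<eta> \<theta>)"

text \<open>For \<open>Y\<close> in the screen distribution, \<open>screen_form S \<xi> D X Y\<close> is the coefficient \<open>C(X, Y)\<close> in the
  decomposition \<open>D\<^sub>X Y = \<nabla>\<^sub>X Y + C(X, Y) \<xi>\<close> with \<open>\<nabla>\<^sub>X Y\<close> in the screen distribution.\<close>

definition screen_form ::
  "('m \<Rightarrow> 'e::real_vector set) \<Rightarrow> ('m \<Rightarrow> 'e) \<Rightarrow> (('m \<Rightarrow> 'e) \<Rightarrow> ('m \<Rightarrow> 'e) \<Rightarrow> 'm \<Rightarrow> 'e) \<Rightarrow>
   ('m \<Rightarrow> 'e) \<Rightarrow> ('m \<Rightarrow> 'e) \<Rightarrow> 'm \<Rightarrow> real" where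
  "screen_form S \<xi> D X Y p = (THE a. D X Y p - a *\<^sub>R \<xi> p \<in> S p)"

definition associated_tensor ::
  "('m::topological_space, 'e::euclidean_space) atlas \<Rightarrow> ('m \<Rightarrow> 'e set) \<Rightarrow> ('m \<Rightarrow> 'e) \<Rightarrow> ('m \<Rightarrow> 'e \<Rightarrow> real) \<Rightarrow>
   (('m \<Rightarrow> 'e) \<Rightarrow> ('m \<Rightarrow> 'e) \<Rightarrow> 'm \<Rightarrow> 'e) \<Rightarrow> ('m \<Rightarrow> 'e \<Rightarrow> real) \<Rightarrow> ('m \<Rightarrow> 'e \<Rightarrow> 'e \<Rightarrow> real) \<Rightarrow> bool" where
  "associated_tensor A S \<xi> \<eta> D \<theta> T \<longleftrightarrow> sym_tensor A T \<and> (\<forall>p. T p (\<xi> p) (\<xi> p) = 0) \<and>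
     (\<forall>W. open W \<longrightarrow> (\<forall>X\<in>vfields A W. \<forall>Y\<in>vfields A W. (\<forall>q\<in>W. Y q \<in> S q) \<longrightarrow>
        (\<forall>p\<in>W. T p (X p) (Y p) = screen_form S \<xi> D X Y p + \<eta> p (X p) * \<theta> p (Y p))))"

definition calD ::
  "('m, 'e::euclidean_space) atlas \<Rightarrow> nat \<Rightarrow> ('m \<Rightarrow> 'e) \<Rightarrow> (('m \<Rightarrow> 'e) \<Rightarrow> ('m \<Rightarrow> 'e) \<Rightarrow> 'm \<Rightarrow> 'e) \<Rightarrow>
   ('m \<Rightarrow> 'e \<Rightarrow> real) \<Rightarrow> ('m \<Rightarrow> 'e \<Rightarrow> real) \<Rightarrow> ('m \<Rightarrow> 'e \<Rightarrow> 'e \<Rightarrow> real) \<Rightarrow>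
   ('m \<Rightarrow> 'e) \<Rightarrow> ('m \<Rightarrow> 'e) \<Rightarrow> 'm \<Rightarrow> real" where
  "calD A n \<xi> D \<phi> \<theta> T X Y p =
     (1 - real n) * (cov1 A D \<theta> X Y p + cov1 A D \<theta> Y X p - 2 * \<theta> p (X p) * \<theta> p (Y p))
     + (cov2 A D T X \<xi> Y p + cov2 A D T Y \<xi> X p)
     + (\<phi> p (X p) * T p (\<xi> p) (Y p) + \<phi> p (Y p) * T p (\<xi> p) (X p))
     - 2 * (cov2 A D T \<xi> X Y p + T p (\<xi> p) (X p) * T p (\<xi> p) (Y p))"

definition Lambda_bar ::
  "('m, 'e::euclidean_space) atlas \<Rightarrow> nat \<Rightarrow> ('m \<Rightarrow> 'e \<Rightarrow> 'e \<Rightarrow> real) \<Rightarrow> ('m \<Rightarrow> 'e) \<Rightarrow> ('m \<Rightarrow> 'e \<Rightarrow> real) \<Rightarrow>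
   (('m \<Rightarrow> 'e) \<Rightarrow> ('m \<Rightarrow> 'e) \<Rightarrow> 'm \<Rightarrow> 'e) \<Rightarrow> ('m \<Rightarrow> 'e \<Rightarrow> real) \<Rightarrow> ('m \<Rightarrow> 'e \<Rightarrow> 'e \<Rightarrow> real) \<Rightarrow>
   ('m \<Rightarrow> real) \<Rightarrow> 'm \<Rightarrow> real" where
  "Lambda_bar A n g \<xi> \<eta> D \<theta> T \<Lambda> p =
     \<Lambda> p / 2 - ((1 - real n) * g p (sharp g \<eta> \<theta> p) (sharp g \<eta> \<theta> p) - codiff A g \<eta> D \<theta> p
                + T p (\<xi> p) (sharp g \<eta> \<theta> p))"

end

theory Submission
  imports Defs
begin

text \<open>Fix \<open>g\<close> in the conformal class and put \<open>A = D - D\<^sup>g\<close>. For a torsion-free \<open>D\<close> with \<open>D g = - 2 \<theta> \<otimes> g\<close> the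
  Koszul trick determines \<open>A(X, Y)\<close> up to a multiple of \<open>\<xi>\<close>, and comparing \<open>\<L>\<^sub>\<xi> g\<close> for \<open>D\<close> and \<open>D\<^sup>g\<close> forces
  \<open>\<theta>(\<xi>) = 0\<close>; the screen condition on \<open>D\<close> says exactly that the remaining coefficient is the
  associated tensor \<open>S\<close>. In \<open>R\<^sup>D - R\<^sup>g\<close> only \<open>\<nabla>A\<close> and \<open>A \<circ> A\<close> occur, and their traces give
  \<open>Ric\<^sup>D(X, Y) + Ric\<^sup>D(Y, X) = Ric\<^sup>g(X, Y) + Ric\<^sup>g(Y, X) + \<D>(\<theta>)(X, Y)
  + 2 ((1 - n) \<bar>\<theta>\<^sup>\<sharp>\<bar>\<^sup>2 - \<delta>\<theta> + S(\<xi>, \<theta>\<^sup>\<sharp>)) g(X, Y)\<close>. This settles the symmetric part of the Ricci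
  equation. The skew part holds for every \<open>D\<^sup>g\<close>: by the first Bianchi identity it is the trace
  of \<open>R\<^sup>g(X, Y)\<close>, which is \<open>g\<close>-skew and acts on \<open>\<xi>\<close> as multiplication by \<open>- 2 d\<phi>(X, Y)\<close>.\<close>

section \<open>Calculus of smooth functions\<close>

text \<open>Two obstacles shape the work. A tangent vector at a point is stored in the chart of that
  point, so vectors at neighbouring points live in different coordinates. Curvature is therefore
  computed at one point \<open>p\<close> in the chart of \<open>p\<close>, where it becomes minus
  the usual expression in Christoffel symbols and their derivatives, and the change of connection
  turns into polynomial algebra. Secondly, g is degenerate and sees vectors only modulo \<xi>. What
  g loses is recovered by \<eta>: the \<xi>-coefficient of a vector in the kernel is its
  \<eta>-value, and g + \<eta> \<otimes> \<eta> supplies the duals for traces. The constants of the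
  Ricci equation come from the trace n + 1 of the identity: in the trace of the curvature change
  \<theta> \<otimes> \<theta> gets n + 3 - 2(n + 1) = 1 - n, and the symmetrised \<nabla>\<theta>
  gets n + 1 - 2 = n - 1, both before the minus sign of the curvature convention. The term - d\<phi>
  is half of Ric(X, Y) - Ric(Y, X) = - 2 d\<phi>(X, Y).\<close>

lemma has_derivative_cong_open:
  assumes "open S" "x \<in> S" "\<And>y. y \<in> S \<Longrightarrow> f y = g y"
  shows "(f has_derivative f') (at x) \<longleftrightarrow> (g has_derivative f') (at x)"
  using has_derivative_transform_within_open[OF _ assms(1,2), of f f' UNIV g]
        has_derivative_transform_within_open[OF _ assms(1,2), of g f' UNIV f] assms(3) by auto

lemma frechet_derivative_cong_open:
  assumes "open S" "x \<in> S" "\<And>y. y \<in> S \<Longrightarrow> f y = g y"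
  shows "frechet_derivative f (at x) = frechet_derivative g (at x)"
  unfolding frechet_derivative_def using has_derivative_cong_open[OF assms] by simp

lemma differentiable_cong_open:
  assumes "open S" "x \<in> S" "\<And>y. y \<in> S \<Longrightarrow> f y = g y"
  shows "f differentiable (at x) \<longleftrightarrow> g differentiable (at x)"
  unfolding differentiable_def using has_derivative_cong_open[OF assms] by simp

lemma differentiable_on_open:
  "open S \<Longrightarrow> f differentiable_on S \<longleftrightarrow> (\<forall>x\<in>S. f differentiable (at x))"
  by (simp add: differentiable_on_eq_differentiable_at)

lemma Ck_on_cong:
  assumes "open S" "\<And>x. x \<in> S \<Longrightarrow> f x = g x"
  shows "Ck_on k S f \<longleftrightarrow> Ck_on k S g"
  using assms(2)
proof (induction k arbitrary: f g)
  case 0 then show ?case by (simp cong: continuous_on_cong)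
next
  case (Suc k)
  have "Ck_on k S (\<lambda>x. frechet_derivative f (at x) v) \<longleftrightarrow> Ck_on k S (\<lambda>x. frechet_derivative g (at x) v)" for v
    using Suc.prems by (intro Suc.IH) (simp add: frechet_derivative_cong_open[OF assms(1), of _ f g])
  moreover have "f differentiable_on S \<longleftrightarrow> g differentiable_on S"
    using Suc.prems differentiable_cong_open[OF assms(1), of _ f g]
    by (simp add: differentiable_on_open[OF assms(1)])
  ultimately show ?case by simp
qed

lemma Ck_on_subset: "Ck_on k S f \<Longrightarrow> T \<subseteq> S \<Longrightarrow> Ck_on k T f"
  by (induction k arbitrary: f) (auto intro: continuous_on_subset differentiable_on_subset)

lemma Ck_on_Suc: "Ck_on (Suc k) S f \<Longrightarrow> Ck_on k S f"
proof (induction k arbitrary: f)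
  case 0 then show ?case by (simp add: differentiable_imp_continuous_on)
next
  case (Suc k)
  have "f differentiable_on S" "\<And>v. Ck_on (Suc k) S (\<lambda>x. frechet_derivative f (at x) v)"
    using Ck_on.simps(2)[of "Suc k" S f] Suc.prems by blast+
  then show ?case using Suc.IH Ck_on.simps(2)[of k S f] by blast
qed

lemma Ck_on_local:
  assumes "\<And>x. x \<in> S \<Longrightarrow> \<exists>T. open T \<and> x \<in> T \<and> Ck_on k T f" "open S"
  shows "Ck_on k S f"
  using assms(1)
proof (induction k arbitrary: f)
  case 0
  have "isCont f x" if "x \<in> S" for x
    using 0[OF that] by (auto simp: continuous_on_eq_continuous_at)
  then show ?case by (simp add: continuous_at_imp_continuous_on)
next
  case (Suc k)
  have "f differentiable_on S"
    using Suc.prems by (auto simp: differentiable_on_open[OF assms(2)])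
      (metis differentiable_on_open)
  moreover have "Ck_on k S (\<lambda>x. frechet_derivative f (at x) v)" for v
    using Suc.prems by (intro Suc.IH) (metis Ck_on.simps(2))
  ultimately show ?case by simp
qed

lemma Ck_on_const: "Ck_on k S (\<lambda>_. c)"
  by (induction k arbitrary: c) auto

lemma Ck_on_add:
  assumes "open S" "Ck_on k S f" "Ck_on k S g" shows "Ck_on k S (\<lambda>x. f x + g x)"
  using assms(2,3)
proof (induction k arbitrary: f g)
  case 0 then show ?case by (auto intro: continuous_intros)
next
  case (Suc k)
  have d: "f differentiable at x" "g differentiable at x" if "x \<in> S" for x
    using Suc.prems that by (auto simp: differentiable_on_open[OF assms(1)])
  have "frechet_derivative (\<lambda>x. f x + g x) (at x) v = frechet_derivative f (at x) v + frechet_derivative g (at x) v"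
    if "x \<in> S" for x v
    using frechet_derivative_at[OF has_derivative_add[OF d[OF that, unfolded frechet_derivative_works]]]
    by (metis)
  then have "Ck_on k S (\<lambda>x. frechet_derivative (\<lambda>x. f x + g x) (at x) v)" for v
    using Suc by (subst Ck_on_cong[OF assms(1)]) auto
  then show ?case using Suc.prems by (auto intro!: derivative_intros)
qed

text \<open>By the Leibniz rule the derivative is a sum of \<open>h\<close>-terms in which one
  factor stays undifferentiated; hence the drop of \<open>f\<close> and \<open>g\<close> from
  \<open>Suc k\<close> to \<open>k\<close>. Products, scalar multiples and inner products are all
  instances.\<close>

lemma Ck_on_bilinear:
  assumes "open S" "bounded_bilinear h" "Ck_on k S f" "Ck_on k S g" shows "Ck_on k S (\<lambda>x. h (f x) (g x))"
  using assms(3,4)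
proof (induction k arbitrary: f g)
  case 0 then show ?case by (auto intro: bounded_bilinear.continuous_on[OF assms(2)])
next
  case (Suc k)
  have d: "f differentiable at x" "g differentiable at x" if "x \<in> S" for x
    using Suc.prems that by (auto simp: differentiable_on_open[OF assms(1)])
  have hd: "((\<lambda>x. h (f x) (g x)) has_derivative
      (\<lambda>v. h (f x) (frechet_derivative g (at x) v) + h (frechet_derivative f (at x) v) (g x))) (at x)"
    if "x \<in> S" for x
    using bounded_bilinear.FDERIV[OF assms(2) d[OF that, unfolded frechet_derivative_works]] .
  have "frechet_derivative (\<lambda>x. h (f x) (g x)) (at x) v =
      h (f x) (frechet_derivative g (at x) v) + h (frechet_derivative f (at x) v) (g x)"
    if "x \<in> S" for x v
    using frechet_derivative_at[OF hd[OF that]] by metis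
  moreover have "Ck_on k S f" "Ck_on k S g" using Suc.prems Ck_on_Suc by blast+
  ultimately have "Ck_on k S (\<lambda>x. frechet_derivative (\<lambda>x. h (f x) (g x)) (at x) v)" for v
    using Suc assms(1) by (subst Ck_on_cong[OF assms(1)]) (auto intro!: Ck_on_add)
  moreover have "(\<lambda>x. h (f x) (g x)) differentiable_on S"
    using hd by (auto simp: differentiable_on_open[OF assms(1)] differentiable_def)
  ultimately show ?case by auto
qed

lemma Ck_on_sum:
  assumes "open S" "\<And>i. i \<in> I \<Longrightarrow> Ck_on k S (f i)" shows "Ck_on k S (\<lambda>x. \<Sum>i\<in>I. f i x)"
  using assms(2) by (induction I rule: infinite_finite_induct) (auto simp: Ck_on_const intro!: Ck_on_add[OF assms(1)])

lemma linear_euclidean_expand: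
  assumes "linear L" shows "L v = (\<Sum>b\<in>Basis. (v \<bullet> b) *\<^sub>R L b)"
  by (metis (no_types, lifting) assms euclidean_representation linear_scale linear_sum sum.cong)

text \<open>The chain rule differentiates \<open>f\<close> in the moving direction
  \<open>frechet_derivative h (at x) v\<close>, whereas \<open>Ck_on\<close> speaks of fixed
  directions. Expanding the direction over \<open>Basis\<close> leaves fixed directions with
  coefficients of class \<open>k\<close>.\<close>

lemma Ck_on_compose:
  fixes f :: "'b::euclidean_space \<Rightarrow> 'c::real_normed_vector" and h :: "'a::euclidean_space \<Rightarrow> 'b"
  assumes "open S" "open T" "h ` S \<subseteq> T" "Ck_on k S h" "Ck_on k T f"
  shows "Ck_on k S (\<lambda>x. f (h x))"
  using assms(4,5)
proof (induction k arbitrary: f)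
  case 0 then show ?case using assms(3) by (auto intro: continuous_on_compose2)
next
  case (Suc k)
  have d: "f differentiable at (h x)" "h differentiable at x" if "x \<in> S" for x
    using Suc.prems that assms(3) by (auto simp: differentiable_on_open[OF assms(1)] differentiable_on_open[OF assms(2)])
  have hd: "((\<lambda>x. f (h x)) has_derivative (\<lambda>v. frechet_derivative f (at (h x)) (frechet_derivative h (at x) v))) (at x)"
    if "x \<in> S" for x
    using diff_chain_at[OF d(2,1)[OF that, unfolded frechet_derivative_works]] by (simp add: o_def)
  have "frechet_derivative (\<lambda>x. f (h x)) (at x) v =
     (\<Sum>b\<in>Basis. (frechet_derivative h (at x) v \<bullet> b) *\<^sub>R frechet_derivative f (at (h x)) b)" if "x \<in> S" for x v
    using frechet_derivative_at[OF hd[OF that]]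
      linear_euclidean_expand[OF linear_frechet_derivative[OF d(1)[OF that]]] by metis
  moreover have "Ck_on k S h" using Suc.prems Ck_on_Suc by blast
  moreover have "Ck_on k S (\<lambda>x. frechet_derivative h (at x) v \<bullet> b)" for v b
    using Suc.prems by (intro Ck_on_bilinear[OF assms(1) bounded_bilinear_inner] Ck_on_const) auto
  moreover have "Ck_on k S (\<lambda>x. frechet_derivative f (at (h x)) b)" for b
    using Suc.IH[OF \<open>Ck_on k S h\<close>, of "\<lambda>y. frechet_derivative f (at y) b"] Suc.prems by simp
  ultimately have "Ck_on k S (\<lambda>x. frechet_derivative (\<lambda>x. f (h x)) (at x) v)" for v
    using Suc assms(1)
    by (subst Ck_on_cong[OF assms(1)])
       (auto intro!: Ck_on_sum Ck_on_bilinear[OF assms(1) bounded_bilinear_scaleR])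
  moreover have "(\<lambda>x. f (h x)) differentiable_on S"
    using hd by (auto simp: differentiable_on_open[OF assms(1)] differentiable_def)
  ultimately show ?case by auto
qed

text \<open>The derivative of 1/f contains 1/f again, but only at the level that the induction has
  already reached.\<close>

lemma Ck_on_inverse:
  fixes f :: "'a::euclidean_space \<Rightarrow> real"
  assumes "open S" "\<And>x. x \<in> S \<Longrightarrow> f x \<noteq> 0" "Ck_on k S f" shows "Ck_on k S (\<lambda>x. inverse (f x))"
  using assms(3)
proof (induction k)
  case 0 then show ?case using assms(2) by (auto intro!: continuous_intros)
next
  case (Suc k)
  have d: "f differentiable at x" if "x \<in> S" for x
    using Suc.prems that by (auto simp: differentiable_on_open[OF assms(1)])
  have hd: "((\<lambda>x. inverse (f x)) has_derivative
      (\<lambda>v. - (inverse (f x) * frechet_derivative f (at x) v * inverse (f x)))) (at x)" if "x \<in> S" for x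
    using Deriv.has_derivative_inverse[OF assms(2)[OF that] d[OF that, unfolded frechet_derivative_works]] .
  have fd: "frechet_derivative (\<lambda>x. inverse (f x)) (at x) v = (- inverse (f x)) * frechet_derivative f (at x) v * inverse (f x)"
    if "x \<in> S" for x v
    using frechet_derivative_at[OF hd[OF that]] by (metis mult_minus_left)
  have "Ck_on k S (\<lambda>x. inverse (f x))" using Suc Ck_on_Suc by blast
  moreover from Ck_on_bilinear[OF assms(1) bounded_bilinear_mult Ck_on_const[where c="-1"] this]
  have "Ck_on k S (\<lambda>x. - inverse (f x))" by simp
  moreover have "Ck_on k S (\<lambda>x. frechet_derivative f (at x) v)" for v using Suc.prems by simp
  ultimately have "Ck_on k S (\<lambda>x. (- inverse (f x)) * frechet_derivative f (at x) v * inverse (f x))" for v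
    by (intro Ck_on_bilinear[OF assms(1) bounded_bilinear_mult])
  then have "Ck_on k S (\<lambda>x. frechet_derivative (\<lambda>x. inverse (f x)) (at x) v)" for v
    by (subst Ck_on_cong[OF assms(1) fd]) auto
  moreover have "(\<lambda>x. inverse (f x)) differentiable_on S"
    using hd by (auto simp: differentiable_on_open[OF assms(1)] differentiable_def)
  ultimately show ?case by auto
qed

lemma Ck_on_exp: "Ck_on k S (exp :: real \<Rightarrow> real)"
proof -
  have hd: "(exp has_derivative (\<lambda>v. v * exp x)) (at x)" for x :: real
    by (auto intro!: derivative_eq_intros)
  have fd: "frechet_derivative exp (at x) v = v * exp x" for x v :: real
    using frechet_derivative_at[OF hd] by metis
  have "Ck_on k UNIV (exp :: real \<Rightarrow> real)"
  proof (induction k)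
    case 0 then show ?case by (auto intro: continuous_intros)
  next
    case (Suc k)
    have "exp differentiable_on (UNIV :: real set)"
      using hd by (auto simp: differentiable_on_def differentiable_def)
    then show ?case using Suc
      by (auto simp: fd intro!: Ck_on_bilinear[OF open_UNIV bounded_bilinear_mult] Ck_on_const)
  qed
  then show ?thesis by (rule Ck_on_subset) simp
qed

lemma smooth_on_cong: "open S \<Longrightarrow> (\<And>x. x \<in> S \<Longrightarrow> f x = g x) \<Longrightarrow> smooth_on S f \<longleftrightarrow> smooth_on S g"
  unfolding smooth_on_def using Ck_on_cong by blast

lemma smooth_on_subset: "smooth_on S f \<Longrightarrow> T \<subseteq> S \<Longrightarrow> smooth_on T f"
  unfolding smooth_on_def using Ck_on_subset by blast

lemma smooth_on_local:
  "(\<And>x. x \<in> S \<Longrightarrow> \<exists>T. open T \<and> x \<in> T \<and> smooth_on T f) \<Longrightarrow> open S \<Longrightarrow> smooth_on S f"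
  unfolding smooth_on_def by (intro allI Ck_on_local) (meson, simp)

lemma smooth_on_const: "smooth_on S (\<lambda>_. c)"
  unfolding smooth_on_def by (simp add: Ck_on_const)

lemma smooth_on_add: "open S \<Longrightarrow> smooth_on S f \<Longrightarrow> smooth_on S g \<Longrightarrow> smooth_on S (\<lambda>x. f x + g x)"
  unfolding smooth_on_def by (simp add: Ck_on_add)

lemma smooth_on_bilinear:
  "open S \<Longrightarrow> bounded_bilinear h \<Longrightarrow> smooth_on S f \<Longrightarrow> smooth_on S g \<Longrightarrow> smooth_on S (\<lambda>x. h (f x) (g x))"
  unfolding smooth_on_def by (simp add: Ck_on_bilinear)

lemmas smooth_on_scaleR = smooth_on_bilinear[OF _ bounded_bilinear_scaleR]
lemmas smooth_on_inner = smooth_on_bilinear[OF _ bounded_bilinear_inner]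

lemma smooth_on_sum:
  "open S \<Longrightarrow> (\<And>i. i \<in> I \<Longrightarrow> smooth_on S (f i)) \<Longrightarrow> smooth_on S (\<lambda>x. \<Sum>i\<in>I. f i x)"
  unfolding smooth_on_def by (simp add: Ck_on_sum)

lemma smooth_on_compose:
  "open S \<Longrightarrow> open T \<Longrightarrow> h ` S \<subseteq> T \<Longrightarrow> smooth_on S h \<Longrightarrow> smooth_on T f \<Longrightarrow> smooth_on S (\<lambda>x. f (h x))"
  unfolding smooth_on_def using Ck_on_compose by blast

lemma smooth_on_inverse:
  fixes f :: "'a::euclidean_space \<Rightarrow> real"
  shows "open S \<Longrightarrow> (\<And>x. x \<in> S \<Longrightarrow> f x \<noteq> 0) \<Longrightarrow> smooth_on S f \<Longrightarrow> smooth_on S (\<lambda>x. inverse (f x))"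
  unfolding smooth_on_def using Ck_on_inverse by blast

lemma smooth_on_exp: "smooth_on S (exp :: real \<Rightarrow> real)"
  unfolding smooth_on_def by (simp add: Ck_on_exp)

lemma smooth_on_continuous: "smooth_on S f \<Longrightarrow> continuous_on S f"
  unfolding smooth_on_def using Ck_on.simps(1) by blast

lemma smooth_on_differentiable: "smooth_on S f \<Longrightarrow> open S \<Longrightarrow> x \<in> S \<Longrightarrow> f differentiable (at x)"
  unfolding smooth_on_def using Ck_on.simps(2) differentiable_on_open by blast

lemma smooth_on_has_derivative:
  "smooth_on S f \<Longrightarrow> open S \<Longrightarrow> x \<in> S \<Longrightarrow> (f has_derivative frechet_derivative f (at x)) (at x)"
  using smooth_on_differentiable frechet_derivative_works by blast

lemma smooth_on_frechet: "smooth_on S f \<Longrightarrow> smooth_on S (\<lambda>x. frechet_derivative f (at x) v)"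
  unfolding smooth_on_def using Ck_on.simps(2) by blast

lemma smooth_on_linear_frechet: "smooth_on S f \<Longrightarrow> open S \<Longrightarrow> x \<in> S \<Longrightarrow> linear (frechet_derivative f (at x))"
  using smooth_on_differentiable linear_frechet_derivative by blast

lemma smooth_on_frechet_field:
  assumes "open S" "smooth_on S f" "smooth_on S h"
  shows "smooth_on S (\<lambda>x. frechet_derivative f (at x) (h x))"
proof -
  have "smooth_on S (\<lambda>x. \<Sum>b\<in>Basis. (h x \<bullet> b) *\<^sub>R frechet_derivative f (at x) b)"
    using assms by (intro smooth_on_sum smooth_on_scaleR smooth_on_inner smooth_on_const smooth_on_frechet) auto
  then show ?thesis
    using linear_euclidean_expand[OF smooth_on_linear_frechet[OF assms(2,1)]]
    by (subst smooth_on_cong[OF assms(1)]) auto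
qed

section \<open>Symmetry of mixed second derivatives\<close>

lemma second_difference_mean_value:
  fixes f :: "'a::euclidean_space \<Rightarrow> real"
  assumes "open S" "smooth_on S f" "0 < h" "\<And>s t. 0 \<le> s \<Longrightarrow> s \<le> h \<Longrightarrow> 0 \<le> t \<Longrightarrow> t \<le> h \<Longrightarrow> x + s *\<^sub>R u + t *\<^sub>R v \<in> S"
  obtains s t where "0 \<le> s" "s \<le> h" "0 \<le> t" "t \<le> h"
    "f (x + h *\<^sub>R u + h *\<^sub>R v) - f (x + h *\<^sub>R u) - f (x + h *\<^sub>R v) + f x =
       h * h * frechet_derivative (\<lambda>y. frechet_derivative f (at y) u) (at (x + s *\<^sub>R u + t *\<^sub>R v)) v"
proof -
  let ?d = "\<lambda>y. frechet_derivative f (at y)"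
  have lin: "linear (?d y)" if "y \<in> S" for y using smooth_on_linear_frechet[OF assms(2,1) that] .
  have D: "((\<lambda>s. f (z + s *\<^sub>R u)) has_derivative (\<lambda>r. ?d (z + s *\<^sub>R u) (r *\<^sub>R u))) (at s)"
    if "z + s *\<^sub>R u \<in> S" for z s
    by (rule has_derivative_compose[of "\<lambda>s. z + s *\<^sub>R u"])
       (auto intro!: derivative_eq_intros smooth_on_has_derivative[OF assms(2,1) that])
  \<comment> \<open>The second difference is the increment over [0, h] of s |-> f(x + hv + su) - f(x
    + su). One mean value in \<open>s\<close> and then one in \<open>t\<close> turn it into a mixed
    derivative at a single point.\<close>
  have "\<exists>s. 0 < s \<and> s < h \<and>
    (\<lambda>s. f (x + h *\<^sub>R v + s *\<^sub>R u) - f (x + s *\<^sub>R u)) h - (\<lambda>s. f (x + h *\<^sub>R v + s *\<^sub>R u) - f (x + s *\<^sub>R u)) 0 =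
    (h - 0) * (?d (x + h *\<^sub>R v + s *\<^sub>R u) u - ?d (x + s *\<^sub>R u) u)"
  proof (rule MVT2[OF assms(3)])
    fix s :: real assume s: "0 \<le> s" "s \<le> h"
    have in1: "x + h *\<^sub>R v + s *\<^sub>R u \<in> S" using assms(4)[of s h] s assms(3) by (simp add: algebra_simps)
    have in2: "x + s *\<^sub>R u \<in> S" using assms(4)[of s 0] s assms(3) by simp
    show "((\<lambda>s. f (x + h *\<^sub>R v + s *\<^sub>R u) - f (x + s *\<^sub>R u)) has_real_derivative
       ?d (x + h *\<^sub>R v + s *\<^sub>R u) u - ?d (x + s *\<^sub>R u) u) (at s)"
      unfolding has_field_derivative_def
      using has_derivative_diff[OF D[OF in1] D[OF in2]]
      by (rule has_derivative_eq_rhs) (simp add: linear_scale[OF lin[OF in1]] linear_scale[OF lin[OF in2]] right_diff_distrib mult.commute fun_eq_iff)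
  qed
  then obtain s where s: "0 < s" "s < h"
    "f (x + h *\<^sub>R v + h *\<^sub>R u) - f (x + h *\<^sub>R u) - f (x + h *\<^sub>R v) + f x =
     h * (?d (x + h *\<^sub>R v + s *\<^sub>R u) u - ?d (x + s *\<^sub>R u) u)" by (auto simp: algebra_simps)
  let ?g = "\<lambda>y. ?d y u"
  have sg: "smooth_on S ?g" using smooth_on_frechet[OF assms(2)] .
  have "\<exists>t. 0 < t \<and> t < h \<and>
    (\<lambda>t. ?g (x + s *\<^sub>R u + t *\<^sub>R v)) h - (\<lambda>t. ?g (x + s *\<^sub>R u + t *\<^sub>R v)) 0 =
    (h - 0) * (frechet_derivative ?g (at (x + s *\<^sub>R u + t *\<^sub>R v)) v)"
  proof (rule MVT2[OF assms(3)])
    fix t :: real assume t: "0 \<le> t" "t \<le> h"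
    have in1: "x + s *\<^sub>R u + t *\<^sub>R v \<in> S" using assms(4)[of s t] s t by simp
    have "((\<lambda>t. ?g (x + s *\<^sub>R u + t *\<^sub>R v)) has_derivative
       (\<lambda>r. frechet_derivative ?g (at (x + s *\<^sub>R u + t *\<^sub>R v)) (r *\<^sub>R v))) (at t)"
      by (rule has_derivative_compose[of "\<lambda>t. x + s *\<^sub>R u + t *\<^sub>R v"])
         (auto intro!: derivative_eq_intros smooth_on_has_derivative[OF sg assms(1) in1])
    then show "((\<lambda>t. ?g (x + s *\<^sub>R u + t *\<^sub>R v)) has_real_derivative
        frechet_derivative ?g (at (x + s *\<^sub>R u + t *\<^sub>R v)) v) (at t)"
      unfolding has_field_derivative_def
      by (rule has_derivative_eq_rhs)
         (simp add: linear_scale[OF smooth_on_linear_frechet[OF sg assms(1) in1]] mult.commute fun_eq_iff)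
  qed
  then obtain t where t: "0 < t" "t < h"
    "?g (x + s *\<^sub>R u + h *\<^sub>R v) - ?g (x + s *\<^sub>R u) = h * frechet_derivative ?g (at (x + s *\<^sub>R u + t *\<^sub>R v)) v"
    by auto
  have e: "x + s *\<^sub>R u + h *\<^sub>R v = x + h *\<^sub>R v + s *\<^sub>R u" "x + h *\<^sub>R u + h *\<^sub>R v = x + h *\<^sub>R v + h *\<^sub>R u"
    by (simp_all add: algebra_simps)
  show ?thesis
    by (rule that[of s t]) (use s t in \<open>simp_all add: e mult.assoc\<close>)
qed

text \<open>Swapping \<open>u\<close> and \<open>v\<close> leaves the second difference unchanged,
  so the two mixed derivatives take equal values at two points of a small parallelogram; continuity
  of both carries this to \<open>x\<close>.\<close>

lemma frechet_derivative_symmetric_real: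
  fixes f :: "'a::euclidean_space \<Rightarrow> real"
  assumes "open S" "smooth_on S f" "x \<in> S"
  shows "frechet_derivative (\<lambda>y. frechet_derivative f (at y) u) (at x) v =
         frechet_derivative (\<lambda>y. frechet_derivative f (at y) v) (at x) u"
proof -
  let ?H = "\<lambda>u v y. frechet_derivative (\<lambda>y. frechet_derivative f (at y) u) (at y) v"
  have cont: "isCont (?H u v) x" for u v
    using smooth_on_continuous[OF smooth_on_frechet[OF smooth_on_frechet[OF assms(2)]]] assms(1,3)
    by (simp add: continuous_on_eq_continuous_at)
  have "\<bar>?H u v x - ?H v u x\<bar> \<le> e" if e: "e > 0" for e
  proof -
    obtain d1 where d1: "d1 > 0" "\<And>y. dist y x < d1 \<Longrightarrow> dist (?H u v y) (?H u v x) < e / 2"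
      using cont[of u v, unfolded continuous_at_eps_delta, rule_format, OF half_gt_zero[OF e]] by blast
    obtain d2 where d2: "d2 > 0" "\<And>y. dist y x < d2 \<Longrightarrow> dist (?H v u y) (?H v u x) < e / 2"
      using cont[of v u, unfolded continuous_at_eps_delta, rule_format, OF half_gt_zero[OF e]] by blast
    obtain d3 where d3: "d3 > 0" "ball x d3 \<subseteq> S" using assms(1,3) openE by blast
    define d where "d = min d1 (min d2 d3)"
    \<comment> \<open>The summand 1 keeps the denominator positive when u = v = 0; the quotient
      keeps the whole parallelogram within distance \<open>d\<close> of \<open>x\<close>.\<close>
    define h where "h = d / (2 * (norm u + norm v + 1))"
    have pos: "norm u + norm v + 1 > 0" by (smt (verit) norm_ge_zero)
    have d: "d > 0" using d1 d2 d3 by (simp add: d_def)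
    have h: "h > 0" using d pos by (simp add: h_def)
    have close: "dist (x + s *\<^sub>R u' + t *\<^sub>R v') x < d"
      if "0 \<le> s" "s \<le> h" "0 \<le> t" "t \<le> h" "u' = u \<and> v' = v \<or> u' = v \<and> v' = u" for s t u' v'
    proof -
      have "norm (s *\<^sub>R u' + t *\<^sub>R v') \<le> s * norm u' + t * norm v'"
        using that norm_triangle_ineq[of "s *\<^sub>R u'" "t *\<^sub>R v'"] by simp
      also have "\<dots> \<le> h * norm u' + h * norm v'"
        using that by (intro add_mono mult_right_mono) auto
      also have "\<dots> = h * (norm u + norm v)" using that by (auto simp: algebra_simps)
      also have "\<dots> < h * (2 * (norm u + norm v + 1))"
        by (intro mult_strict_left_mono[OF _ h]) (simp add: add_nonneg_pos add_pos_nonneg)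
      also have "\<dots> = d" using pos by (simp add: h_def)
      finally show ?thesis by (simp add: dist_norm add.assoc)
    qed
    have inS: "x + s *\<^sub>R u' + t *\<^sub>R v' \<in> S"
      if "0 \<le> s" "s \<le> h" "0 \<le> t" "t \<le> h" "u' = u \<and> v' = v \<or> u' = v \<and> v' = u" for s t u' v'
      using close[OF that] d3(2) by (auto simp: d_def dist_commute)
    obtain s t where st: "0 \<le> s" "s \<le> h" "0 \<le> t" "t \<le> h"
      "f (x + h *\<^sub>R u + h *\<^sub>R v) - f (x + h *\<^sub>R u) - f (x + h *\<^sub>R v) + f x = h * h * ?H u v (x + s *\<^sub>R u + t *\<^sub>R v)"
      using second_difference_mean_value[OF assms(1,2) h, of x u v] inS by blast
    obtain s' t' where st': "0 \<le> s'" "s' \<le> h" "0 \<le> t'" "t' \<le> h"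
      "f (x + h *\<^sub>R v + h *\<^sub>R u) - f (x + h *\<^sub>R v) - f (x + h *\<^sub>R u) + f x = h * h * ?H v u (x + s' *\<^sub>R v + t' *\<^sub>R u)"
      using second_difference_mean_value[OF assms(1,2) h, of x v u] inS by blast
    have "h * h * ?H u v (x + s *\<^sub>R u + t *\<^sub>R v) = h * h * ?H v u (x + s' *\<^sub>R v + t' *\<^sub>R u)"
      using st(5) st'(5) by (simp add: algebra_simps)
    then have "?H u v (x + s *\<^sub>R u + t *\<^sub>R v) = ?H v u (x + s' *\<^sub>R v + t' *\<^sub>R u)" using h by simp
    moreover have "dist (?H u v (x + s *\<^sub>R u + t *\<^sub>R v)) (?H u v x) < e / 2"
      using d1(2) close st by (auto simp: d_def)
    moreover have "dist (?H v u (x + s' *\<^sub>R v + t' *\<^sub>R u)) (?H v u x) < e / 2"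
      using d2(2) close st' by (auto simp: d_def)
    ultimately show ?thesis unfolding dist_real_def by linarith
  qed
  then have "\<bar>?H u v x - ?H v u x\<bar> \<le> 0" using field_le_epsilon[of "\<bar>?H u v x - ?H v u x\<bar>" 0] by simp
  then show ?thesis by simp
qed

lemma frechet_derivative_linear_image:
  assumes "bounded_linear L" "f differentiable (at x)"
  shows "frechet_derivative (\<lambda>y. L (f y)) (at x) v = L (frechet_derivative f (at x) v)"
  using frechet_derivative_at[OF bounded_linear.has_derivative[OF assms(1) assms(2)[unfolded frechet_derivative_works]]]
  by metis

lemma frechet_derivative_symmetric:
  fixes f :: "'a::euclidean_space \<Rightarrow> 'b::euclidean_space"
  assumes "open S" "smooth_on S f" "x \<in> S"
  shows "frechet_derivative (\<lambda>y. frechet_derivative f (at y) u) (at x) v =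
         frechet_derivative (\<lambda>y. frechet_derivative f (at y) v) (at x) u"
proof (rule euclidean_eqI)
  fix b :: 'b
  have s: "smooth_on S (\<lambda>y. f y \<bullet> b)" using assms by (intro smooth_on_inner smooth_on_const)
  have c: "frechet_derivative (\<lambda>y. frechet_derivative f (at y) u) (at x) v \<bullet> b =
        frechet_derivative (\<lambda>y. frechet_derivative (\<lambda>z. f z \<bullet> b) (at y) u) (at x) v" for u v
  proof -
    have "frechet_derivative (\<lambda>z. f z \<bullet> b) (at y) u = frechet_derivative f (at y) u \<bullet> b" if "y \<in> S" for y
      using frechet_derivative_linear_image[OF bounded_linear_inner_left smooth_on_differentiable[OF assms(2,1) that]] .
    then have "frechet_derivative (\<lambda>y. frechet_derivative (\<lambda>z. f z \<bullet> b) (at y) u) (at x) v =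
        frechet_derivative (\<lambda>y. frechet_derivative f (at y) u \<bullet> b) (at x) v"
      by (intro fun_cong[OF frechet_derivative_cong_open[OF assms(1,3)]]) simp
    also have "\<dots> = frechet_derivative (\<lambda>y. frechet_derivative f (at y) u) (at x) v \<bullet> b"
      using frechet_derivative_linear_image[OF bounded_linear_inner_left
          smooth_on_differentiable[OF smooth_on_frechet[OF assms(2)] assms(1,3)]] .
    finally show ?thesis by simp
  qed
  show "frechet_derivative (\<lambda>y. frechet_derivative f (at y) u) (at x) v \<bullet> b =
         frechet_derivative (\<lambda>y. frechet_derivative f (at y) v) (at x) u \<bullet> b"
    unfolding c using frechet_derivative_symmetric_real[OF assms(1) s assms(3)] .
qed


section \<open>Charts, functions and vector fields\<close>

locale smooth_mfd =
  fixes A :: "('m::t2_space, 'e::euclidean_space) atlas"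
  assumes smooth_manifold: "smooth_manifold A"
begin

text \<open>The Jacobian at \<open>z\<close> of the coordinate change from the chart of
  \<open>p\<close> to that of \<open>q\<close>. Since a vector at \<open>z\<close> is stored in the
  chart of \<open>z\<close>, \<open>transit z p z\<close> reads it in the chart of
  \<open>p\<close>.\<close>

definition transit :: "'m \<Rightarrow> 'm \<Rightarrow> 'm \<Rightarrow> 'e \<Rightarrow> 'e" where
  "transit p q z = frechet_derivative (cmap A q \<circ> chart_inv A p) (at (cmap A p z))"

lemma mem_cdom [simp]: "p \<in> cdom A p"
  and open_cdom [simp]: "open (cdom A p)"
  and homeomorphism_chart: "homeomorphism (cdom A p) (cmap A p ` cdom A p) (cmap A p) (chart_inv A p)"
  and smooth_transition: "smooth_on (cmap A p ` (cdom A p \<inter> cdom A q)) (cmap A q \<circ> chart_inv A p)"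
  using smooth_manifold unfolding smooth_manifold_def by auto

lemma chart_inv_left [simp]: "q \<in> cdom A p \<Longrightarrow> chart_inv A p (cmap A p q) = q"
  using homeomorphism_chart[of p] by (auto simp: homeomorphism_def)

lemma open_chart_image:
  assumes "open W" shows "open (cmap A p ` (cdom A p \<inter> W))"
proof -
  have "openin (top_of_set (cmap A p ` cdom A p)) (cmap A p ` (cdom A p \<inter> W))"
    using homeomorphism_imp_open_map[OF homeomorphism_chart[of p]] assms by (simp add: openin_open_Int)
  moreover have "open (cmap A p ` cdom A p)"
    using smooth_manifold unfolding smooth_manifold_def by auto
  ultimately show ?thesis using openin_open_trans by blast
qed

lemma transition_has_derivative:
  assumes "z \<in> cdom A p" "z \<in> cdom A q"
  shows "(cmap A q \<circ> chart_inv A p has_derivative transit p q z) (at (cmap A p z))"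
  unfolding transit_def
  by (rule smooth_on_has_derivative[OF smooth_transition open_chart_image]) (use assms in auto)

lemma linear_transit: "z \<in> cdom A p \<Longrightarrow> z \<in> cdom A q \<Longrightarrow> linear (transit p q z)"
  using transition_has_derivative has_derivative_linear by blast

lemma frechet_derivative_change_chart:
  assumes "z \<in> cdom A p" "z \<in> cdom A q" "(f \<circ> chart_inv A p) differentiable (at (cmap A p z))"
  shows "frechet_derivative (f \<circ> chart_inv A q) (at (cmap A q z)) w =
         frechet_derivative (f \<circ> chart_inv A p) (at (cmap A p z)) (transit q p z w)"
proof -
  have "(((f \<circ> chart_inv A p) \<circ> (cmap A p \<circ> chart_inv A q)) has_derivative
     (frechet_derivative (f \<circ> chart_inv A p) (at (cmap A p z)) \<circ> transit q p z)) (at (cmap A q z))"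
    using assms(3)[unfolded frechet_derivative_works] assms(1,2)
    by (intro diff_chain_at transition_has_derivative) (auto simp: o_def)
  then have "((f \<circ> chart_inv A q) has_derivative
     (frechet_derivative (f \<circ> chart_inv A p) (at (cmap A p z)) \<circ> transit q p z)) (at (cmap A q z))"
    by (rule has_derivative_transform_within_open[OF _ open_chart_image[OF open_cdom[of p]]])
       (use assms(1,2) in auto)
  from frechet_derivative_at[OF this] show ?thesis by (metis comp_apply)
qed

text \<open>The cocycle identity, that is, the chain rule for composed transition maps; it makes
  every chart describe the same tangent vector.\<close>

lemma transit_transit:
  assumes "z \<in> cdom A p" "z \<in> cdom A q" "z \<in> cdom A r"
  shows "transit q r z (transit p q z v) = transit p r z v"
proof -
  have "(cmap A r \<circ> chart_inv A q) differentiable (at (cmap A q z))"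
    using transition_has_derivative[OF assms(2,3)] by (auto simp: differentiable_def)
  from frechet_derivative_change_chart[OF assms(2,1) this] show ?thesis by (simp add: transit_def)
qed

lemma transit_same [simp]: "z \<in> cdom A p \<Longrightarrow> transit p p z v = v"
proof -
  assume z: "z \<in> cdom A p"
  have "frechet_derivative (cmap A p \<circ> chart_inv A p) (at (cmap A p z)) = frechet_derivative (\<lambda>x. x) (at (cmap A p z))"
    by (rule frechet_derivative_cong_open[OF open_chart_image[OF open_UNIV, of p]]) (use z in auto)
  then show ?thesis by (simp add: transit_def)
qed

lemma dfun_cmap: "dfun A (cmap A p) q v = transit q p q v"
  by (simp add: dfun_def transit_def)

lemma coord_field_transit: "coord_field A p v q = transit p q q v"
  by (simp add: coord_field_def transit_def)

lemma coord_field_same [simp]: "coord_field A p v p = v"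
  by (simp add: coord_field_transit)

lemma vrep_cmap: "z \<in> cdom A p \<Longrightarrow> vrep A p X (cmap A p z) = transit z p z (X z)"
  by (simp add: vrep_def Let_def dfun_cmap)

lemma vrep_same [simp]: "vrep A p X (cmap A p p) = X p"
  by (simp add: vrep_cmap)

lemma vrep_coord_field: "z \<in> cdom A p \<Longrightarrow> vrep A p (coord_field A p v) (cmap A p z) = v"
  by (simp add: vrep_cmap coord_field_transit transit_transit)

lemma smooth_fun_on:
  "f \<in> smooth_funs A W \<Longrightarrow> smooth_on (cmap A p ` (cdom A p \<inter> W)) (f \<circ> chart_inv A p)"
  by (simp add: smooth_funs_def)

lemma smooth_fun_differentiable:
  "f \<in> smooth_funs A W \<Longrightarrow> open W \<Longrightarrow> z \<in> W \<Longrightarrow> z \<in> cdom A p \<Longrightarrow>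
    (f \<circ> chart_inv A p) differentiable (at (cmap A p z))"
  by (rule smooth_on_differentiable[OF smooth_fun_on open_chart_image]) auto

lemma dfun_chart:
  assumes "f \<in> smooth_funs A W" "open W" "z \<in> W" "z \<in> cdom A p"
  shows "dfun A f z w = frechet_derivative (f \<circ> chart_inv A p) (at (cmap A p z)) (transit z p z w)"
  unfolding dfun_def
  using frechet_derivative_change_chart[OF assms(4) mem_cdom smooth_fun_differentiable[OF assms]] .

lemma dfun_field_chart:
  assumes "f \<in> smooth_funs A W" "open W" "z \<in> W" "z \<in> cdom A p"
  shows "dfun A f z (X z) = frechet_derivative (f \<circ> chart_inv A p) (at (cmap A p z)) (vrep A p X (cmap A p z))"
  using dfun_chart[OF assms] vrep_cmap[OF assms(4)] by simp

lemma dfun_coord_field: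
  assumes "f \<in> smooth_funs A W" "open W" "z \<in> W" "z \<in> cdom A p"
  shows "dfun A f z (coord_field A p v z) = frechet_derivative (f \<circ> chart_inv A p) (at (cmap A p z)) v"
  using dfun_field_chart[OF assms] vrep_coord_field[OF assms(4)] by simp

lemma linear_dfun:
  assumes "f \<in> smooth_funs A W" "open W" "z \<in> W" shows "linear (dfun A f z)"
  using linear_frechet_derivative[OF smooth_fun_differentiable[OF assms mem_cdom]] by (simp add: dfun_def[abs_def])

lemma dfun_cong:
  assumes "open W" "z \<in> W" "\<And>q. q \<in> W \<Longrightarrow> f q = g q"
  shows "dfun A f z v = dfun A g z v"
proof -
  have "frechet_derivative (f \<circ> chart_inv A z) (at (cmap A z z)) = frechet_derivative (g \<circ> chart_inv A z) (at (cmap A z z))"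
    by (rule frechet_derivative_cong_open[OF open_chart_image[OF assms(1)]]) (use assms in auto)
  then show ?thesis by (simp add: dfun_def)
qed

lemma dfun_const [simp]: "dfun A (\<lambda>_. c) z v = 0"
  by (simp add: dfun_def o_def)

lemma dfun_add:
  assumes "f \<in> smooth_funs A W" "g \<in> smooth_funs A W" "open W" "z \<in> W"
  shows "dfun A (\<lambda>q. f q + g q) z v = dfun A f z v + dfun A g z v"
  using frechet_derivative_at[OF has_derivative_add[OF
     smooth_fun_differentiable[OF assms(1,3,4) mem_cdom, unfolded frechet_derivative_works]
     smooth_fun_differentiable[OF assms(2,3,4) mem_cdom, unfolded frechet_derivative_works]]]
  by (simp add: dfun_def o_def fun_eq_iff)

lemma dfun_bilinear:
  assumes "bounded_bilinear h" "f \<in> smooth_funs A W" "g \<in> smooth_funs A W" "open W" "z \<in> W"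
  shows "dfun A (\<lambda>q. h (f q) (g q)) z v = h (f z) (dfun A g z v) + h (dfun A f z v) (g z)"
  using frechet_derivative_at[OF bounded_bilinear.FDERIV[OF assms(1)
     smooth_fun_differentiable[OF assms(2,4,5) mem_cdom, unfolded frechet_derivative_works]
     smooth_fun_differentiable[OF assms(3,4,5) mem_cdom, unfolded frechet_derivative_works]]]
  by (simp add: dfun_def o_def fun_eq_iff)

lemmas dfun_mult = dfun_bilinear[OF bounded_bilinear_mult]

lemma smooth_funs_mono: "f \<in> smooth_funs A W \<Longrightarrow> V \<subseteq> W \<Longrightarrow> f \<in> smooth_funs A V"
  unfolding smooth_funs_def by (auto intro: smooth_on_subset)

lemma smooth_funs_cong:
  assumes "open W" "\<And>q. q \<in> W \<Longrightarrow> f q = g q" shows "f \<in> smooth_funs A W \<longleftrightarrow> g \<in> smooth_funs A W"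
  unfolding smooth_funs_def using assms
  by (auto intro!: all_cong1 smooth_on_cong open_chart_image)

text \<open>One chart that covers \<open>W\<close> is enough: any other coordinate expression arises
  by precomposing with a smooth transition map.\<close>

lemma smooth_funs_chart:
  assumes "open W" "W \<subseteq> cdom A p" "smooth_on (cmap A p ` W) (f \<circ> chart_inv A p)"
  shows "f \<in> smooth_funs A W"
  unfolding smooth_funs_def
proof (intro CollectI allI)
  fix q
  have W: "cdom A p \<inter> W = W" using assms(2) by auto
  have o: "open (cmap A q ` (cdom A q \<inter> W))" using open_chart_image[OF assms(1)] .
  have 1: "smooth_on (cmap A q ` (cdom A q \<inter> W)) (cmap A p \<circ> chart_inv A q)"
    by (rule smooth_on_subset[OF smooth_transition]) (use assms in auto)
  have "smooth_on (cmap A q ` (cdom A q \<inter> W)) (\<lambda>y. (f \<circ> chart_inv A p) ((cmap A p \<circ> chart_inv A q) y))"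
    by (rule smooth_on_compose[OF o _ _ 1 assms(3)])
       (use open_chart_image[OF assms(1), of p] assms(2) in \<open>auto simp: W\<close>)
  then show "smooth_on (cmap A q ` (cdom A q \<inter> W)) (f \<circ> chart_inv A q)"
    by (subst smooth_on_cong[OF o]) (use assms in auto)
qed

lemma smooth_funs_local:
  assumes "open W" "\<And>q. q \<in> W \<Longrightarrow> \<exists>V. open V \<and> q \<in> V \<and> f \<in> smooth_funs A V"
  shows "f \<in> smooth_funs A W"
  unfolding smooth_funs_def
proof (intro CollectI allI smooth_on_local open_chart_image assms(1))
  fix p y assume "y \<in> cmap A p ` (cdom A p \<inter> W)"
  then obtain z where z: "z \<in> cdom A p" "z \<in> W" "y = cmap A p z" by auto
  obtain V where "open V" "z \<in> V" "f \<in> smooth_funs A V" using assms(2)[OF z(2)] by auto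
  then show "\<exists>T. open T \<and> y \<in> T \<and> smooth_on T (f \<circ> chart_inv A p)"
    using z by (intro exI[of _ "cmap A p ` (cdom A p \<inter> V)"]) (auto intro: open_chart_image smooth_fun_on)
qed

lemma smooth_funs_compose_chart:
  assumes "open W" "smooth_on (cmap A p ` (cdom A p \<inter> W)) h"
  shows "(\<lambda>q. h (cmap A p q)) \<in> smooth_funs A (cdom A p \<inter> W)"
  by (rule smooth_funs_chart[of _ p], use assms in auto)
     (subst smooth_on_cong[OF open_chart_image[OF assms(1)], of _ _ h], auto)

lemma smooth_funs_const: "(\<lambda>_. c) \<in> smooth_funs A W"
  by (simp add: smooth_funs_def o_def smooth_on_const)

lemma smooth_funs_bilinear:
  "open W \<Longrightarrow> bounded_bilinear h \<Longrightarrow> f \<in> smooth_funs A W \<Longrightarrow> g \<in> smooth_funs A W \<Longrightarrow>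
    (\<lambda>q. h (f q) (g q)) \<in> smooth_funs A W"
  unfolding smooth_funs_def o_def by (auto intro!: smooth_on_bilinear[where h=h] open_chart_image)

lemmas smooth_funs_mult = smooth_funs_bilinear[OF _ bounded_bilinear_mult]
lemmas smooth_funs_inner = smooth_funs_bilinear[OF _ bounded_bilinear_inner]

lemma smooth_funs_minus:
  fixes f :: "'m \<Rightarrow> real"
  assumes "open W" "f \<in> smooth_funs A W" shows "(\<lambda>q. - f q) \<in> smooth_funs A W"
  using smooth_funs_mult[OF assms(1) smooth_funs_const[where c="-1"] assms(2)] by simp

lemma smooth_funs_sum:
  "open W \<Longrightarrow> (\<And>i. i \<in> I \<Longrightarrow> f i \<in> smooth_funs A W) \<Longrightarrow> (\<lambda>q. \<Sum>i\<in>I. f i q) \<in> smooth_funs A W"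
  by (simp add: smooth_funs_def o_def smooth_on_sum open_chart_image)

lemma smooth_funs_inverse:
  fixes f :: "'m \<Rightarrow> real"
  assumes "open W" "f \<in> smooth_funs A W" "\<And>q. q \<in> W \<Longrightarrow> f q \<noteq> 0"
  shows "(\<lambda>q. inverse (f q)) \<in> smooth_funs A W"
  using assms by (auto simp: smooth_funs_def o_def intro!: smooth_on_inverse open_chart_image)

lemma smooth_funs_exp:
  fixes f :: "'m \<Rightarrow> real"
  assumes "open W" "f \<in> smooth_funs A W" shows "(\<lambda>q. exp (f q)) \<in> smooth_funs A W"
  using assms by (auto simp: smooth_funs_def o_def
    intro!: smooth_on_compose[OF open_chart_image open_UNIV _ _ smooth_on_exp])

lemma smooth_funs_continuous:
  assumes "f \<in> smooth_funs A W" "open W" shows "continuous_on W f"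
proof -
  have "isCont f z" if z: "z \<in> W" for z
  proof -
    have c: "continuous_on (cmap A z ` (cdom A z \<inter> W)) (f \<circ> chart_inv A z)"
      using smooth_on_continuous[OF smooth_fun_on[OF assms(1)]] .
    have "continuous_on (cdom A z \<inter> W) (cmap A z)"
      using homeomorphism_cont1[OF homeomorphism_chart] continuous_on_subset by blast
    then have "continuous_on (cdom A z \<inter> W) ((f \<circ> chart_inv A z) \<circ> cmap A z)"
      using c by (rule continuous_on_compose)
    then have "continuous_on (cdom A z \<inter> W) f"
      by (subst (asm) continuous_on_cong[OF refl, where g=f]) auto
    then show ?thesis
      using z assms(2) by (simp add: continuous_on_eq_continuous_at open_Int)
  qed
  then show ?thesis by (simp add: continuous_at_imp_continuous_on)
qed

section \<open>Vector fields through their coordinate expressions\<close>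

lemma vfield_on: "X \<in> vfields A W \<Longrightarrow> smooth_on (cmap A p ` (cdom A p \<inter> W)) (vrep A p X)"
  by (simp add: vfields_def)

lemma vfields_mono: "X \<in> vfields A W \<Longrightarrow> V \<subseteq> W \<Longrightarrow> X \<in> vfields A V"
  unfolding vfields_def by (auto intro: smooth_on_subset)

lemma vrep_cong:
  "(\<And>q. q \<in> W \<Longrightarrow> X q = Y q) \<Longrightarrow> y \<in> cmap A p ` (cdom A p \<inter> W) \<Longrightarrow> vrep A p X y = vrep A p Y y"
  by (auto simp: vrep_cmap)

lemma vfields_cong:
  assumes "open W" "\<And>q. q \<in> W \<Longrightarrow> X q = Y q" shows "X \<in> vfields A W \<longleftrightarrow> Y \<in> vfields A W"
  unfolding vfields_def mem_Collect_eq
  by (intro all_cong1 smooth_on_cong open_chart_image assms(1) vrep_cong[OF assms(2)])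

text \<open>In another chart the components are the Jacobian of the transition map applied to the
  old components, and Jacobians of smooth maps along smooth fields are smooth
  (\<open>smooth_on_frechet_field\<close>).\<close>

lemma vfields_chart:
  assumes "open W" "W \<subseteq> cdom A p" "smooth_on (cmap A p ` W) (vrep A p X)"
  shows "X \<in> vfields A W"
  unfolding vfields_def
proof (intro CollectI allI)
  fix q
  have o: "open (cmap A q ` (cdom A q \<inter> W))" using open_chart_image[OF assms(1)] .
  have "cdom A p \<inter> (cdom A q \<inter> W) = cdom A q \<inter> W" using assms(2) by auto
  with open_chart_image[OF open_Int[OF open_cdom[of q] assms(1)], of p]
  have o': "open (cmap A p ` (cdom A q \<inter> W))" by simp
  have "smooth_on (cmap A p ` (cdom A q \<inter> W)) (\<lambda>y. frechet_derivative (cmap A q \<circ> chart_inv A p) (at y) (vrep A p X y))"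
    using o' assms(2,3)
    by (intro smooth_on_frechet_field) (auto intro: smooth_on_subset[OF smooth_transition] smooth_on_subset)
  note comp = smooth_on_compose[OF o o' _ _ this]
  have 1: "smooth_on (cmap A q ` (cdom A q \<inter> W)) (cmap A p \<circ> chart_inv A q)"
    by (rule smooth_on_subset[OF smooth_transition]) (use assms in auto)
  have "smooth_on (cmap A q ` (cdom A q \<inter> W))
    (\<lambda>y. frechet_derivative (cmap A q \<circ> chart_inv A p) (at ((cmap A p \<circ> chart_inv A q) y))
      (vrep A p X ((cmap A p \<circ> chart_inv A q) y)))"
    by (rule comp[OF _ 1]) auto
  then show "smooth_on (cmap A q ` (cdom A q \<inter> W)) (vrep A q X)"
  proof (subst smooth_on_cong[OF o])
    fix y assume "y \<in> cmap A q ` (cdom A q \<inter> W)"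
    then obtain z where z: "z \<in> cdom A q" "z \<in> W" "y = cmap A q z" by auto
    then have "vrep A q X y = transit p q z (vrep A p X (cmap A p z))"
      using assms(2) by (auto simp: vrep_cmap transit_transit subset_iff)
    then show "vrep A q X y = frechet_derivative (cmap A q \<circ> chart_inv A p) (at ((cmap A p \<circ> chart_inv A q) y))
        (vrep A p X ((cmap A p \<circ> chart_inv A q) y))" using z by (simp add: transit_def)
  qed
qed

lemma vfields_local:
  assumes "open W" "\<And>q. q \<in> W \<Longrightarrow> \<exists>V. open V \<and> q \<in> V \<and> X \<in> vfields A V"
  shows "X \<in> vfields A W"
  unfolding vfields_def
proof (intro CollectI allI smooth_on_local open_chart_image assms(1))
  fix p y assume "y \<in> cmap A p ` (cdom A p \<inter> W)"
  then obtain z where z: "z \<in> cdom A p" "z \<in> W" "y = cmap A p z" by auto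
  obtain V where "open V" "z \<in> V" "X \<in> vfields A V" using assms(2)[OF z(2)] by auto
  then show "\<exists>T. open T \<and> y \<in> T \<and> smooth_on T (vrep A p X)"
    using z by (intro exI[of _ "cmap A p ` (cdom A p \<inter> V)"]) (auto intro: open_chart_image vfield_on)
qed

lemma vrep_linear:
  assumes "z \<in> cdom A p"
  shows "vrep A p (\<lambda>q. X q + Y q) (cmap A p z) = vrep A p X (cmap A p z) + vrep A p Y (cmap A p z)"
    and "vrep A p (\<lambda>q. f q *\<^sub>R X q) (cmap A p z) = f z *\<^sub>R vrep A p X (cmap A p z)"
  using linear_transit[OF mem_cdom assms] by (simp_all add: vrep_cmap assms linear_add linear_scale)

lemma vfields_add:
  assumes "open W" "X \<in> vfields A W" "Y \<in> vfields A W" shows "(\<lambda>q. X q + Y q) \<in> vfields A W"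
  unfolding vfields_def
proof (intro CollectI allI)
  fix p
  have "smooth_on (cmap A p ` (cdom A p \<inter> W)) (\<lambda>y. vrep A p X y + vrep A p Y y)"
    by (intro smooth_on_add open_chart_image vfield_on assms)
  then show "smooth_on (cmap A p ` (cdom A p \<inter> W)) (vrep A p (\<lambda>q. X q + Y q))"
    by (subst smooth_on_cong[OF open_chart_image[OF assms(1)]]) (auto simp: vrep_linear)
qed

lemma vfields_scaleR:
  assumes "open W" "f \<in> smooth_funs A W" "X \<in> vfields A W" shows "(\<lambda>q. f q *\<^sub>R X q) \<in> vfields A W"
  unfolding vfields_def
proof (intro CollectI allI)
  fix p
  have "smooth_on (cmap A p ` (cdom A p \<inter> W)) (\<lambda>y. (f \<circ> chart_inv A p) y *\<^sub>R vrep A p X y)"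
    by (intro smooth_on_scaleR open_chart_image vfield_on smooth_fun_on assms)
  then show "smooth_on (cmap A p ` (cdom A p \<inter> W)) (vrep A p (\<lambda>q. f q *\<^sub>R X q))"
    by (subst smooth_on_cong[OF open_chart_image[OF assms(1)]]) (auto simp: vrep_linear)
qed

lemma vfields_minus:
  assumes "open W" "X \<in> vfields A W" shows "(\<lambda>q. - X q) \<in> vfields A W"
  using vfields_scaleR[OF assms(1) smooth_funs_const[where c="-1"] assms(2)] by simp

lemma vfields_diff:
  assumes "open W" "X \<in> vfields A W" "Y \<in> vfields A W" shows "(\<lambda>q. X q - Y q) \<in> vfields A W"
  using vfields_add[OF assms(1,2) vfields_minus[OF assms(1,3)]] by simp

lemma vfields_coord_field: "coord_field A p v \<in> vfields A (cdom A p)"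
proof (rule vfields_chart[OF open_cdom order_refl])
  show "smooth_on (cmap A p ` cdom A p) (vrep A p (coord_field A p v))"
    using open_chart_image[OF open_UNIV, of p]
    by (subst smooth_on_cong[of _ _ "\<lambda>_. v"]) (auto simp: vrep_coord_field smooth_on_const)
qed

lemma vfields_zero: "(\<lambda>_. 0) \<in> vfields A W"
proof -
  have "(\<lambda>_. 0) \<in> vfields A UNIV"
  proof (rule vfields_local[OF open_UNIV])
    fix q
    have "(\<lambda>z. 0 *\<^sub>R coord_field A q 0 z) \<in> vfields A (cdom A q)"
      by (intro vfields_scaleR smooth_funs_const vfields_coord_field open_cdom)
    then show "\<exists>V. open V \<and> q \<in> V \<and> (\<lambda>_. 0) \<in> vfields A V"
      by (intro exI[of _ "cdom A q"]) simp
  qed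
  then show ?thesis by (rule vfields_mono) simp
qed

lemma vfields_sum:
  assumes "open W" "\<And>i. i \<in> I \<Longrightarrow> X i \<in> vfields A W" shows "(\<lambda>q. \<Sum>i\<in>I. X i q) \<in> vfields A W"
  using assms(2) by (induction I rule: infinite_finite_induct) (auto simp: vfields_zero intro!: vfields_add[OF assms(1)])

lemma smooth_funs_dfun:
  assumes "open W" "f \<in> smooth_funs A W" "X \<in> vfields A W"
  shows "(\<lambda>q. dfun A f q (X q)) \<in> smooth_funs A W"
  unfolding smooth_funs_def
proof (intro CollectI allI)
  fix p
  have o: "open (cmap A p ` (cdom A p \<inter> W))" using open_chart_image[OF assms(1)] .
  have "smooth_on (cmap A p ` (cdom A p \<inter> W)) (\<lambda>y. frechet_derivative (f \<circ> chart_inv A p) (at y) (vrep A p X y))"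
    by (intro smooth_on_frechet_field o smooth_fun_on vfield_on assms)
  then show "smooth_on (cmap A p ` (cdom A p \<inter> W)) ((\<lambda>q. dfun A f q (X q)) \<circ> chart_inv A p)"
    by (subst smooth_on_cong[OF o]) (auto simp: dfun_field_chart[OF assms(2,1)])
qed

section \<open>Coordinate frames: expansion of fields and commuting of coordinate fields\<close>

definition comps :: "'m \<Rightarrow> ('m \<Rightarrow> 'e) \<Rightarrow> 'e \<Rightarrow> 'm \<Rightarrow> real" where
  "comps p X b q = vrep A p X (cmap A p q) \<bullet> b"

lemma smooth_funs_comps:
  assumes "open W" "X \<in> vfields A W" shows "comps p X b \<in> smooth_funs A (cdom A p \<inter> W)"
proof -
  have "(\<lambda>q. (\<lambda>y. vrep A p X y \<bullet> b) (cmap A p q)) \<in> smooth_funs A (cdom A p \<inter> W)"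
    by (intro smooth_funs_compose_chart smooth_on_inner smooth_on_const vfield_on open_chart_image assms)
  then show ?thesis by (simp add: comps_def[abs_def])
qed

lemma coord_field_expand:
  assumes "q \<in> cdom A p"
  shows "X q = (\<Sum>b\<in>Basis. comps p X b q *\<^sub>R coord_field A p b q)"
proof -
  have "(\<Sum>b\<in>Basis. comps p X b q *\<^sub>R coord_field A p b q) = transit p q q (vrep A p X (cmap A p q))"
    using linear_euclidean_expand[OF linear_transit[OF assms mem_cdom], of "vrep A p X (cmap A p q)"]
    by (simp only: comps_def coord_field_transit)
  also have "\<dots> = X q" using assms by (simp add: vrep_cmap transit_transit)
  finally show ?thesis by simp
qed

lemma coord_field_linear:
  assumes "q \<in> cdom A p" shows "linear (\<lambda>v. coord_field A p v q)"
  using linear_transit[OF assms mem_cdom] by (simp add: coord_field_transit[abs_def])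

lemma dfun_comps:
  assumes "open W" "X \<in> vfields A W" "p \<in> W"
  shows "dfun A (comps p X b) p v = frechet_derivative (vrep A p X) (at (cmap A p p)) v \<bullet> b"
proof -
  have o: "open (cmap A p ` (cdom A p \<inter> W))" using open_chart_image[OF assms(1)] .
  have m: "cmap A p p \<in> cmap A p ` (cdom A p \<inter> W)" using assms(3) by auto
  have "dfun A (comps p X b) p v = frechet_derivative (\<lambda>y. vrep A p X y \<bullet> b) (at (cmap A p p)) v"
    unfolding dfun_def
    by (rule fun_cong[OF frechet_derivative_cong_open[OF o m]]) (auto simp: comps_def)
  also have "\<dots> = frechet_derivative (vrep A p X) (at (cmap A p p)) v \<bullet> b"
    by (rule frechet_derivative_linear_image[OF bounded_linear_inner_left smooth_on_differentiable[OF vfield_on[OF assms(2)] o m]])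
  finally show ?thesis .
qed

text \<open>Coordinate fields of \<open>p\<close> have constant components throughout its chart, so
  both sides are second partial derivatives of the same coordinate expression.\<close>

lemma dfun_symmetric:
  fixes f :: "'m \<Rightarrow> real"
  assumes "open W" "f \<in> smooth_funs A W" "p \<in> W"
  shows "dfun A (\<lambda>q. dfun A f q (coord_field A p v q)) p u = dfun A (\<lambda>q. dfun A f q (coord_field A p u q)) p v"
    (is "?L u v = ?L v u")
proof -
  have o: "open (cmap A p ` (cdom A p \<inter> W))" using open_chart_image[OF assms(1)] .
  have m: "cmap A p p \<in> cmap A p ` (cdom A p \<inter> W)" using assms(3) by auto
  have "?L u v = frechet_derivative (\<lambda>y. frechet_derivative (f \<circ> chart_inv A p) (at y) v) (at (cmap A p p)) u" for u v
    unfolding dfun_def[of A "\<lambda>q. dfun A f q (coord_field A p v q)"]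
    by (rule fun_cong[OF frechet_derivative_cong_open[OF o m]]) (auto simp: dfun_coord_field[OF assms(2,1)])
  then show ?thesis
    using frechet_derivative_symmetric[OF o smooth_fun_on[OF assms(2)] m] by simp
qed

text \<open>The bracket at \<open>q\<close> is computed in the chart of \<open>q\<close>, where
  these fields are not constant: their components are first derivatives of the transition map. The
  two terms of the bracket are then its mixed second derivatives, which agree.\<close>

lemma lie_bracket_coord_field:
  assumes "q \<in> cdom A p" shows "lie_bracket A (coord_field A p u) (coord_field A p v) q = 0"
proof -
  let ?\<tau> = "cmap A q \<circ> chart_inv A p"
  have o: "open (cmap A p ` (cdom A p \<inter> cdom A q))" using open_chart_image[OF open_cdom] .
  have m: "cmap A p q \<in> cmap A p ` (cdom A p \<inter> cdom A q)" using assms by auto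
  have o': "open (cmap A q ` (cdom A q \<inter> cdom A p))" using open_chart_image[OF open_cdom] .
  have m': "cmap A q q \<in> cmap A q ` (cdom A q \<inter> cdom A p)" using assms by auto
  have s: "smooth_on (cmap A p ` (cdom A p \<inter> cdom A q)) (\<lambda>y. frechet_derivative ?\<tau> (at y) v)" for v
    by (intro smooth_on_frechet smooth_transition)
  have "frechet_derivative (vrep A q (coord_field A p v)) (at (cmap A q q)) (coord_field A p u q) =
        frechet_derivative (\<lambda>y. frechet_derivative ?\<tau> (at y) v) (at (cmap A p q)) u" for u v
  proof -
    have "frechet_derivative (vrep A q (coord_field A p v)) (at (cmap A q q)) =
      frechet_derivative ((\<lambda>y. frechet_derivative ?\<tau> (at y) v) \<circ> (cmap A p \<circ> chart_inv A q)) (at (cmap A q q))"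
      by (rule frechet_derivative_cong_open[OF o' m'])
         (auto simp: vrep_cmap coord_field_transit transit_transit, auto simp: transit_def)
    also have "\<dots> = frechet_derivative (\<lambda>y. frechet_derivative ?\<tau> (at y) v) (at (cmap A p q)) \<circ> transit q p q"
      using frechet_derivative_compose[where f="\<lambda>y. frechet_derivative ?\<tau> (at y) v" and g="cmap A p \<circ> chart_inv A q" and x="cmap A q q"]
        smooth_on_differentiable[OF s o m] transition_has_derivative[of q q p] assms
      by (auto simp: differentiable_def transit_def)
    finally show ?thesis using assms by (simp add: coord_field_transit transit_transit)
  qed
  then show ?thesis
    unfolding lie_bracket_def using frechet_derivative_symmetric[OF o smooth_transition m] by simp
qed

end


section \<open>Connections in coordinates\<close>

context smooth_mfd begin

text \<open>The flat derivative belonging to the chart of \<open>p\<close>, taken at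
  \<open>p\<close>. It is not tensorial; a connection corrects it by its Christoffel
  symbols.\<close>

definition vder :: "'m \<Rightarrow> ('m \<Rightarrow> 'e) \<Rightarrow> 'e \<Rightarrow> 'e" where
  "vder p X = frechet_derivative (vrep A p X) (at (cmap A p p))"

lemma lie_bracket_vder: "lie_bracket A X Y p = vder p Y (X p) - vder p X (Y p)"
  by (simp add: lie_bracket_def vder_def)

lemma chart_center_mem: "p \<in> W \<Longrightarrow> cmap A p p \<in> cmap A p ` (cdom A p \<inter> W)"
  by auto

lemma vder_has_derivative:
  assumes "open W" "X \<in> vfields A W" "p \<in> W"
  shows "(vrep A p X has_derivative vder p X) (at (cmap A p p))"
  unfolding vder_def
  by (rule smooth_on_has_derivative[OF vfield_on[OF assms(2)] open_chart_image[OF assms(1)] chart_center_mem[OF assms(3)]])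

lemma linear_vder: "open W \<Longrightarrow> X \<in> vfields A W \<Longrightarrow> p \<in> W \<Longrightarrow> linear (vder p X)"
  using vder_has_derivative has_derivative_linear by blast

lemma vder_eqI:
  assumes "(f has_derivative f') (at (cmap A p p))" "open W" "p \<in> W"
    "\<And>q. q \<in> W \<Longrightarrow> q \<in> cdom A p \<Longrightarrow> vrep A p X (cmap A p q) = f (cmap A p q)"
  shows "vder p X = f'"
proof -
  have "(vrep A p X has_derivative f') (at (cmap A p p))"
    by (rule has_derivative_transform_within_open[OF assms(1) open_chart_image[OF assms(2)] chart_center_mem[OF assms(3)]])
       (use assms(4) in auto)
  then show ?thesis using frechet_derivative_at by (metis vder_def)
qed

lemma vder_cong:
  assumes "open W" "p \<in> W" "\<And>q. q \<in> W \<Longrightarrow> X q = Y q" shows "vder p X = vder p Y"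
proof -
  have "frechet_derivative (vrep A p X) (at (cmap A p p)) = frechet_derivative (vrep A p Y) (at (cmap A p p))"
    by (rule frechet_derivative_cong_open[OF open_chart_image[OF assms(1)] chart_center_mem[OF assms(2)] vrep_cong])
       (use assms(3) in auto)
  then show ?thesis by (simp add: vder_def)
qed

lemma vder_coord_field [simp]: "vder p (coord_field A p v) u = 0"
proof -
  have "vder p (coord_field A p v) = (\<lambda>u. 0)"
    by (rule vder_eqI[of "\<lambda>_. v" _ p UNIV]) (auto simp: vrep_coord_field)
  then show ?thesis by simp
qed

lemma vder_add:
  assumes "open W" "X \<in> vfields A W" "Y \<in> vfields A W" "p \<in> W"
  shows "vder p (\<lambda>q. X q + Y q) u = vder p X u + vder p Y u"
  by (rule fun_cong[OF vder_eqI[OF has_derivative_add[OF vder_has_derivative[OF assms(1,2,4)]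
       vder_has_derivative[OF assms(1,3,4)]] assms(1,4)]]) (simp add: vrep_linear)

lemma vder_scaleR:
  assumes "open W" "f \<in> smooth_funs A W" "X \<in> vfields A W" "p \<in> W"
  shows "vder p (\<lambda>q. f q *\<^sub>R X q) u = f p *\<^sub>R vder p X u + dfun A f p u *\<^sub>R X p"
proof -
  have "((\<lambda>y. (f \<circ> chart_inv A p) y *\<^sub>R vrep A p X y) has_derivative
     (\<lambda>u. (f \<circ> chart_inv A p) (cmap A p p) *\<^sub>R vder p X u
        + frechet_derivative (f \<circ> chart_inv A p) (at (cmap A p p)) u *\<^sub>R vrep A p X (cmap A p p))) (at (cmap A p p))"
    by (intro has_derivative_scaleR vder_has_derivative[OF assms(1,3,4)]
       smooth_fun_differentiable[OF assms(2,1,4) mem_cdom, unfolded frechet_derivative_works])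
  from fun_cong[OF vder_eqI[OF this assms(1,4)], of "\<lambda>q. f q *\<^sub>R X q" u]
  show ?thesis by (simp add: vrep_linear dfun_def)
qed

lemma vder_zero [simp]: "vder p (\<lambda>_. 0) u = 0"
  by (rule fun_cong[OF vder_eqI[of "\<lambda>_. 0" "\<lambda>_. 0" p UNIV]]) (auto simp: vrep_cmap linear_0[OF linear_transit])

lemma vder_sum:
  assumes "open W" "\<And>i. i \<in> I \<Longrightarrow> X i \<in> vfields A W" "p \<in> W"
  shows "vder p (\<lambda>q. \<Sum>i\<in>I. X i q) u = (\<Sum>i\<in>I. vder p (X i) u)"
  using assms(2)
  by (induction I rule: infinite_finite_induct)
     (auto simp: vder_add[OF assms(1) _ vfields_sum[OF assms(1)] assms(3)])

lemma comps_center: "comps p X b p = X p \<bullet> b"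
  by (simp add: comps_def)

lemma comps_coord_field: "q \<in> cdom A p \<Longrightarrow> comps p (coord_field A p v) b q = v \<bullet> b"
  by (simp add: comps_def vrep_coord_field)

lemma dfun_comps_vder:
  "open W \<Longrightarrow> X \<in> vfields A W \<Longrightarrow> p \<in> W \<Longrightarrow> dfun A (comps p X b) p v = vder p X v \<bullet> b"
  using dfun_comps by (simp add: vder_def)

lemma dfun_sum:
  assumes "open W" "\<And>i. i \<in> I \<Longrightarrow> f i \<in> smooth_funs A W" "p \<in> W"
  shows "dfun A (\<lambda>q. \<Sum>i\<in>I. f i q) p u = (\<Sum>i\<in>I. dfun A (f i) p u)"
  using assms(2)
  by (induction I rule: infinite_finite_induct)
     (auto simp: dfun_add[OF _ smooth_funs_sum[OF assms(1)] assms(1,3)])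

lemma linear_coord_expand:
  fixes L :: "'e \<Rightarrow> 'b::real_vector"
  assumes "linear L" "q \<in> cdom A p"
  shows "L (X q) = (\<Sum>b\<in>Basis. comps p X b q *\<^sub>R L (coord_field A p b q))"
proof -
  have "L (X q) = L (\<Sum>b\<in>Basis. comps p X b q *\<^sub>R coord_field A p b q)"
    using coord_field_expand[OF assms(2), of X] by simp
  then show ?thesis using assms(1) by (simp add: linear_sum linear_scale)
qed

text \<open>A product rule that separates the derivative of the field from that of the form: in the
  last term \<open>Y\<close> is frozen to constant components in the chart of \<open>p\<close>, so
  only the form is differentiated.\<close>

lemma dfun_contract:
  fixes \<omega> :: "'m \<Rightarrow> 'e \<Rightarrow> real"
  assumes "open W" "p \<in> W" "\<And>q. linear (\<omega> q)"
    "\<And>v. (\<lambda>q. \<omega> q (coord_field A p v q)) \<in> smooth_funs A (cdom A p \<inter> W)" "Y \<in> vfields A W"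
  shows "dfun A (\<lambda>q. \<omega> q (Y q)) p u = \<omega> p (vder p Y u) + dfun A (\<lambda>q. \<omega> q (coord_field A p (Y p) q)) p u"
proof -
  let ?V = "cdom A p \<inter> W"
  have V: "open ?V" "p \<in> ?V" using assms by auto
  have ex: "\<omega> q (Z q) = (\<Sum>b\<in>Basis. comps p Z b q * \<omega> q (coord_field A p b q))" if "q \<in> ?V" for q Z
    using linear_coord_expand[OF assms(3), of q p q Z] that by simp
  have *: "dfun A (\<lambda>q. \<omega> q (Z q)) p u =
      (\<Sum>b\<in>Basis. (Z p \<bullet> b) * dfun A (\<lambda>q. \<omega> q (coord_field A p b q)) p u) + \<omega> p (vder p Z u)"
    if Z: "Z \<in> vfields A ?V" for Z
  proof -
    have cs: "comps p Z b \<in> smooth_funs A ?V" for b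
      using smooth_funs_comps[OF V(1) Z, of p b] by (simp add: Int_absorb1)
    have "dfun A (\<lambda>q. \<omega> q (Z q)) p u = dfun A (\<lambda>q. \<Sum>b\<in>Basis. comps p Z b q * \<omega> q (coord_field A p b q)) p u"
      by (rule dfun_cong[OF V ex])
    also have "\<dots> = (\<Sum>b\<in>Basis. dfun A (\<lambda>q. comps p Z b q * \<omega> q (coord_field A p b q)) p u)"
      by (rule dfun_sum[OF V(1) smooth_funs_mult[OF V(1) cs assms(4)] V(2)])
    also have "\<dots> = (\<Sum>b\<in>Basis. (Z p \<bullet> b) * dfun A (\<lambda>q. \<omega> q (coord_field A p b q)) p u
        + (vder p Z u \<bullet> b) * \<omega> p b)"
      by (intro sum.cong refl)
         (simp add: dfun_mult[OF cs assms(4) V] comps_center dfun_comps_vder[OF V(1) Z V(2)])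
    also have "\<dots> = (\<Sum>b\<in>Basis. (Z p \<bullet> b) * dfun A (\<lambda>q. \<omega> q (coord_field A p b q)) p u) + \<omega> p (vder p Z u)"
      using linear_euclidean_expand[OF assms(3), of p "vder p Z u"] by (simp add: sum.distrib)
    finally show ?thesis .
  qed
  have "coord_field A p (Y p) \<in> vfields A ?V" "Y \<in> vfields A ?V"
    using vfields_mono[OF vfields_coord_field] vfields_mono[OF assms(5)] by auto
  from *[OF this(1)] *[OF this(2)] show ?thesis using linear_0[OF assms(3)] by simp
qed

lemma dfun_dfun:
  fixes f :: "'m \<Rightarrow> real"
  assumes "open W" "f \<in> smooth_funs A W" "Y \<in> vfields A W" "p \<in> W"
  shows "dfun A (\<lambda>q. dfun A f q (Y q)) p u = dfun A f p (vder p Y u) + dfun A (\<lambda>q. dfun A f q (coord_field A p (Y p) q)) p u"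
proof -
  \<comment> \<open>The contraction rule wants a form that is linear at every point;
    \<open>dfun A f\<close> is known to be linear only on \<open>W\<close>, hence the value 0
    elsewhere.\<close>
  let ?\<omega> = "\<lambda>q v. if q \<in> W then dfun A f q v else 0"
  have lin: "linear (?\<omega> q)" for q
    using linear_dfun[OF assms(2,1)] by (cases "q \<in> W") (auto simp: linear_iff)
  have sm: "(\<lambda>q. ?\<omega> q (coord_field A p v q)) \<in> smooth_funs A (cdom A p \<inter> W)" for v
  proof (subst smooth_funs_cong)
    show "(\<lambda>q. dfun A f q (coord_field A p v q)) \<in> smooth_funs A (cdom A p \<inter> W)"
      using assms(1) by (intro smooth_funs_dfun vfields_mono[OF vfields_coord_field] smooth_funs_mono[OF assms(2)]) auto
  qed (use assms(1) in auto)
  have "dfun A (\<lambda>q. ?\<omega> q (Z q)) p u = dfun A (\<lambda>q. dfun A f q (Z q)) p u" for Z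
    by (rule dfun_cong[OF assms(1,4)]) simp
  with dfun_contract[OF assms(1,4) lin sm assms(3), of u] assms(4) show ?thesis by simp
qed

lemma one_form_linear: "one_form A \<omega> \<Longrightarrow> linear (\<omega> p)"
  and one_form_smooth: "one_form A \<omega> \<Longrightarrow> open W \<Longrightarrow> X \<in> vfields A W \<Longrightarrow> (\<lambda>q. \<omega> q (X q)) \<in> smooth_funs A W"
  by (auto simp: one_form_def)

lemma sym_tensor_bilinear: "sym_tensor A T \<Longrightarrow> bilinear (T p)"
  and sym_tensor_sym: "sym_tensor A T \<Longrightarrow> T p u v = T p v u"
  and sym_tensor_smooth: "sym_tensor A T \<Longrightarrow> open W \<Longrightarrow> X \<in> vfields A W \<Longrightarrow> Y \<in> vfields A W \<Longrightarrow>
     (\<lambda>q. T q (X q) (Y q)) \<in> smooth_funs A W"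
  by (auto simp: sym_tensor_def)

lemma vfields_coord_field_Int: "coord_field A p v \<in> vfields A (cdom A p \<inter> W)"
  by (rule vfields_mono[OF vfields_coord_field]) auto

lemma dfun_one_form:
  assumes "one_form A \<omega>" "open W" "p \<in> W" "Y \<in> vfields A W"
  shows "dfun A (\<lambda>q. \<omega> q (Y q)) p u = \<omega> p (vder p Y u) + dfun A (\<lambda>q. \<omega> q (coord_field A p (Y p) q)) p u"
  using assms by (intro dfun_contract one_form_linear one_form_smooth vfields_coord_field_Int) auto

lemma dfun_sym_tensor:
  assumes "sym_tensor A T" "open W" "p \<in> W" "Y \<in> vfields A W" "Z \<in> vfields A W"
  shows "dfun A (\<lambda>q. T q (Y q) (Z q)) p u = T p (vder p Y u) (Z p) + T p (Y p) (vder p Z u)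
     + dfun A (\<lambda>q. T q (coord_field A p (Y p) q) (coord_field A p (Z p) q)) p u"
proof -
  let ?V = "cdom A p \<inter> W"
  have V: "open ?V" "p \<in> ?V" and vf: "Y \<in> vfields A ?V" "Z \<in> vfields A ?V"
    using assms by (auto intro: vfields_mono)
  have "dfun A (\<lambda>q. T q (Y q) (Z q)) p u = T p (vder p Y u) (Z p) + dfun A (\<lambda>q. T q (coord_field A p (Y p) q) (Z q)) p u"
    by (rule dfun_contract[OF V, where \<omega> = "\<lambda>q v. T q v (Z q)"])
       (use vf V sym_tensor_bilinear[OF assms(1)] in
         \<open>auto simp: bilinear_def intro!: sym_tensor_smooth[OF assms(1)] vfields_coord_field_Int vfields_mono[OF vf(2)]\<close>)
  moreover have "dfun A (\<lambda>q. T q (coord_field A p (Y p) q) (Z q)) p u = T p (coord_field A p (Y p) p) (vder p Z u)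
     + dfun A (\<lambda>q. T q (coord_field A p (Y p) q) (coord_field A p (Z p) q)) p u"
    by (rule dfun_contract[OF V, where \<omega> = "\<lambda>q v. T q (coord_field A p (Y p) q) v"])
       (use vf V sym_tensor_bilinear[OF assms(1)] in
         \<open>auto simp: bilinear_def intro!: sym_tensor_smooth[OF assms(1)] vfields_coord_field_Int\<close>)
  ultimately show ?thesis by simp
qed

end

section \<open>Christoffel symbols of a connection\<close>

locale mfd_connection = smooth_mfd A for A :: "('m::t2_space, 'e::euclidean_space) atlas" +
  fixes D :: "('m \<Rightarrow> 'e) \<Rightarrow> ('m \<Rightarrow> 'e) \<Rightarrow> 'm \<Rightarrow> 'e"
  assumes connection: "connection A D"
begin

definition chris :: "'m \<Rightarrow> 'e \<Rightarrow> 'e \<Rightarrow> 'e" where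
  "chris p u v = D (coord_field A p u) (coord_field A p v) p"

text \<open>The derivative of the Christoffel symbols at \<open>p\<close>. The direction of
  differentiation is the first argument; the other two are the slots of the symbol.\<close>

definition dchris :: "'m \<Rightarrow> 'e \<Rightarrow> 'e \<Rightarrow> 'e \<Rightarrow> 'e" where
  "dchris p u v w = vder p (D (coord_field A p v) (coord_field A p w)) u"

lemmas conn_props = connection[unfolded connection_def, THEN spec, THEN mp, THEN bspec, THEN bspec]
lemmas vfields_conn = conn_props[THEN conjunct1]
lemmas conn_add1 = conn_props[THEN conjunct2, THEN conjunct1, THEN bspec, THEN bspec]
lemmas conn_add2 = conn_props[THEN conjunct2, THEN conjunct2, THEN conjunct1, THEN bspec, THEN bspec]
lemmas conn_scale1 = conn_props[THEN conjunct2, THEN conjunct2, THEN conjunct2, THEN conjunct1, THEN bspec, THEN bspec]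
lemmas conn_scale2 = conn_props[THEN conjunct2, THEN conjunct2, THEN conjunct2, THEN conjunct2, THEN bspec, THEN bspec]

text \<open>Locality follows from the product rules with the function that is 1 on \<open>W\<close> and 0 elsewhere.\<close>

lemma conn_cong:
  assumes "open W" "X \<in> vfields A W" "Y \<in> vfields A W" "p \<in> W"
    "\<And>q. q \<in> W \<Longrightarrow> X' q = X q" "\<And>q. q \<in> W \<Longrightarrow> Y' q = Y q"
  shows "D X' Y' p = D X Y p"
proof -
  let ?f = "\<lambda>q. if q \<in> W then 1 else 0 :: real"
  have f: "?f \<in> smooth_funs A W" by (subst smooth_funs_cong[OF assms(1), of _ "\<lambda>_. 1"]) (auto simp: smooth_funs_const)
  have X': "X' \<in> vfields A W" using vfields_cong[OF assms(1), of X' X] assms by simp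
  have Y': "Y' \<in> vfields A W" using vfields_cong[OF assms(1), of Y' Y] assms by simp
  have d: "dfun A ?f p v = 0" for v
    using dfun_cong[OF assms(1,4), of ?f "\<lambda>_. 1" v] by simp
  have "(\<lambda>q. ?f q *\<^sub>R X' q) = (\<lambda>q. ?f q *\<^sub>R X q)" "(\<lambda>q. ?f q *\<^sub>R Y' q) = (\<lambda>q. ?f q *\<^sub>R Y q)"
    using assms(5,6) by auto
  then have "D X' Y' p = D X Y' p" "D X Y' p = D X Y p"
    using conn_scale1[OF assms(1) X' Y' f assms(4)] conn_scale1[OF assms(1,2) Y' f assms(4)]
      conn_scale2[OF assms(1,2) Y' f assms(4)] conn_scale2[OF assms(1,2,3) f assms(4)] assms(4)
    by (auto simp: d)
  then show ?thesis by simp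
qed

lemma conn_zero1: "open W \<Longrightarrow> Y \<in> vfields A W \<Longrightarrow> p \<in> W \<Longrightarrow> D (\<lambda>_. 0) Y p = 0"
  using conn_scale1[OF _ vfields_zero _ smooth_funs_const[where c=0], of W Y p] by simp

lemma conn_zero2: "open W \<Longrightarrow> X \<in> vfields A W \<Longrightarrow> p \<in> W \<Longrightarrow> D X (\<lambda>_. 0) p = 0"
  using conn_scale2[OF _ _ vfields_zero smooth_funs_const[where c=0], of W X p] by simp

lemma conn_sum1:
  assumes "open W" "\<And>i. i \<in> I \<Longrightarrow> X i \<in> vfields A W" "Y \<in> vfields A W" "p \<in> W"
  shows "D (\<lambda>q. \<Sum>i\<in>I. X i q) Y p = (\<Sum>i\<in>I. D (X i) Y p)"
  using assms(2)
  by (induction I rule: infinite_finite_induct)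
     (auto simp: conn_zero1[OF assms(1,3,4)] conn_add1[OF assms(1) _ assms(3) vfields_sum[OF assms(1)] assms(4)])

lemma conn_sum2:
  assumes "open W" "\<And>i. i \<in> I \<Longrightarrow> Y i \<in> vfields A W" "X \<in> vfields A W" "p \<in> W"
  shows "D X (\<lambda>q. \<Sum>i\<in>I. Y i q) p = (\<Sum>i\<in>I. D X (Y i) p)"
  using assms(2)
  by (induction I rule: infinite_finite_induct)
     (auto simp: conn_zero2[OF assms(1,3,4)] conn_add2[OF assms(1,3) _ vfields_sum[OF assms(1)] assms(4)])

lemma conn_expand1:
  assumes "open W" "X \<in> vfields A W" "Y \<in> vfields A W" "q \<in> W" "q \<in> cdom A p"
  shows "D X Y q = (\<Sum>b\<in>Basis. comps p X b q *\<^sub>R D (coord_field A p b) Y q)"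
proof -
  let ?V = "cdom A p \<inter> W"
  have V: "open ?V" "q \<in> ?V" using assms by auto
  have Y: "Y \<in> vfields A ?V" by (rule vfields_mono[OF assms(3)]) auto
  have cs: "comps p X b \<in> smooth_funs A ?V" for b
    by (rule smooth_funs_comps[OF assms(1,2)])
  have fs: "(\<lambda>q. comps p X b q *\<^sub>R coord_field A p b q) \<in> vfields A ?V" for b
    by (intro vfields_scaleR V cs vfields_coord_field_Int)
  have "D X Y q = D (\<lambda>q. \<Sum>b\<in>Basis. comps p X b q *\<^sub>R coord_field A p b q) Y q"
    by (rule conn_cong[OF V(1) vfields_sum[OF V(1) fs] Y V(2)]) (use coord_field_expand in auto)
  also have "\<dots> = (\<Sum>b\<in>Basis. D (\<lambda>q. comps p X b q *\<^sub>R coord_field A p b q) Y q)"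
    by (rule conn_sum1[OF V(1) fs Y V(2)])
  also have "\<dots> = (\<Sum>b\<in>Basis. comps p X b q *\<^sub>R D (coord_field A p b) Y q)"
    by (intro sum.cong refl conn_scale1[OF V(1) vfields_coord_field_Int Y cs V(2)])
  finally show ?thesis .
qed

lemma conn_expand2:
  assumes "open W" "X \<in> vfields A W" "Y \<in> vfields A W" "q \<in> W" "q \<in> cdom A p"
  shows "D X Y q = (\<Sum>b\<in>Basis. dfun A (comps p Y b) q (X q) *\<^sub>R coord_field A p b q + comps p Y b q *\<^sub>R D X (coord_field A p b) q)"
proof -
  let ?V = "cdom A p \<inter> W"
  have V: "open ?V" "q \<in> ?V" using assms by auto
  have X: "X \<in> vfields A ?V" by (rule vfields_mono[OF assms(2)]) auto
  have cs: "comps p Y b \<in> smooth_funs A ?V" for b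
    by (rule smooth_funs_comps[OF assms(1,3)])
  have fs: "(\<lambda>q. comps p Y b q *\<^sub>R coord_field A p b q) \<in> vfields A ?V" for b
    by (intro vfields_scaleR V cs vfields_coord_field_Int)
  have "D X Y q = D X (\<lambda>q. \<Sum>b\<in>Basis. comps p Y b q *\<^sub>R coord_field A p b q) q"
    by (rule conn_cong[OF V(1) X vfields_sum[OF V(1) fs] V(2)]) (use coord_field_expand in auto)
  also have "\<dots> = (\<Sum>b\<in>Basis. D X (\<lambda>q. comps p Y b q *\<^sub>R coord_field A p b q) q)"
    by (rule conn_sum2[OF V(1) fs X V(2)])
  also have "\<dots> = (\<Sum>b\<in>Basis. dfun A (comps p Y b) q (X q) *\<^sub>R coord_field A p b q + comps p Y b q *\<^sub>R D X (coord_field A p b) q)"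
    by (intro sum.cong refl conn_scale2[OF V(1) X vfields_coord_field_Int cs V(2)])
  finally show ?thesis .
qed

lemma vfields_conn_coord_field: "D (coord_field A p u) (coord_field A p v) \<in> vfields A (cdom A p)"
  by (intro vfields_conn open_cdom vfields_coord_field)

lemma conn_coord_field_linear:
  assumes "q \<in> cdom A p"
  shows "D (coord_field A p u) (coord_field A p v) q =
    (\<Sum>a\<in>Basis. \<Sum>b\<in>Basis. ((u \<bullet> a) * (v \<bullet> b)) *\<^sub>R D (coord_field A p a) (coord_field A p b) q)"
proof -
  have *: "dfun A (comps p (coord_field A p v) b) q w = 0" for b w
    using dfun_cong[OF open_cdom assms, of "comps p (coord_field A p v) b" "\<lambda>_. v \<bullet> b" w] comps_coord_field by simp
  have "D (coord_field A p a) (coord_field A p v) q = (\<Sum>b\<in>Basis. (v \<bullet> b) *\<^sub>R D (coord_field A p a) (coord_field A p b) q)" for a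
    using conn_expand2[OF open_cdom vfields_coord_field vfields_coord_field assms assms, of a v] assms
    by (simp add: * comps_coord_field)
  then show ?thesis
    using conn_expand1[OF open_cdom vfields_coord_field vfields_coord_field assms assms, of u v] assms
    by (simp add: comps_coord_field scaleR_sum_right)
qed

lemma bilinear_euclideanI:
  fixes h :: "'e \<Rightarrow> 'e \<Rightarrow> 'e"
  assumes "\<And>u v. h u v = (\<Sum>a\<in>Basis. \<Sum>b\<in>Basis. ((u \<bullet> a) * (v \<bullet> b)) *\<^sub>R h a b)"
  shows "bilinear h"
proof -
  \<comment> \<open>With a second name on the right-hand side, \<open>h\<close> can be rewritten by
    its own expansion without looping.\<close>
  define k where "k = h"
  have "h = (\<lambda>u v. \<Sum>a\<in>Basis. \<Sum>b\<in>Basis. ((u \<bullet> a) * (v \<bullet> b)) *\<^sub>R k a b)"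
    unfolding k_def using assms by blast
  then show ?thesis
    by (simp add: bilinear_def linear_iff inner_add_left algebra_simps sum.distrib scaleR_sum_right)
qed

lemma bilinear_chris: "bilinear (chris p)"
  by (rule bilinear_euclideanI, unfold chris_def) (rule conn_coord_field_linear[OF mem_cdom])

text \<open>Expanding both fields in the coordinate frame, the first slot contributes values only
  and the second slot also derivatives of its components. The formula is specific to the centre of a
  chart: at another point the chart changes as well.\<close>

lemma conn_chris:
  assumes "open W" "X \<in> vfields A W" "Y \<in> vfields A W" "p \<in> W"
  shows "D X Y p = vder p Y (X p) + chris p (X p) (Y p)"
proof -
  have c: "D X (coord_field A p b) p = chris p (X p) b" for b
    using conn_expand1[OF open_Int[OF open_cdom assms(1)] vfields_mono[OF assms(2)] vfields_coord_field_Int _ mem_cdom, of p p b]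
      assms(4) linear_euclidean_expand[where L="\<lambda>u. chris p u b" and v="X p"] bilinear_chris[of p]
    by (simp add: comps_center chris_def bilinear_def)
  have "D X Y p = (\<Sum>b\<in>Basis. (vder p Y (X p) \<bullet> b) *\<^sub>R b + (Y p \<bullet> b) *\<^sub>R chris p (X p) b)"
    by (subst conn_expand2[OF assms mem_cdom]) (simp add: dfun_comps_vder[OF assms(1,3,4)] comps_center c)
  also have "\<dots> = vder p Y (X p) + chris p (X p) (Y p)"
    using linear_euclidean_expand[of "chris p (X p)" "Y p"] bilinear_chris[of p]
    by (simp add: sum.distrib euclidean_representation bilinear_def)
  finally show ?thesis .
qed

lemma dchris_linear:
  "dchris p u v w = (\<Sum>a\<in>Basis. \<Sum>b\<in>Basis. ((v \<bullet> a) * (w \<bullet> b)) *\<^sub>R dchris p u a b)"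
proof -
  let ?F = "\<lambda>a b. D (coord_field A p a) (coord_field A p b)"
  have s: "vder p (\<lambda>q. c *\<^sub>R ?F a b q) u = c *\<^sub>R vder p (?F a b) u" for a b c
    using vder_scaleR[OF open_cdom smooth_funs_const[where c=c] vfields_conn_coord_field mem_cdom, of p a b u] by simp
  have sv: "(\<lambda>q. c *\<^sub>R ?F a b q) \<in> vfields A (cdom A p)" for a b c
    by (intro vfields_scaleR smooth_funs_const open_cdom vfields_conn_coord_field)
  have "vder p (?F v w) = vder p (\<lambda>q. \<Sum>a\<in>Basis. \<Sum>b\<in>Basis. ((v \<bullet> a) * (w \<bullet> b)) *\<^sub>R ?F a b q)"
    by (rule vder_cong[OF open_cdom mem_cdom conn_coord_field_linear])
  then have "dchris p u v w = (\<Sum>a\<in>Basis. \<Sum>b\<in>Basis. vder p (\<lambda>q. ((v \<bullet> a) * (w \<bullet> b)) *\<^sub>R ?F a b q) u)"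
    by (simp add: dchris_def vder_sum[OF open_cdom _ mem_cdom] vfields_sum[OF open_cdom] sv)
  then show ?thesis by (simp add: s dchris_def)
qed

lemma bilinear_dchris: "bilinear (dchris p u)"
  by (rule bilinear_euclideanI) (rule dchris_linear)

lemma linear_dchris: "linear (\<lambda>u. dchris p u v w)"
  using linear_vder[OF open_cdom vfields_conn_coord_field mem_cdom, of p v w] by (simp add: dchris_def[abs_def])

section \<open>Curvature at a point in terms of Christoffel symbols\<close>

definition hess :: "'m \<Rightarrow> ('m \<Rightarrow> 'e) \<Rightarrow> 'e \<Rightarrow> 'e \<Rightarrow> 'e" where
  "hess p Z u v = (\<Sum>c\<in>Basis. dfun A (\<lambda>q. dfun A (comps p Z c) q (coord_field A p v q)) p u *\<^sub>R c)"

lemma hess_sym: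
  assumes "open W" "Z \<in> vfields A W" "p \<in> W" shows "hess p Z u v = hess p Z v u"
  unfolding hess_def
  by (intro sum.cong refl arg_cong2[where f=scaleR] dfun_symmetric[OF _ smooth_funs_comps[OF assms(1,2)]])
     (use assms in auto)

text \<open>Differentiating the covariant derivative needs an expression valid near
  \<open>p\<close>, which \<open>conn_chris\<close> does not give. So it is expanded in the
  coordinate frame of the one chart of \<open>p\<close> and differentiated term by term.\<close>

lemma vder_conn:
  assumes "open W" "Y \<in> vfields A W" "Z \<in> vfields A W" "p \<in> W"
  shows "vder p (D Y Z) u = vder p Z (vder p Y u) + hess p Z u (Y p)
    + chris p (Y p) (vder p Z u) + chris p (vder p Y u) (Z p) + dchris p u (Y p) (Z p)"
proof -
  let ?V = "cdom A p \<inter> W"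
  let ?c = "comps p"
  let ?E = "coord_field A p"
  have V: "open ?V" "p \<in> ?V" using assms by auto
  have vf: "Y \<in> vfields A ?V" "Z \<in> vfields A ?V" by (auto intro: vfields_mono assms)
  note E = vfields_coord_field_Int[of p _ W]
  have cs: "?c Y b \<in> smooth_funs A ?V" "?c Z b \<in> smooth_funs A ?V" for b
    using smooth_funs_comps[OF assms(1,2)] smooth_funs_comps[OF assms(1,3)] by auto
  have lin: "linear (chris p w)" "linear (\<lambda>w'. chris p w' w)" "linear (dchris p w w')" "linear (\<lambda>v. dchris p w v w')" for w w'
    using bilinear_chris[of p] bilinear_dchris[of p w] by (auto simp: bilinear_def)
  have f1: "(\<lambda>q. dfun A (?c Z b) q (Y q)) \<in> smooth_funs A ?V" for b
    by (rule smooth_funs_dfun[OF V(1) cs(2) vf(1)])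
  have d1: "vder p (\<lambda>q. dfun A (?c Z b) q (Y q) *\<^sub>R ?E b q) u
      = (vder p Z (vder p Y u) \<bullet> b) *\<^sub>R b + dfun A (\<lambda>q. dfun A (?c Z b) q (?E (Y p) q)) p u *\<^sub>R b" for b
    using vder_scaleR[OF V(1) f1 E V(2)] dfun_dfun[OF V(1) cs(2) vf(1) V(2)]
      dfun_comps_vder[OF V(1) vf(2) V(2)] by (simp add: algebra_simps)
  have d2: "vder p (D Y (?E b)) u = chris p (vder p Y u) b + dchris p u (Y p) b" for b
  proof -
    have "vder p (D Y (?E b)) = vder p (\<lambda>q. \<Sum>a\<in>Basis. ?c Y a q *\<^sub>R D (?E a) (?E b) q)"
      by (rule vder_cong[OF V conn_expand1[OF V(1) vf(1) E]]) auto
    then have "vder p (D Y (?E b)) u = (\<Sum>a\<in>Basis. vder p (\<lambda>q. ?c Y a q *\<^sub>R D (?E a) (?E b) q) u)"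
      by (simp add: vder_sum[OF V(1) _ V(2)] vfields_scaleR[OF V(1) cs(1) vfields_conn[OF V(1) E E]])
    also have "\<dots> = (\<Sum>a\<in>Basis. (Y p \<bullet> a) *\<^sub>R dchris p u a b + (vder p Y u \<bullet> a) *\<^sub>R chris p a b)"
      by (simp add: vder_scaleR[OF V(1) cs(1) vfields_conn[OF V(1) E E] V(2)] comps_center
          dfun_comps_vder[OF V(1) vf(1) V(2)] dchris_def chris_def)
    also have "\<dots> = chris p (vder p Y u) b + dchris p u (Y p) b"
      using linear_euclidean_expand[OF lin(2), of "vder p Y u" b] linear_euclidean_expand[OF lin(4), of u "Y p" b]
      by (simp add: sum.distrib add.commute)
    finally show ?thesis .
  qed
  have d3: "vder p (\<lambda>q. ?c Z b q *\<^sub>R D Y (?E b) q) u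
     = (Z p \<bullet> b) *\<^sub>R (chris p (vder p Y u) b + dchris p u (Y p) b) + (vder p Z u \<bullet> b) *\<^sub>R chris p (Y p) b" for b
    using vder_scaleR[OF V(1) cs(2) vfields_conn[OF V(1) vf(1) E] V(2)] conn_chris[OF V(1) vf(1) E V(2)] d2
    by (simp add: comps_center dfun_comps_vder[OF V(1) vf(2) V(2)])
  have v1: "(\<lambda>q. dfun A (?c Z b) q (Y q) *\<^sub>R ?E b q) \<in> vfields A ?V" for b
    by (rule vfields_scaleR[OF V(1) f1 E])
  have v2: "(\<lambda>q. ?c Z b q *\<^sub>R D Y (?E b) q) \<in> vfields A ?V" for b
    by (rule vfields_scaleR[OF V(1) cs(2) vfields_conn[OF V(1) vf(1) E]])
  have "vder p (D Y Z) = vder p (\<lambda>q. \<Sum>b\<in>Basis. dfun A (?c Z b) q (Y q) *\<^sub>R ?E b q + ?c Z b q *\<^sub>R D Y (?E b) q)"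
    by (rule vder_cong[OF V conn_expand2[OF V(1) vf]]) auto
  then have "vder p (D Y Z) u = (\<Sum>b\<in>Basis. vder p (\<lambda>q. dfun A (?c Z b) q (Y q) *\<^sub>R ?E b q) u + vder p (\<lambda>q. ?c Z b q *\<^sub>R D Y (?E b) q) u)"
    by (simp add: vder_sum[OF V(1) _ V(2)] vfields_add[OF V(1) v1 v2] vder_add[OF V(1) v1 v2 V(2)])
  also have "\<dots> = (\<Sum>b\<in>Basis. (vder p Z (vder p Y u) \<bullet> b) *\<^sub>R b) + hess p Z u (Y p)
     + (\<Sum>b\<in>Basis. (Z p \<bullet> b) *\<^sub>R chris p (vder p Y u) b) + (\<Sum>b\<in>Basis. (Z p \<bullet> b) *\<^sub>R dchris p u (Y p) b)
     + (\<Sum>b\<in>Basis. (vder p Z u \<bullet> b) *\<^sub>R chris p (Y p) b)"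
    by (simp add: d1 d3 hess_def sum.distrib scaleR_add_right)
  also have "\<dots> = vder p Z (vder p Y u) + hess p Z u (Y p)
     + chris p (vder p Y u) (Z p) + dchris p u (Y p) (Z p) + chris p (Y p) (vder p Z u)"
    by (simp only: linear_euclidean_expand[OF lin(1), symmetric] linear_euclidean_expand[OF lin(3), symmetric] euclidean_representation)
  finally show ?thesis by (simp add: add_ac)
qed

definition curv_at :: "'m \<Rightarrow> 'e \<Rightarrow> 'e \<Rightarrow> 'e \<Rightarrow> 'e" where
  "curv_at p u v w = - (dchris p u v w - dchris p v u w + chris p u (chris p v w) - chris p v (chris p u w))"

text \<open>The second derivatives of \<open>Z\<close> cancel by \<open>hess_sym\<close>, and its
  first derivatives cancel against the bracket term, so only the values of the three fields at
  \<open>p\<close> survive.\<close>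

lemma curv_curv_at:
  assumes "open W" "X \<in> vfields A W" "Y \<in> vfields A W" "Z \<in> vfields A W" "p \<in> W"
    "lie_bracket A X Y \<in> vfields A W"
  shows "curv A D X Y Z p = curv_at p (X p) (Y p) (Z p)"
proof -
  have lin: "linear (chris p w)" "linear (\<lambda>w'. chris p w' w)" for w
    using bilinear_chris[of p] by (auto simp: bilinear_def)
  have "D X (D Y Z) p = vder p (D Y Z) (X p) + chris p (X p) (D Y Z p)"
    "D Y (D X Z) p = vder p (D X Z) (Y p) + chris p (Y p) (D X Z p)"
    "D (lie_bracket A X Y) Z p = vder p Z (lie_bracket A X Y p) + chris p (lie_bracket A X Y p) (Z p)"
    using assms by (auto intro!: conn_chris vfields_conn)
  then show ?thesis
    unfolding curv_def curv_at_def
    using vder_conn[OF assms(1,3,4,5), of "X p"] vder_conn[OF assms(1,2,4,5), of "Y p"] hess_sym[OF assms(1,4,5), of "X p" "Y p"]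
      conn_chris[OF assms(1,3,4,5)] conn_chris[OF assms(1,2,4,5)]
    by (simp add: lie_bracket_vder linear_diff[OF lin(1)] linear_diff[OF lin(2)] linear_add[OF lin(1)]
       linear_diff[OF linear_vder[OF assms(1,4,5)]])
qed

lemma linear_curv_at: "linear (\<lambda>u. curv_at p u v w)" "linear (\<lambda>v. curv_at p u v w)" "linear (curv_at p u v)"
proof -
  have lin: "linear (chris p w)" "linear (\<lambda>w'. chris p w' w)" "linear (dchris p w w')" "linear (\<lambda>v. dchris p w v w')"
    "linear (\<lambda>v. dchris p v w w')" for w w'
    using bilinear_chris[of p] bilinear_dchris[of p w] linear_dchris by (auto simp: bilinear_def)
  note l = lin[THEN linear_add] lin[THEN linear_scale]
  show "linear (\<lambda>u. curv_at p u v w)" "linear (\<lambda>v. curv_at p u v w)" "linear (curv_at p u v)"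
    unfolding curv_at_def by (rule linearI; simp add: l algebra_simps)+
qed

text \<open>The derivative of \<open>Y\<close> produced by the product rule cancels against the one
  in the connection. Hence fields may be replaced by coordinate fields with the same value at
  \<open>p\<close>.\<close>

lemma cov1_tensor:
  assumes "one_form A \<omega>" "open W" "X \<in> vfields A W" "Y \<in> vfields A W" "p \<in> W"
  shows "cov1 A D \<omega> X Y p = cov1 A D \<omega> (coord_field A p (X p)) (coord_field A p (Y p)) p"
  using dfun_one_form[OF assms(1,2,5,4)] conn_chris[OF assms(2,3,4,5)]
  by (simp add: cov1_def chris_def linear_add[OF one_form_linear[OF assms(1)]])

lemma cov2_tensor:
  assumes "sym_tensor A T" "open W" "X \<in> vfields A W" "Y \<in> vfields A W" "Z \<in> vfields A W" "p \<in> W"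
  shows "cov2 A D T X Y Z p = cov2 A D T (coord_field A p (X p)) (coord_field A p (Y p)) (coord_field A p (Z p)) p"
  using dfun_sym_tensor[OF assms(1,2,6,4,5)] conn_chris[OF assms(2,3,4,6)] conn_chris[OF assms(2,3,5,6)]
    sym_tensor_bilinear[OF assms(1), of p]
  by (simp add: cov2_def chris_def bilinear_ladd bilinear_radd)

end


section \<open>Lightlike metrics\<close>

lemma linear_eq_BasisI:
  fixes f g :: "'e::euclidean_space \<Rightarrow> 'b::real_vector"
  assumes "linear f" "linear g" "\<And>b. b \<in> Basis \<Longrightarrow> f b = g b" shows "f v = g v"
  using linear_euclidean_expand[OF assms(1), of v] linear_euclidean_expand[OF assms(2), of v] assms(3) by simp

lemma linear_sum_Basis:
  fixes f :: "'e::euclidean_space \<Rightarrow> real"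
  assumes "linear f" shows "(\<Sum>b\<in>Basis. f b * (z \<bullet> b)) = f z"
  using linear_euclidean_expand[OF assms, of z] by (simp add: mult.commute)

text \<open>\<open>L t\<close> has the values of \<open>h t\<close> on \<open>Basis\<close> as
  coordinates; nondegeneracy makes this endomorphism injective, hence surjective in finite
  dimension.\<close>

lemma ex1_representative:
  fixes h :: "'e::euclidean_space \<Rightarrow> 'e \<Rightarrow> real"
  assumes "bilinear h" "\<And>t. (\<And>v. h t v = 0) \<Longrightarrow> t = 0" "linear \<omega>"
  shows "\<exists>!t. \<forall>v. h t v = \<omega> v"
proof -
  define L where "L t = (\<Sum>b\<in>Basis. h t b *\<^sub>R b)" for t
  have lin: "linear (\<lambda>t. h t v)" "linear (h t)" for t v using assms(1) by (auto simp: bilinear_def)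
  have linL: "linear L"
    unfolding L_def linear_iff
    by (simp add: linear_add[OF lin(1)] linear_scale[OF lin(1)] scaleR_add_left sum.distrib scaleR_sum_right)
  have Lb: "L t \<bullet> b = h t b" if "b \<in> Basis" for t b
    using that by (simp add: L_def inner_sum_left inner_Basis if_distrib cong: if_cong)
  have "inj L"
  proof (rule linear_injective_0[OF linL, THEN iffD2], intro allI impI)
    fix t assume "L t = 0"
    then have "h t b = 0" if "b \<in> Basis" for b using Lb[OF that, of t] by simp
    then have "h t v = 0" for v using linear_eq_BasisI[OF lin(2) linear_zero] by blast
    then show "t = 0" by (rule assms(2))
  qed
  then have "surj L" using linear_injective_imp_surjective[OF linL] by simp
  then obtain t where t: "L t = (\<Sum>b\<in>Basis. \<omega> b *\<^sub>R b)" by (metis surjD)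
  have "h t b = \<omega> b" if "b \<in> Basis" for b
    using Lb[OF that, of t] that by (simp add: t inner_sum_left inner_Basis if_distrib cong: if_cong)
  then have "h t v = \<omega> v" for v using linear_eq_BasisI[OF lin(2) assms(3)] by blast
  moreover have "s = t" if "\<forall>v. h s v = \<omega> v" for s
  proof -
    have "h (s - t) v = 0" for v using that calculation linear_diff[OF lin(1)] by simp
    then have "s - t = 0" by (rule assms(2))
    then show ?thesis by simp
  qed
  ultimately show ?thesis by blast
qed

text \<open>In the dual frame of \<open>g + \<eta> \<otimes> \<eta>\<close> a \<open>g\<close>-skew map contributes nothing to the \<open>g\<close>-part of the trace.\<close>

lemma trace_skew_degenerate:
  fixes g :: "'e::euclidean_space \<Rightarrow> 'e \<Rightarrow> real"
  assumes g: "bilinear g" "\<And>u v. g u v = g v u" and \<eta>: "linear \<eta>"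
    and nd: "\<And>t. (\<And>v. g t v + \<eta> t * \<eta> v = 0) \<Longrightarrow> t = 0"
    and \<xi>: "\<And>v. g \<xi> v = 0" "\<eta> \<xi> = 1"
    and L: "linear L" "\<And>u v. g (L u) v + g u (L v) = 0" "L \<xi> = c *\<^sub>R \<xi>"
  shows "(\<Sum>b\<in>Basis. L b \<bullet> b) = c"
proof -
  let ?h = "\<lambda>u v. g u v + \<eta> u * \<eta> v"
  have lg: "linear (g u)" "linear (\<lambda>u. g u v)" for u v using g(1) by (auto simp: bilinear_def)
  have bh: "bilinear ?h"
    unfolding bilinear_def linear_iff
    by (simp add: linear_add[OF lg(1)] linear_add[OF lg(2)] linear_scale[OF lg(1)] linear_scale[OF lg(2)]
       linear_add[OF \<eta>] linear_scale[OF \<eta>] algebra_simps)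
  have "\<exists>t. \<forall>v. ?h t v = b \<bullet> v" for b
    using ex1_representative[OF bh nd, of "\<lambda>v. b \<bullet> v"] bounded_linear.linear[OF bounded_linear_inner_right] by blast
  \<comment> \<open>\<open>d b\<close> represents the coordinate functional of \<open>b\<close>; its
    coordinates form the inverse matrix of \<open>?h\<close>, which is symmetric because
    \<open>?h\<close> is.\<close>
  then obtain d where d: "\<And>b v. ?h (d b) v = b \<bullet> v" by metis
  have sym: "d b \<bullet> c = d c \<bullet> b" for b c
    using d[of c "d b"] d[of b "d c"] by (simp add: g(2) inner_commute mult.commute)
  have e1: "L b \<bullet> b = g (L b) (d b) + \<eta> (L b) * \<eta> (d b)" for b
    using d[of b "L b"] by (simp add: g(2) inner_commute mult.commute)
  have e2: "\<eta> (d b) = \<xi> \<bullet> b" for b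
    using d[of b \<xi>] g(2)[of "d b" \<xi>] \<xi> by (simp add: inner_commute)
  \<comment> \<open>Symmetry of the inverse matrix moves \<open>d\<close> from one argument to the
    other, and skewness of \<open>L\<close> then shows that the sum equals its own negative.\<close>
  have "(\<Sum>b\<in>Basis. g (L b) (d b)) = (\<Sum>b\<in>Basis. \<Sum>c\<in>Basis. g (L b) c * (d b \<bullet> c))"
    by (simp add: linear_sum_Basis[OF lg(1)])
  also have "\<dots> = (\<Sum>c\<in>Basis. \<Sum>b\<in>Basis. g (L b) c * (d c \<bullet> b))"
    by (subst sum.swap) (simp add: sym)
  also have "\<dots> = (\<Sum>c\<in>Basis. g (L (d c)) c)"
    using linear_compose[OF L(1) lg(2)] by (simp add: linear_sum_Basis o_def)
  also have "\<dots> = - (\<Sum>c\<in>Basis. g (L c) (d c))"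
    unfolding sum_negf[symmetric]
  proof (rule sum.cong[OF refl])
    fix c show "g (L (d c)) c = - g (L c) (d c)" using L(2)[of "d c" c] g(2)[of "d c" "L c"] by linarith
  qed
  finally have z: "(\<Sum>b\<in>Basis. g (L b) (d b)) = 0" by simp
  have "(\<Sum>b\<in>Basis. L b \<bullet> b) = (\<Sum>b\<in>Basis. \<eta> (L b) * (\<xi> \<bullet> b))"
    by (simp add: e1 e2 sum.distrib z)
  also have "\<dots> = \<eta> (L \<xi>)" using linear_compose[OF L(1) \<eta>] by (simp add: linear_sum_Basis o_def)
  finally show ?thesis by (simp add: L(3) linear_scale[OF \<eta>] \<xi>)
qed

text \<open>One metric of the conformal class with its connection. \<xi> and \<eta> serve all
  metrics of the class, since rescaling keeps the kernel. \<open>g_nonzero\<close> is what allows a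
  form to be recovered from its product with \<open>g\<close>.\<close>

locale lightlike = smooth_mfd A for A :: "('m::t2_space, 'e::euclidean_space) atlas" +
  fixes n :: nat and g :: "'m \<Rightarrow> 'e \<Rightarrow> 'e \<Rightarrow> real" and \<xi> :: "'m \<Rightarrow> 'e" and \<eta> :: "'m \<Rightarrow> 'e \<Rightarrow> real"
    and Dg :: "('m \<Rightarrow> 'e) \<Rightarrow> ('m \<Rightarrow> 'e) \<Rightarrow> 'm \<Rightarrow> 'e" and \<phi> :: "'m \<Rightarrow> 'e \<Rightarrow> real"
  assumes dim: "DIM('e) = n + 1"
    and g: "sym_tensor A g"
    and kernel: "\<And>p v. (\<And>w. g p v w = 0) \<Longrightarrow> \<exists>c. v = c *\<^sub>R \<xi> p"
    and g_xi: "\<And>p w. g p (\<xi> p) w = 0"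
    and g_nonzero: "\<And>p. \<exists>u v. g p u v \<noteq> 0"
    and xi: "\<xi> \<in> vfields A UNIV"
    and eta: "one_form A \<eta>" "\<And>p. \<eta> p (\<xi> p) = 1"
    and Dg_connection: "connection A Dg"
    and Dg_torsion_free: "torsion_free A Dg"
    and Dg_metric: "metric_connection A g Dg"
    and Dg_xi_xi: "\<And>p. Dg \<xi> \<xi> p = 0"
    and phi: "one_form A \<phi>"
    and Dg_xi: "\<And>W X p. open W \<Longrightarrow> X \<in> vfields A W \<Longrightarrow> p \<in> W \<Longrightarrow> Dg X \<xi> p = \<phi> p (X p) *\<^sub>R \<xi> p"

sublocale lightlike \<subseteq> G: mfd_connection A Dg
  by unfold_locales (rule Dg_connection)

context lightlike begin

lemma xi_vfields: "\<xi> \<in> vfields A W"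
  by (rule vfields_mono[OF xi]) simp

lemma phi_xi: "\<phi> p (\<xi> p) = 0"
  using Dg_xi[OF open_UNIV xi UNIV_I, of p] Dg_xi_xi[of p] eta(2)[of p] linear_0[OF one_form_linear[OF eta(1)], of p]
  by (metis scaleR_eq_0_iff zero_neq_one)

text \<open>Smoothness is read off a torsion-free connection: the bracket is a difference of two
  covariant derivatives.\<close>

lemma lie_bracket_vfields:
  assumes "open W" "X \<in> vfields A W" "Y \<in> vfields A W" shows "lie_bracket A X Y \<in> vfields A W"
proof (subst vfields_cong[OF assms(1)])
  show "(\<lambda>q. Dg X Y q - Dg Y X q) \<in> vfields A W"
    by (intro vfields_diff G.vfields_conn assms)
qed (use assms Dg_torsion_free in \<open>auto simp: torsion_free_def\<close>)

lemma Dg_sym_coord: "q \<in> cdom A p \<Longrightarrow> Dg (coord_field A p u) (coord_field A p v) q = Dg (coord_field A p v) (coord_field A p u) q"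
  using Dg_torsion_free[unfolded torsion_free_def, rule_format, OF open_cdom vfields_coord_field vfields_coord_field]
    lie_bracket_coord_field by (metis eq_iff_diff_eq_0)

lemma chris_sym: "G.chris p u v = G.chris p v u"
  by (simp add: G.chris_def Dg_sym_coord)

lemma dchris_sym: "G.dchris p u v w = G.dchris p u w v"
  unfolding G.dchris_def by (rule fun_cong[OF vder_cong[OF open_cdom mem_cdom Dg_sym_coord]])

lemma Dg_metric':
  assumes "open W" "X \<in> vfields A W" "Y \<in> vfields A W" "Z \<in> vfields A W" "p \<in> W"
  shows "dfun A (\<lambda>q. g q (Y q) (Z q)) p (X p) = g p (Dg X Y p) (Z p) + g p (Y p) (Dg X Z p)"
  using Dg_metric assms unfolding metric_connection_def cov2_def by force

lemma curv_curv_at_Dg: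
  assumes "open W" "X \<in> vfields A W" "Y \<in> vfields A W" "Z \<in> vfields A W" "p \<in> W"
  shows "curv A Dg X Y Z p = G.curv_at p (X p) (Y p) (Z p)"
  using G.curv_curv_at[OF assms lie_bracket_vfields[OF assms(1-3)]] .

text \<open>The coordinate fields of \<open>p\<close> take the basis vectors themselves as values at
  \<open>p\<close>. \<open>D\<close> is arbitrary here so that both connections can be
  compared.\<close>

lemma ricci_trace:
  assumes "mfd_connection A D" "open W" "X \<in> vfields A W" "Y \<in> vfields A W" "p \<in> W"
  shows "ricci A D X Y p = (\<Sum>b\<in>Basis. mfd_connection.curv_at A D p (X p) b (Y p) \<bullet> b)"
proof -
  interpret D: mfd_connection A D by (rule assms(1))
  let ?V = "cdom A p \<inter> W"
  have V: "open ?V" "p \<in> ?V" "X \<in> vfields A ?V" "Y \<in> vfields A ?V"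
    using assms by (auto intro: vfields_mono)
  show ?thesis
    unfolding ricci_def
    using D.curv_curv_at[OF V(1,3) vfields_coord_field_Int V(4,2) lie_bracket_vfields[OF V(1,3) vfields_coord_field_Int]]
    by simp
qed

text \<open>Differentiating \<phi>(Y) \<xi> yields products \<phi>(X) \<phi>(Y) that cancel under
  exchange of \<open>X\<close> and \<open>Y\<close>; the rest is the exterior derivative, with 2
  compensating the factor 1/2 in \<open>ext_d\<close>.\<close>

lemma curv_xi:
  assumes "open W" "X \<in> vfields A W" "Y \<in> vfields A W" "p \<in> W"
  shows "curv A Dg X Y \<xi> p = (- 2 * ext_d A \<phi> X Y p) *\<^sub>R \<xi> p"
proof -
  have *: "Dg X (Dg Y \<xi>) p = (dfun A (\<lambda>q. \<phi> q (Y q)) p (X p) + \<phi> p (Y p) * \<phi> p (X p)) *\<^sub>R \<xi> p"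
    if X: "X \<in> vfields A W" and Y: "Y \<in> vfields A W" for X Y
  proof -
    have f: "(\<lambda>q. \<phi> q (Y q)) \<in> smooth_funs A W" by (rule one_form_smooth[OF phi assms(1) Y])
    have "Dg X (Dg Y \<xi>) p = Dg X (\<lambda>q. \<phi> q (Y q) *\<^sub>R \<xi> q) p"
      by (rule G.conn_cong[OF assms(1) X vfields_scaleR[OF assms(1) f xi_vfields] assms(4)])
         (use Dg_xi[OF assms(1) Y] in auto)
    also have "\<dots> = (dfun A (\<lambda>q. \<phi> q (Y q)) p (X p) + \<phi> p (Y p) * \<phi> p (X p)) *\<^sub>R \<xi> p"
      using G.conn_scale2[OF assms(1) X xi_vfields f assms(4)] Dg_xi[OF assms(1) X assms(4)]
      by (simp add: scaleR_add_left)
    finally show ?thesis .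
  qed
  have "Dg (lie_bracket A X Y) \<xi> p = \<phi> p (lie_bracket A X Y p) *\<^sub>R \<xi> p"
    by (rule Dg_xi[OF assms(1) lie_bracket_vfields[OF assms(1-3)] assms(4)])
  then have "curv A Dg X Y \<xi> p = (\<phi> p (lie_bracket A X Y p) - ((dfun A (\<lambda>q. \<phi> q (Y q)) p (X p) + \<phi> p (Y p) * \<phi> p (X p))
       - (dfun A (\<lambda>q. \<phi> q (X q)) p (Y p) + \<phi> p (X p) * \<phi> p (Y p)))) *\<^sub>R \<xi> p"
    by (simp only: curv_def *[OF assms(2,3)] *[OF assms(3,2)] scaleR_diff_left)
  also have "\<dots> = (- 2 * ext_d A \<phi> X Y p) *\<^sub>R \<xi> p"
    by (rule arg_cong[where f="\<lambda>c. c *\<^sub>R \<xi> p"]) (simp add: ext_d_def)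
  finally show ?thesis .
qed

text \<open>Second derivatives of g(E_a, E_b) along two coordinate fields commute. Writing them with
  the metric connection, the products of first derivatives cancel and the commutators on
  \<open>a\<close> and \<open>b\<close> remain; the coordinate fields commute, so these are the
  curvature.\<close>

lemma curv_skew: "g p (G.curv_at p u v a) b + g p a (G.curv_at p u v b) = 0"
proof -
  let ?E = "coord_field A p" and ?U = "cdom A p"
  note E = vfields_coord_field[of p] and o = open_cdom[of p] and m = mem_cdom[of p]
  note EE = G.vfields_conn[OF o E E]
  have s: "(\<lambda>q. g q (X q) (Y q)) \<in> smooth_funs A ?U" if "X \<in> vfields A ?U" "Y \<in> vfields A ?U" for X Y
    by (rule sym_tensor_smooth[OF g o that])
  have second: "dfun A (\<lambda>q. dfun A (\<lambda>q. g q (?E a q) (?E b q)) q (?E v q)) p u =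
     g p (Dg (?E u) (Dg (?E v) (?E a)) p) b + g p (Dg (?E v) (?E a) p) (Dg (?E u) (?E b) p)
     + g p (Dg (?E u) (?E a) p) (Dg (?E v) (?E b) p) + g p a (Dg (?E u) (Dg (?E v) (?E b)) p)" for u v
  proof -
    have "dfun A (\<lambda>q. dfun A (\<lambda>q. g q (?E a q) (?E b q)) q (?E v q)) p u =
       dfun A (\<lambda>q. g q (Dg (?E v) (?E a) q) (?E b q) + g q (?E a q) (Dg (?E v) (?E b) q)) p u"
      by (rule dfun_cong[OF o m]) (rule Dg_metric'[OF o E E E])
    also have "\<dots> = dfun A (\<lambda>q. g q (Dg (?E v) (?E a) q) (?E b q)) p (?E u p)
        + dfun A (\<lambda>q. g q (?E a q) (Dg (?E v) (?E b) q)) p (?E u p)"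
      using dfun_add[OF s[OF EE E] s[OF E EE] o m] by simp
    finally show ?thesis
      using Dg_metric'[OF o E[of u] EE[of v a] E[of b] m] Dg_metric'[OF o E[of u] E[of a] EE[of v b] m] by simp
  qed
  have c: "G.curv_at p u v w = Dg (?E v) (Dg (?E u) (?E w)) p - Dg (?E u) (Dg (?E v) (?E w)) p" for w
  proof -
    have "Dg (lie_bracket A (?E u) (?E v)) (?E w) p = Dg (\<lambda>_. 0) (?E w) p"
      by (rule G.conn_cong[OF o vfields_zero E m]) (auto simp: lie_bracket_coord_field)
    then show ?thesis
      using curv_curv_at_Dg[OF o E E E m, of u v w] G.conn_zero1[OF o E m] by (simp add: curv_def)
  qed
  have "dfun A (\<lambda>q. dfun A (\<lambda>q. g q (?E a q) (?E b q)) q (?E v q)) p u =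
        dfun A (\<lambda>q. dfun A (\<lambda>q. g q (?E a q) (?E b q)) q (?E u q)) p v"
    by (rule dfun_symmetric[OF o s[OF E E] m])
  then show ?thesis
    unfolding second c using sym_tensor_bilinear[OF g, of p] by (simp add: bilinear_lsub bilinear_rsub)
qed

lemma gtilde_bilinear: "bilinear (gtilde g \<eta> p)"
  using sym_tensor_bilinear[OF g, of p] one_form_linear[OF eta(1), of p]
  unfolding gtilde_def bilinear_def linear_iff by (simp add: algebra_simps)

lemma gtilde_sym: "gtilde g \<eta> p u v = gtilde g \<eta> p v u"
  using sym_tensor_sym[OF g] by (simp add: gtilde_def)

lemma gtilde_xi: "gtilde g \<eta> p u (\<xi> p) = \<eta> p u"
  using g_xi[of p u] sym_tensor_sym[OF g, of p u "\<xi> p"] by (simp add: gtilde_def eta)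

text \<open>Testing against \<xi> gives \<eta>(t) = 0; then \<open>t\<close> lies in the kernel of
  \<open>g\<close>, and a multiple of \<xi> killed by \<eta> is zero.\<close>

lemma gtilde_nondegenerate:
  assumes "\<And>v. gtilde g \<eta> p t v = 0" shows "t = 0"
proof -
  have e: "\<eta> p t = 0" using assms[of "\<xi> p"] gtilde_xi by simp
  then have "g p t w = 0" for w using assms[of w] by (simp add: gtilde_def)
  then obtain c where "t = c *\<^sub>R \<xi> p" using kernel by blast
  then show ?thesis using e linear_scale[OF one_form_linear[OF eta(1)]] by (simp add: eta)
qed

lemma gtilde_sharp:
  assumes "linear (\<omega> p)" shows "gtilde g \<eta> p (sharp g \<eta> \<omega> p) v = \<omega> p v"
proof -
  have "\<exists>!t. \<forall>v. gtilde g \<eta> p t v = \<omega> p v"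
    by (rule ex1_representative[OF gtilde_bilinear _ assms]) (rule gtilde_nondegenerate)
  from theI'[OF this] show ?thesis by (simp add: sharp_def)
qed

lemma ricci_Dg_skew:
  assumes "open W" "X \<in> vfields A W" "Y \<in> vfields A W" "p \<in> W"
  shows "ricci A Dg X Y p - ricci A Dg Y X p = - 2 * ext_d A \<phi> X Y p"
proof -
  let ?R = "G.curv_at p"
  \<comment> \<open>The first Bianchi identity in coordinates: derivative terms and quadratic terms
    cancel by the symmetry of the Christoffel symbols. Its trace over \<open>b\<close> is Ric(x, y)
    - Ric(y, x).\<close>
  have cyc: "?R x b y - ?R y b x = ?R x y b" for x y b
  proof -
    have e: "G.dchris p x b y = G.dchris p x y b" "G.dchris p y b x = G.dchris p y x b" "G.dchris p b x y = G.dchris p b y x"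
      "G.chris p b y = G.chris p y b" "G.chris p b x = G.chris p x b" "G.chris p x y = G.chris p y x"
      by (rule dchris_sym chris_sym)+
    show ?thesis unfolding G.curv_at_def e by simp
  qed
  have "ricci A Dg X Y p - ricci A Dg Y X p = (\<Sum>b\<in>Basis. ?R (X p) (Y p) b \<bullet> b)"
    using ricci_trace[OF G.mfd_connection_axioms assms] ricci_trace[OF G.mfd_connection_axioms assms(1,3,2,4)]
    by (simp add: sum_subtractf[symmetric] inner_diff_left[symmetric] cyc)
  also have "\<dots> = - 2 * ext_d A \<phi> X Y p"
  proof (rule trace_skew_degenerate[where g="g p" and \<eta>="\<eta> p" and \<xi>="\<xi> p"])
    show "\<And>t. (\<And>v. g p t v + \<eta> p t * \<eta> p v = 0) \<Longrightarrow> t = 0"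
      using gtilde_nondegenerate[of p] by (simp add: gtilde_def)
    show "?R (X p) (Y p) (\<xi> p) = (- 2 * ext_d A \<phi> X Y p) *\<^sub>R \<xi> p"
      using curv_xi[OF assms] curv_curv_at_Dg[OF assms(1-3) xi_vfields assms(4)] by simp
  qed (use sym_tensor_bilinear[OF g] sym_tensor_sym[OF g] one_form_linear[OF eta(1)] g_xi eta(2) curv_skew G.linear_curv_at in auto)
  finally show ?thesis .
qed

text \<open>Contracting with the inverse of \<open>gtilde\<close> undoes the contraction with
  \<open>gtilde\<close>, so the divergence is the ordinary trace of the covariant
  derivative.\<close>

lemma codiff_trace:
  shows "codiff A g \<eta> Dg \<theta> p = (\<Sum>b\<in>Basis. Dg (coord_field A p b) (sharp g \<eta> \<theta>) p \<bullet> b)"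
  unfolding codiff_def divergence_def
proof (rule sum.cong[OF refl])
  fix a :: 'e
  let ?w = "Dg (coord_field A p a) (sharp g \<eta> \<theta>) p" and ?s = "sharp g \<eta> (\<lambda>_ v. a \<bullet> v) p"
  have "linear (gtilde g \<eta> p ?w)" using gtilde_bilinear by (auto simp: bilinear_def)
  then have "(\<Sum>b\<in>Basis. ginv g \<eta> p a b * gtilde g \<eta> p ?w b) = gtilde g \<eta> p ?w ?s"
    using linear_sum_Basis[of "gtilde g \<eta> p ?w" ?s] by (simp add: ginv_def mult.commute)
  also have "\<dots> = gtilde g \<eta> p ?s ?w" by (rule gtilde_sym)
  also have "\<dots> = a \<bullet> ?w"
    by (rule gtilde_sharp) (rule bounded_linear.linear[OF bounded_linear_inner_right])
  also have "\<dots> = ?w \<bullet> a" by (rule inner_commute)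
  finally show "(\<Sum>b\<in>Basis. ginv g \<eta> p a b * gtilde g \<eta> p ?w b) = ?w \<bullet> a" .
qed

end


section \<open>Change of connection\<close>

text \<open>The pointwise linear algebra of the Ricci change. \<open>A\<close> stands for the
  difference of the connections and \<open>B\<close> for its covariant derivative, with
  \<open>dth\<close>, \<open>dt\<close>, \<open>dT\<close> in the roles of the derivatives of
  \<theta>, its sharp and S. The four lines of the result are the traces of the four
  summands.\<close>

lemma trace_weyl_terms:
  fixes g T :: "'e::euclidean_space \<Rightarrow> 'e \<Rightarrow> real" and \<theta> \<phi> :: "'e \<Rightarrow> real" and t \<xi> :: 'e
    and dth :: "'e \<Rightarrow> 'e \<Rightarrow> real" and dt :: "'e \<Rightarrow> 'e" and dT :: "'e \<Rightarrow> 'e \<Rightarrow> 'e \<Rightarrow> real"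
  defines "A \<equiv> \<lambda>u v. \<theta> u *\<^sub>R v + \<theta> v *\<^sub>R u - g u v *\<^sub>R t - T u v *\<^sub>R \<xi>"
    and "B \<equiv> \<lambda>u v w. dth u v *\<^sub>R w + dth u w *\<^sub>R v - g v w *\<^sub>R dt u - dT u v w *\<^sub>R \<xi> - (T v w * \<phi> u) *\<^sub>R \<xi>"
  assumes dim: "DIM('e) = n + 1"
    and g: "bilinear g" "\<And>u v. g u v = g v u" and T: "bilinear T" "\<And>u v. T u v = T v u"
    and \<theta>: "linear \<theta>" and \<phi>: "linear \<phi>"
    and dth: "\<And>u. linear (dth u)" "\<And>v. linear (\<lambda>u. dth u v)"
    and dT: "\<And>v w. linear (\<lambda>u. dT u v w)" "\<And>u w. linear (\<lambda>v. dT u v w)"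
    and t: "\<And>v. g t v = \<theta> v" and \<xi>: "\<And>v. g \<xi> v = 0" "\<theta> \<xi> = 0" "T \<xi> \<xi> = 0" "\<phi> \<xi> = 0"
    and dt: "\<And>x y. g (dt x) y = dth x y"
  shows "(\<Sum>b\<in>Basis. (B x b y - B b x y + A x (A b y) - A b (A x y)) \<bullet> b) =
      ((real n + 1) * dth x y - dT x \<xi> y - T \<xi> y * \<phi> x)
    - (dth y x + dth x y - g x y * (\<Sum>b\<in>Basis. dt b \<bullet> b) - dT \<xi> x y)
    + ((real n + 3) * \<theta> x * \<theta> y - 2 * g x y * g t t - T \<xi> x * \<theta> y - \<theta> x * T \<xi> y + T \<xi> x * T \<xi> y)
    - ((real n + 1) * (2 * \<theta> x * \<theta> y - g x y * g t t) - (\<theta> x * T \<xi> y + \<theta> y * T \<xi> x - g x y * T \<xi> t))"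
proof -
  have lg: "linear (g u)" "linear (\<lambda>u. g u v)" for u v using g(1) by (auto simp: bilinear_def)
  have lT: "linear (T u)" "linear (\<lambda>u. T u v)" for u v using T(1) by (auto simp: bilinear_def)
  note ls = lg lT \<theta> \<phi> dth dT
  note la = ls[THEN linear_add] ls[THEN linear_scale] ls[THEN linear_diff]
  have A1: "linear (\<lambda>u. A u v)" for v
    unfolding A_def linear_iff by (simp add: la algebra_simps)
  have S: "(\<Sum>b\<in>(Basis :: 'e set). c * (b \<bullet> b)) = (real n + 1) * c" for c :: real
  proof -
    have "(\<Sum>b\<in>(Basis :: 'e set). c * (b \<bullet> b)) = (\<Sum>b\<in>(Basis :: 'e set). c)" by (intro sum.cong) auto
    then show ?thesis by (simp add: dim)
  qed
  have SL: "(\<Sum>b\<in>Basis. f b * (b \<bullet> z)) = f z" if "linear f" for f and z :: 'e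
    using linear_sum_Basis[OF that, of z] by (simp add: inner_commute)
  have g\<xi>: "g v \<xi> = 0" for v using \<xi>(1)[of v] g(2)[of v \<xi>] by simp
  have gt: "g v t = \<theta> v" for v using t[of v] g(2)[of v t] by simp
  \<comment> \<open>The traced vector \<open>b\<close> is inserted in different slots of
    \<open>B\<close>. Each of the two forms arranges the factors so that every sum matches
    \<open>S\<close>, \<open>SL\<close> or the divergence.\<close>
  have exB: "B u v w \<bullet> b = dth u v * (b \<bullet> w) + dth u w * (v \<bullet> b) - g v w * (b \<bullet> dt u) - dT u v w * (b \<bullet> \<xi>)
      - \<phi> u * (T v w * (b \<bullet> \<xi>))" for u v w b
    unfolding B_def inner_diff_left inner_add_left by (simp add: inner_commute mult_ac)
  have exB': "B u v w \<bullet> b = dth u v * (b \<bullet> w) + dth u w * (b \<bullet> v) - g v w * (dt u \<bullet> b) - dT u v w * (b \<bullet> \<xi>)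
      - T v w * (\<phi> u * (b \<bullet> \<xi>))" for u v w b
    unfolding exB by (simp add: inner_commute mult_ac)
  have B1: "(\<Sum>b\<in>Basis. B x b y \<bullet> b) = (real n + 1) * dth x y - dT x \<xi> y - T \<xi> y * \<phi> x"
  proof -
    have "(\<Sum>b\<in>Basis. B x b y \<bullet> b) = (\<Sum>b\<in>Basis. dth x b * (b \<bullet> y)) + (\<Sum>b\<in>(Basis :: 'e set). dth x y * (b \<bullet> b))
       - (\<Sum>b\<in>Basis. g b y * (b \<bullet> dt x)) - (\<Sum>b\<in>Basis. dT x b y * (b \<bullet> \<xi>)) - \<phi> x * (\<Sum>b\<in>Basis. T b y * (b \<bullet> \<xi>))"
      by (simp only: exB sum.distrib sum_subtractf sum_distrib_left)
    then show ?thesis by (simp only: S SL ls dt) simp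
  qed
  have B2: "(\<Sum>b\<in>Basis. B b x y \<bullet> b) = dth y x + dth x y - g x y * (\<Sum>b\<in>Basis. dt b \<bullet> b) - dT \<xi> x y"
  proof -
    have "(\<Sum>b\<in>Basis. B b x y \<bullet> b) = (\<Sum>b\<in>Basis. dth b x * (b \<bullet> y)) + (\<Sum>b\<in>Basis. dth b y * (b \<bullet> x))
       - g x y * (\<Sum>b\<in>Basis. dt b \<bullet> b) - (\<Sum>b\<in>Basis. dT b x y * (b \<bullet> \<xi>)) - T x y * (\<Sum>b\<in>Basis. \<phi> b * (b \<bullet> \<xi>))"
      by (simp add: exB' sum.distrib sum_subtractf sum_distrib_left)
    then show ?thesis by (simp only: S SL ls \<xi>)
  qed
  have exA: "A u v \<bullet> b = \<theta> u * (b \<bullet> v) + \<theta> v * (u \<bullet> b) - g u v * (b \<bullet> t) - T u v * (b \<bullet> \<xi>)" for u v b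
    unfolding A_def inner_diff_left inner_add_left by (simp add: inner_commute)
  have exA': "A u v \<bullet> b = \<theta> u * (v \<bullet> b) + \<theta> v * (b \<bullet> u) - g u v * (b \<bullet> t) - T u v * (b \<bullet> \<xi>)" for u v b
    unfolding A_def inner_diff_left inner_add_left by (simp add: inner_commute)
  \<comment> \<open>The trace of the first summand is \<theta>(v), which cancels against g(t, v) =
    \<theta>(v).\<close>
  have a: "(\<Sum>b\<in>Basis. A b v \<bullet> b) = (real n + 1) * \<theta> v - T \<xi> v" for v
  proof -
    have "(\<Sum>b\<in>Basis. A b v \<bullet> b) = (\<Sum>b\<in>Basis. \<theta> b * (b \<bullet> v)) + (\<Sum>b\<in>(Basis :: 'e set). \<theta> v * (b \<bullet> b))
       - (\<Sum>b\<in>Basis. g b v * (b \<bullet> t)) - (\<Sum>b\<in>Basis. T b v * (b \<bullet> \<xi>))"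
      by (simp only: exA sum.distrib sum_subtractf)
    then show ?thesis by (simp only: S SL ls t)
  qed
  have th_tt: "\<theta> t = g t t" using t[of t] by simp
  have C1: "(\<Sum>b\<in>Basis. A x (A b y) \<bullet> b) =
     (real n + 3) * \<theta> x * \<theta> y - 2 * g x y * g t t - T \<xi> x * \<theta> y - \<theta> x * T \<xi> y + T \<xi> x * T \<xi> y"
  proof -
    have l: "linear (\<lambda>b. \<theta> (A b y))" "linear (\<lambda>b. g x (A b y))" "linear (\<lambda>b. T x (A b y))"
      using linear_compose[OF A1 \<theta>] linear_compose[OF A1 lg(1)] linear_compose[OF A1 lT(1)] by (auto simp: o_def)
    have "(\<Sum>b\<in>Basis. A x (A b y) \<bullet> b) = \<theta> x * (\<Sum>b\<in>Basis. A b y \<bullet> b) + (\<Sum>b\<in>Basis. \<theta> (A b y) * (b \<bullet> x))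
       - (\<Sum>b\<in>Basis. g x (A b y) * (b \<bullet> t)) - (\<Sum>b\<in>Basis. T x (A b y) * (b \<bullet> \<xi>))"
      by (simp only: exA'[where u=x] sum.distrib sum_subtractf sum_distrib_left)
    also have "\<dots> = \<theta> x * ((real n + 1) * \<theta> y - T \<xi> y) + \<theta> (A x y) - g x (A t y) - T x (A \<xi> y)"
      by (simp only: a SL[OF l(1)] SL[OF l(2)] SL[OF l(3)])
    also have "\<dots> = (real n + 3) * \<theta> x * \<theta> y - 2 * g x y * g t t - T \<xi> x * \<theta> y - \<theta> x * T \<xi> y + T \<xi> x * T \<xi> y"
      by (simp add: A_def la \<xi> g\<xi> t gt T(2)[of x \<xi>] algebra_simps)
    finally show ?thesis .
  qed
  have C2: "(\<Sum>b\<in>Basis. A b (A x y) \<bullet> b) =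
      (real n + 1) * (2 * \<theta> x * \<theta> y - g x y * g t t) - (\<theta> x * T \<xi> y + \<theta> y * T \<xi> x - g x y * T \<xi> t)"
    unfolding a by (simp add: A_def la \<xi> th_tt algebra_simps)
  show ?thesis
    unfolding inner_diff_left inner_add_left sum.distrib sum_subtractf B1 B2 C1 C2 by simp
qed

context smooth_mfd begin

lemma linear_dfun_contract:
  fixes \<omega> :: "'m \<Rightarrow> 'e \<Rightarrow> real"
  assumes "\<And>q. linear (\<omega> q)" "\<And>v. (\<lambda>q. \<omega> q (coord_field A p v q)) \<in> smooth_funs A (cdom A p)"
  shows "linear (\<lambda>v. dfun A (\<lambda>q. \<omega> q (coord_field A p v q)) p u)"
proof (rule linearI)
  fix v w and c :: real
  have "dfun A (\<lambda>q. \<omega> q (coord_field A p (v + w) q)) p u =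
      dfun A (\<lambda>q. \<omega> q (coord_field A p v q) + \<omega> q (coord_field A p w q)) p u"
    by (rule dfun_cong[OF open_cdom mem_cdom])
       (simp add: linear_add[OF coord_field_linear] linear_add[OF assms(1)])
  then show "dfun A (\<lambda>q. \<omega> q (coord_field A p (v + w) q)) p u =
      dfun A (\<lambda>q. \<omega> q (coord_field A p v q)) p u + dfun A (\<lambda>q. \<omega> q (coord_field A p w q)) p u"
    by (simp add: dfun_add[OF assms(2) assms(2) open_cdom mem_cdom])
  have "dfun A (\<lambda>q. \<omega> q (coord_field A p (c *\<^sub>R v) q)) p u = dfun A (\<lambda>q. c * \<omega> q (coord_field A p v q)) p u"
    by (rule dfun_cong[OF open_cdom mem_cdom])
       (simp add: linear_scale[OF coord_field_linear] linear_scale[OF assms(1)])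
  then show "dfun A (\<lambda>q. \<omega> q (coord_field A p (c *\<^sub>R v) q)) p u = c *\<^sub>R dfun A (\<lambda>q. \<omega> q (coord_field A p v q)) p u"
    by (simp add: dfun_mult[OF smooth_funs_const assms(2) open_cdom mem_cdom])
qed

end

context mfd_connection begin

lemma linear_cov1:
  assumes "one_form A \<omega>"
  shows "linear (\<lambda>u. cov1 A D \<omega> (coord_field A p u) (coord_field A p v) p)"
    and "linear (\<lambda>v. cov1 A D \<omega> (coord_field A p u) (coord_field A p v) p)"
proof -
  have lc: "linear (chris p w)" "linear (\<lambda>w'. chris p w' w)" for w
    using bilinear_chris[of p] by (auto simp: bilinear_def)
  have s: "(\<lambda>q. \<omega> q (coord_field A p v q)) \<in> smooth_funs A (cdom A p)" for v
    by (rule one_form_smooth[OF assms open_cdom vfields_coord_field])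
  have eq: "cov1 A D \<omega> (coord_field A p u) (coord_field A p v) p =
      dfun A (\<lambda>q. \<omega> q (coord_field A p v q)) p u - \<omega> p (chris p u v)" for u v
    by (simp add: cov1_def chris_def)
  note l\<omega> = one_form_linear[OF assms]
  show "linear (\<lambda>u. cov1 A D \<omega> (coord_field A p u) (coord_field A p v) p)"
    unfolding eq using linear_compose[OF lc(2) l\<omega>]
    by (intro linear_compose_sub linear_dfun[OF s open_cdom mem_cdom]) (simp add: o_def)
  show "linear (\<lambda>v. cov1 A D \<omega> (coord_field A p u) (coord_field A p v) p)"
    unfolding eq using linear_compose[OF lc(1) l\<omega>]
    by (intro linear_compose_sub linear_dfun_contract[OF l\<omega> s]) (simp add: o_def)
qed

lemma linear_cov2:
  assumes "sym_tensor A T"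
  shows "linear (\<lambda>u. cov2 A D T (coord_field A p u) (coord_field A p v) (coord_field A p w) p)"
    and "linear (\<lambda>v. cov2 A D T (coord_field A p u) (coord_field A p v) (coord_field A p w) p)"
proof -
  have lc: "linear (chris p w)" "linear (\<lambda>w'. chris p w' w)" for w
    using bilinear_chris[of p] by (auto simp: bilinear_def)
  have lT: "linear (T q w)" "linear (\<lambda>w'. T q w' w)" for q w
    using sym_tensor_bilinear[OF assms, of q] by (auto simp: bilinear_def)
  have s: "(\<lambda>q. T q (coord_field A p v q) (coord_field A p w q)) \<in> smooth_funs A (cdom A p)" for v w
    by (rule sym_tensor_smooth[OF assms open_cdom vfields_coord_field vfields_coord_field])
  have eq: "cov2 A D T (coord_field A p u) (coord_field A p v) (coord_field A p w) p =
      dfun A (\<lambda>q. T q (coord_field A p v q) (coord_field A p w q)) p u - T p (chris p u v) w - T p v (chris p u w)" for u v w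
    by (simp add: cov2_def chris_def)
  show "linear (\<lambda>u. cov2 A D T (coord_field A p u) (coord_field A p v) (coord_field A p w) p)"
    unfolding eq using linear_compose[OF lc(2) lT(2)] linear_compose[OF lc(2) lT(1)]
    by (intro linear_compose_sub linear_dfun[OF s open_cdom mem_cdom]) (simp_all add: o_def)
  show "linear (\<lambda>v. cov2 A D T (coord_field A p u) (coord_field A p v) (coord_field A p w) p)"
    unfolding eq using linear_compose[OF lc(1) lT(2)]
    by (intro linear_compose_sub linear_dfun_contract[where \<omega>="\<lambda>q v. T q v (coord_field A p w q)"] s lT)
       (simp_all add: o_def)
qed

end

context lightlike begin

text \<open>\<open>gtilde\<close> paired with \<xi> is \<eta>, so the sharp of a horizontal form
  lies in the kernel of \<eta>. There the \<eta>-term of \<open>gtilde\<close> drops out, and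
  \<theta> is represented by the degenerate \<open>g\<close> itself.\<close>

lemma eta_sharp:
  assumes "linear (\<theta> p)" "\<theta> p (\<xi> p) = 0" shows "\<eta> p (sharp g \<eta> \<theta> p) = 0"
  using gtilde_sharp[of \<theta> p "\<xi> p", OF assms(1)] gtilde_xi assms(2) by simp

lemma g_sharp:
  assumes "linear (\<theta> p)" "\<theta> p (\<xi> p) = 0" shows "g p (sharp g \<eta> \<theta> p) v = \<theta> p v"
  using gtilde_sharp[of \<theta> p v, OF assms(1)] eta_sharp[of \<theta> p, OF assms] by (simp add: gtilde_def)

end

text \<open>The connection formula for one metric. The link between \<open>T\<close> and the screen
  is kept apart, as \<open>associated_tensor\<close>, and is used to obtain the screen condition in
  \<open>D_screen\<close>.\<close>

locale weyl_formula = lightlike A n g \<xi> \<eta> Dg \<phi>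
  for A :: "('m::t2_space, 'e::euclidean_space) atlas" and n g \<xi> \<eta> Dg \<phi> +
  fixes D :: "('m \<Rightarrow> 'e) \<Rightarrow> ('m \<Rightarrow> 'e) \<Rightarrow> 'm \<Rightarrow> 'e" and \<theta> :: "'m \<Rightarrow> 'e \<Rightarrow> real" and T :: "'m \<Rightarrow> 'e \<Rightarrow> 'e \<Rightarrow> real"
  assumes D_connection: "connection A D"
    and theta: "one_form A \<theta>" "\<And>p. \<theta> p (\<xi> p) = 0"
    and T: "sym_tensor A T" "\<And>p. T p (\<xi> p) (\<xi> p) = 0"
    and D_formula: "\<And>W X Y p. open W \<Longrightarrow> X \<in> vfields A W \<Longrightarrow> Y \<in> vfields A W \<Longrightarrow> p \<in> W \<Longrightarrow>
      D X Y p = Dg X Y p + \<theta> p (X p) *\<^sub>R Y p + \<theta> p (Y p) *\<^sub>R X p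
        - g p (X p) (Y p) *\<^sub>R sharp g \<eta> \<theta> p - T p (X p) (Y p) *\<^sub>R \<xi> p"

sublocale weyl_formula \<subseteq> W: mfd_connection A D
  by unfold_locales (rule D_connection)

context weyl_formula begin

abbreviation "theta_sharp \<equiv> sharp g \<eta> \<theta>"

lemmas eta_theta_sharp = eta_sharp[of \<theta>, OF one_form_linear[OF theta(1)] theta(2)]
lemmas g_theta_sharp = g_sharp[of \<theta>, OF one_form_linear[OF theta(1)] theta(2)]

text \<open>Smoothness is read off the formula for \<open>D\<close>, solved for \<open>theta_sharp\<close> near a point
  where \<open>g(X, Y) \<noteq> 0\<close>; this avoids inverting \<open>gtilde\<close>.\<close>

lemma theta_sharp_vfields: "theta_sharp \<in> vfields A W"
proof -
  have "theta_sharp \<in> vfields A UNIV"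
  proof (rule vfields_local[OF open_UNIV])
    fix p
    obtain u v where uv: "g p u v \<noteq> 0" using g_nonzero by blast
    let ?X = "coord_field A p u" and ?Y = "coord_field A p v"
    let ?f = "\<lambda>q. g q (?X q) (?Y q)"
    let ?V = "?f -` (- {0}) \<inter> cdom A p"
    have f: "?f \<in> smooth_funs A (cdom A p)"
      by (rule sym_tensor_smooth[OF g open_cdom vfields_coord_field vfields_coord_field])
    have V: "open ?V"
      using continuous_on_open_vimage[OF open_cdom, of p ?f] smooth_funs_continuous[OF f open_cdom] by auto
    have X: "?X \<in> vfields A ?V" and Y: "?Y \<in> vfields A ?V"
      by (auto intro: vfields_mono[OF vfields_coord_field])
    have s: "(\<lambda>q. \<theta> q (Z q)) \<in> smooth_funs A ?V" if "Z \<in> vfields A ?V" for Z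
      by (rule one_form_smooth[OF theta(1) V that])
    have "(\<lambda>q. inverse (?f q) *\<^sub>R (Dg ?X ?Y q + \<theta> q (?X q) *\<^sub>R ?Y q + \<theta> q (?Y q) *\<^sub>R ?X q
        - T q (?X q) (?Y q) *\<^sub>R \<xi> q - D ?X ?Y q)) \<in> vfields A ?V"
      by (intro vfields_scaleR vfields_add vfields_diff V X Y s G.vfields_conn W.vfields_conn xi_vfields
          sym_tensor_smooth[OF T(1)] smooth_funs_inverse smooth_funs_mono[OF f]) auto
    then have "theta_sharp \<in> vfields A ?V"
    proof (subst vfields_cong[OF V])
      fix q assume q: "q \<in> ?V"
      then have "?f q *\<^sub>R theta_sharp q = Dg ?X ?Y q + \<theta> q (?X q) *\<^sub>R ?Y q + \<theta> q (?Y q) *\<^sub>R ?X q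
        - T q (?X q) (?Y q) *\<^sub>R \<xi> q - D ?X ?Y q"
        using D_formula[OF V X Y q] by (simp add: algebra_simps)
      then show "theta_sharp q = inverse (?f q) *\<^sub>R (Dg ?X ?Y q + \<theta> q (?X q) *\<^sub>R ?Y q + \<theta> q (?Y q) *\<^sub>R ?X q
        - T q (?X q) (?Y q) *\<^sub>R \<xi> q - D ?X ?Y q)" using q by (metis (no_types, lifting) ComplD IntD1 insertCI scaleR_one left_inverse scaleR_scaleR vimageD)
    qed
    then show "\<exists>V. open V \<and> p \<in> V \<and> theta_sharp \<in> vfields A V"
      using V uv by (intro exI[of _ ?V]) auto
  qed
  then show ?thesis by (rule vfields_mono) simp
qed

lemma D_torsion_free: "torsion_free A D"
  unfolding torsion_free_def
proof (intro allI impI ballI)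
  fix W X Y p assume W: "open W" "X \<in> vfields A W" "Y \<in> vfields A W" "p \<in> W"
  have "Dg X Y p - Dg Y X p = lie_bracket A X Y p"
    using Dg_torsion_free W unfolding torsion_free_def by blast
  then show "D X Y p - D Y X p = lie_bracket A X Y p"
    using D_formula[OF W(1-4)] D_formula[OF W(1,3,2,4)] sym_tensor_sym[OF g, of p "X p" "Y p"] sym_tensor_sym[OF T(1), of p "X p" "Y p"]
    by simp
qed

lemma D_weyl:
  assumes "open W" "X \<in> vfields A W" "Y \<in> vfields A W" "Z \<in> vfields A W" "p \<in> W"
  shows "cov2 A D g X Y Z p = - 2 * \<theta> p (X p) * g p (Y p) (Z p)"
proof -
  have lg: "linear (g p w)" "linear (\<lambda>w'. g p w' w)" for w
    using sym_tensor_bilinear[OF g, of p] by (auto simp: bilinear_def)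
  note la = lg[THEN linear_add] lg[THEN linear_diff] lg[THEN linear_scale]
  have "g p v (theta_sharp p) = \<theta> p v" "g p v (\<xi> p) = 0" for v
    using g_theta_sharp[of p v] g_xi[of p v] sym_tensor_sym[OF g, of p v] by auto
  then show ?thesis
    using Dg_metric'[OF assms] sym_tensor_sym[OF g, of p "Y p" "X p"]
    by (simp add: cov2_def D_formula[OF assms(1,2,3,5)] D_formula[OF assms(1,2,4,5)] la g_theta_sharp g_xi algebra_simps)
qed

text \<open>Differentiate g(\<open>theta_sharp\<close>, E) = \<theta>(E) along a metric
  connection.\<close>

lemma nabla_theta_sharp:
  "g p (Dg (coord_field A p u) theta_sharp p) v = cov1 A Dg \<theta> (coord_field A p u) (coord_field A p v) p"
  using Dg_metric'[OF open_cdom vfields_coord_field theta_sharp_vfields vfields_coord_field mem_cdom, of p v u]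
  by (simp add: cov1_def g_theta_sharp)

section \<open>The change of curvature caused by the difference tensor\<close>

definition diff_tensor :: "'m \<Rightarrow> 'e \<Rightarrow> 'e \<Rightarrow> 'e" where
  "diff_tensor p u v = \<theta> p u *\<^sub>R v + \<theta> p v *\<^sub>R u - g p u v *\<^sub>R theta_sharp p - T p u v *\<^sub>R \<xi> p"

text \<open>The covariant derivative of \<open>diff_tensor\<close> for \<open>Dg\<close>, spelled
  out by the product rule. The metric is parallel and contributes nothing; the last term comes from
  the derivative \<phi>(u) \<xi> of \<xi>.\<close>

definition nabla_diff :: "'m \<Rightarrow> 'e \<Rightarrow> 'e \<Rightarrow> 'e \<Rightarrow> 'e" where
  "nabla_diff p u v w = (let n1 = (\<lambda>v. cov1 A Dg \<theta> (coord_field A p u) (coord_field A p v) p) in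
     n1 v *\<^sub>R w + n1 w *\<^sub>R v - g p v w *\<^sub>R Dg (coord_field A p u) theta_sharp p
     - cov2 A Dg T (coord_field A p u) (coord_field A p v) (coord_field A p w) p *\<^sub>R \<xi> p - (T p v w * \<phi> p u) *\<^sub>R \<xi> p)"

lemma chris_diff: "W.chris p u v = G.chris p u v + diff_tensor p u v"
  using D_formula[OF open_cdom vfields_coord_field vfields_coord_field mem_cdom, of p u v]
  by (simp add: W.chris_def G.chris_def diff_tensor_def)

text \<open>The flat derivative of a tensor is its covariant derivative plus Christoffel
  corrections, one for each argument and a negative one for the value; applied here to
  \<open>diff_tensor\<close>.\<close>

lemma dchris_diff:
  "W.dchris p u v w = G.dchris p u v w + nabla_diff p u v w + diff_tensor p (G.chris p u v) w
     + diff_tensor p v (G.chris p u w) - G.chris p u (diff_tensor p v w)"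
proof -
  let ?E = "coord_field A p" and ?U = "cdom A p"
  note E = vfields_coord_field[of p] and o = open_cdom[of p] and m = mem_cdom[of p]
  note ths = theta_sharp_vfields[of ?U] and xis = xi_vfields[of ?U]
  have s1: "(\<lambda>q. \<theta> q (?E v q)) \<in> smooth_funs A ?U" for v
    by (rule one_form_smooth[OF theta(1) o E])
  have s2: "(\<lambda>q. g q (?E v q) (?E w q)) \<in> smooth_funs A ?U" "(\<lambda>q. T q (?E v q) (?E w q)) \<in> smooth_funs A ?U"
    by (rule sym_tensor_smooth[OF g o E E] sym_tensor_smooth[OF T(1) o E E])+
  \<comment> \<open>Signs are absorbed into the coefficients so that the formula for
    \<open>D\<close> becomes a sum of scaled fields.\<close>
  have m1: "vder p (\<lambda>q. (- f q) *\<^sub>R X q) u = - (f p *\<^sub>R vder p X u + dfun A f p u *\<^sub>R X p)"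
    "(\<lambda>q. (- f q) *\<^sub>R X q) \<in> vfields A ?U"
    if "f \<in> smooth_funs A ?U" "X \<in> vfields A ?U" for f X
  proof -
    have "dfun A (\<lambda>q. - f q) p u = - dfun A f p u"
      using dfun_mult[OF smooth_funs_const[where c="-1"] that(1) o m, of u] by simp
    then show "vder p (\<lambda>q. (- f q) *\<^sub>R X q) u = - (f p *\<^sub>R vder p X u + dfun A f p u *\<^sub>R X p)"
      using vder_scaleR[OF o smooth_funs_minus[OF o that(1)] that(2) m, of u] by simp
    show "(\<lambda>q. (- f q) *\<^sub>R X q) \<in> vfields A ?U"
      by (intro vfields_scaleR smooth_funs_minus o that)
  qed
  let ?F1 = "\<lambda>q. \<theta> q (?E v q) *\<^sub>R ?E w q" and ?F2 = "\<lambda>q. \<theta> q (?E w q) *\<^sub>R ?E v q"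
  let ?F3 = "\<lambda>q. (- g q (?E v q) (?E w q)) *\<^sub>R theta_sharp q" and ?F4 = "\<lambda>q. (- T q (?E v q) (?E w q)) *\<^sub>R \<xi> q"
  have F: "?F1 \<in> vfields A ?U" "?F2 \<in> vfields A ?U" "?F3 \<in> vfields A ?U" "?F4 \<in> vfields A ?U"
    by (intro vfields_scaleR o s1 E m1 s2 ths xis)+
  note G0 = G.vfields_conn[OF o E E, of v w]
  note a1 = vfields_add[OF o G0 F(1)] note a2 = vfields_add[OF o a1 F(2)] note a3 = vfields_add[OF o a2 F(3)]
  have "W.dchris p u v w = vder p (\<lambda>q. Dg (?E v) (?E w) q + ?F1 q + ?F2 q + ?F3 q + ?F4 q) u"
    unfolding W.dchris_def
    by (rule fun_cong[OF vder_cong[OF o m]]) (simp add: D_formula[OF o E E])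
  also have "\<dots> = G.dchris p u v w + vder p ?F1 u + vder p ?F2 u + vder p ?F3 u + vder p ?F4 u"
    by (simp only: vder_add[OF o a3 F(4) m] vder_add[OF o a2 F(3) m] vder_add[OF o a1 F(2) m] vder_add[OF o G0 F(1) m] G.dchris_def)
  also have "\<dots> = G.dchris p u v w + dfun A (\<lambda>q. \<theta> q (?E v q)) p u *\<^sub>R w + dfun A (\<lambda>q. \<theta> q (?E w q)) p u *\<^sub>R v
    - (g p v w *\<^sub>R vder p theta_sharp u + dfun A (\<lambda>q. g q (?E v q) (?E w q)) p u *\<^sub>R theta_sharp p)
    - (T p v w *\<^sub>R vder p \<xi> u + dfun A (\<lambda>q. T q (?E v q) (?E w q)) p u *\<^sub>R \<xi> p)"
    by (simp only: vder_scaleR[OF o s1 E m] m1(1)[OF s2(1) ths] m1(1)[OF s2(2) xis] vder_coord_field coord_field_same) simp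
  finally have dch: "W.dchris p u v w = \<dots>" .
  have d1: "dfun A (\<lambda>q. \<theta> q (?E v q)) p u = cov1 A Dg \<theta> (?E u) (?E v) p + \<theta> p (G.chris p u v)" for v
    by (simp add: cov1_def G.chris_def)
  have d2: "dfun A (\<lambda>q. T q (?E v q) (?E w q)) p u = cov2 A Dg T (?E u) (?E v) (?E w) p + T p (G.chris p u v) w + T p v (G.chris p u w)"
    by (simp add: cov2_def G.chris_def)
  have d3: "dfun A (\<lambda>q. g q (?E v q) (?E w q)) p u = g p (G.chris p u v) w + g p v (G.chris p u w)"
    using Dg_metric'[OF o E[of u] E[of v] E[of w] m] by (simp add: G.chris_def)
  have d4: "vder p theta_sharp u = Dg (?E u) theta_sharp p - G.chris p u (theta_sharp p)"
    using G.conn_chris[OF o E[of u] ths m] by simp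
  have d5: "vder p \<xi> u = \<phi> p u *\<^sub>R \<xi> p - G.chris p u (\<xi> p)"
    using G.conn_chris[OF o E[of u] xis m] Dg_xi[OF o E[of u] m] by simp
  have lc: "linear (G.chris p u)" using G.bilinear_chris[of p] by (auto simp: bilinear_def)
  show ?thesis
    unfolding dch d1 d2 d3 d4 d5 nabla_diff_def Let_def diff_tensor_def
    by (simp add: linear_add[OF lc] linear_diff[OF lc] linear_scale[OF lc] algebra_simps)
qed

text \<open>All terms mixing Christoffel symbols with the difference tensor cancel, the ones with
  \<Gamma>(u, v) by torsion-freeness of \<open>Dg\<close>. What remains is \<nabla>A skewed plus the
  commutator of A, with the sign of the curvature convention.\<close>

lemma curv_at_diff:
  "W.curv_at p u v w = G.curv_at p u v w - (nabla_diff p u v w - nabla_diff p v u w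
     + diff_tensor p u (diff_tensor p v w) - diff_tensor p v (diff_tensor p u w))"
proof -
  have lc: "linear (G.chris p u)" for u using G.bilinear_chris[of p] by (auto simp: bilinear_def)
  have ld: "diff_tensor p a (b + c) = diff_tensor p a b + diff_tensor p a c" for a b c
    using sym_tensor_bilinear[OF g, of p] sym_tensor_bilinear[OF T(1), of p] one_form_linear[OF theta(1), of p]
    by (simp add: diff_tensor_def bilinear_radd linear_add algebra_simps)
  show ?thesis
    unfolding W.curv_at_def G.curv_at_def dchris_diff chris_diff ld linear_add[OF lc] chris_sym[of p v u]
    by simp
qed

lemma ricci_diff:
  assumes "open W" "X \<in> vfields A W" "Y \<in> vfields A W" "p \<in> W"
  shows "ricci A D X Y p = ricci A Dg X Y p - (
      ((real n + 1) * cov1 A Dg \<theta> X Y p - cov2 A Dg T X \<xi> Y p - T p (\<xi> p) (Y p) * \<phi> p (X p))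
    - (cov1 A Dg \<theta> Y X p + cov1 A Dg \<theta> X Y p - g p (X p) (Y p) * codiff A g \<eta> Dg \<theta> p - cov2 A Dg T \<xi> X Y p)
    + ((real n + 3) * \<theta> p (X p) * \<theta> p (Y p) - 2 * g p (X p) (Y p) * g p (theta_sharp p) (theta_sharp p)
       - T p (\<xi> p) (X p) * \<theta> p (Y p) - \<theta> p (X p) * T p (\<xi> p) (Y p) + T p (\<xi> p) (X p) * T p (\<xi> p) (Y p))
    - ((real n + 1) * (2 * \<theta> p (X p) * \<theta> p (Y p) - g p (X p) (Y p) * g p (theta_sharp p) (theta_sharp p))
       - (\<theta> p (X p) * T p (\<xi> p) (Y p) + \<theta> p (Y p) * T p (\<xi> p) (X p) - g p (X p) (Y p) * T p (\<xi> p) (theta_sharp p))))"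
proof -
  let ?x = "X p" and ?y = "Y p"
  let ?A = "diff_tensor p" and ?B = "nabla_diff p"
  have "ricci A D X Y p = ricci A Dg X Y p - (\<Sum>b\<in>Basis. (?B ?x b ?y - ?B b ?x ?y + ?A ?x (?A b ?y) - ?A b (?A ?x ?y)) \<bullet> b)"
    unfolding ricci_trace[OF G.mfd_connection_axioms assms] ricci_trace[OF W.mfd_connection_axioms assms] curv_at_diff
    by (simp add: inner_diff_left sum_subtractf)
  also have "(\<Sum>b\<in>Basis. (?B ?x b ?y - ?B b ?x ?y + ?A ?x (?A b ?y) - ?A b (?A ?x ?y)) \<bullet> b) =
     ((real n + 1) * cov1 A Dg \<theta> X Y p - cov2 A Dg T X \<xi> Y p - T p (\<xi> p) (Y p) * \<phi> p (X p))
    - (cov1 A Dg \<theta> Y X p + cov1 A Dg \<theta> X Y p - g p (X p) (Y p) * codiff A g \<eta> Dg \<theta> p - cov2 A Dg T \<xi> X Y p)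
    + ((real n + 3) * \<theta> p (X p) * \<theta> p (Y p) - 2 * g p (X p) (Y p) * g p (theta_sharp p) (theta_sharp p)
       - T p (\<xi> p) (X p) * \<theta> p (Y p) - \<theta> p (X p) * T p (\<xi> p) (Y p) + T p (\<xi> p) (X p) * T p (\<xi> p) (Y p))
    - ((real n + 1) * (2 * \<theta> p (X p) * \<theta> p (Y p) - g p (X p) (Y p) * g p (theta_sharp p) (theta_sharp p))
       - (\<theta> p (X p) * T p (\<xi> p) (Y p) + \<theta> p (Y p) * T p (\<xi> p) (X p) - g p (X p) (Y p) * T p (\<xi> p) (theta_sharp p)))"
    unfolding diff_tensor_def nabla_diff_def Let_def codiff_trace
      G.cov1_tensor[OF theta(1) assms] G.cov1_tensor[OF theta(1) assms(1,3,2,4)]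
      G.cov2_tensor[OF T(1) assms(1,2) xi_vfields assms(3,4)] G.cov2_tensor[OF T(1) assms(1) xi_vfields assms(2,3,4)]
    by (rule trace_weyl_terms[where g = "g p" and T = "T p" and \<theta> = "\<theta> p" and \<phi> = "\<phi> p" and t = "theta_sharp p" and \<xi> = "\<xi> p"
        and dth = "\<lambda>u v. cov1 A Dg \<theta> (coord_field A p u) (coord_field A p v) p"
        and dt = "\<lambda>u. Dg (coord_field A p u) theta_sharp p"
        and dT = "\<lambda>u v w. cov2 A Dg T (coord_field A p u) (coord_field A p v) (coord_field A p w) p",
        OF dim sym_tensor_bilinear[OF g] sym_tensor_sym[OF g] sym_tensor_bilinear[OF T(1)] sym_tensor_sym[OF T(1)]
        one_form_linear[OF theta(1)] one_form_linear[OF phi] G.linear_cov1(2)[OF theta(1)] G.linear_cov1(1)[OF theta(1)]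
        G.linear_cov2(1)[OF T(1)] G.linear_cov2(2)[OF T(1)] g_theta_sharp g_xi theta(2) T(2) phi_xi nabla_theta_sharp])
  finally show ?thesis .
qed

text \<open>Collecting coefficients: \<theta> \<otimes> \<theta> and the squared length of the sharp
  get their 1 - n from n + 3 - 2(n + 1) and 2 - (n + 1), and the products of \<theta> with S(\<xi>,
  .) cancel.\<close>

lemma ricci_sum:
  assumes "open W" "X \<in> vfields A W" "Y \<in> vfields A W" "p \<in> W"
  shows "ricci A D X Y p + ricci A D Y X p = ricci A Dg X Y p + ricci A Dg Y X p + calD A n \<xi> Dg \<phi> \<theta> T X Y p
     + 2 * ((1 - real n) * g p (theta_sharp p) (theta_sharp p) - codiff A g \<eta> Dg \<theta> p + T p (\<xi> p) (theta_sharp p)) * g p (X p) (Y p)"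
proof -
  have "cov2 A Dg T \<xi> Y X p = cov2 A Dg T \<xi> X Y p"
    using sym_tensor_sym[OF T(1)] by (simp add: cov2_def)
  then show ?thesis
    unfolding ricci_diff[OF assms] ricci_diff[OF assms(1,3,2,4)] calD_def sym_tensor_sym[OF g, of p "Y p" "X p"]
    by (simp add: algebra_simps)
qed

text \<open>Ric(X, Y) is half the sum plus half the difference of its two orders. The difference is
  known from \<open>ricci_Dg_skew\<close>, so prescribing Ric(X, Y) is the same as prescribing the
  sum; half of - 2 d\<phi> gives the term \<open>- ext_d\<close>.\<close>

lemma einstein_weyl_function_iff:
  assumes "\<Lambda> \<in> smooth_funs A UNIV"
  shows "einstein_weyl_function A D g \<Lambda> \<longleftrightarrow>
    (\<forall>W. open W \<longrightarrow> (\<forall>X\<in>vfields A W. \<forall>Y\<in>vfields A W. \<forall>p\<in>W.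
      ricci A Dg X Y p = - ext_d A \<phi> X Y p - calD A n \<xi> Dg \<phi> \<theta> T X Y p / 2
        + Lambda_bar A n g \<xi> \<eta> Dg \<theta> T \<Lambda> p * g p (X p) (Y p)))"
proof -
  have "ricci A D X Y p + ricci A D Y X p = \<Lambda> p * g p (X p) (Y p) \<longleftrightarrow>
      ricci A Dg X Y p = - ext_d A \<phi> X Y p - calD A n \<xi> Dg \<phi> \<theta> T X Y p / 2
        + Lambda_bar A n g \<xi> \<eta> Dg \<theta> T \<Lambda> p * g p (X p) (Y p)"
    if W: "open W" "X \<in> vfields A W" "Y \<in> vfields A W" "p \<in> W" for W X Y p
  proof -
    define k where "k = (1 - real n) * g p (theta_sharp p) (theta_sharp p) - codiff A g \<eta> Dg \<theta> p + T p (\<xi> p) (theta_sharp p)"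
    have l: "Lambda_bar A n g \<xi> \<eta> Dg \<theta> T \<Lambda> p * g p (X p) (Y p) = \<Lambda> p * g p (X p) (Y p) / 2 - k * g p (X p) (Y p)"
      by (simp add: Lambda_bar_def k_def left_diff_distrib)
    have "ricci A D X Y p + ricci A D Y X p = ricci A Dg X Y p + ricci A Dg Y X p + calD A n \<xi> Dg \<phi> \<theta> T X Y p
        + 2 * (k * g p (X p) (Y p))"
      using ricci_sum[OF W, folded k_def] by (simp only: mult.assoc)
    with ricci_Dg_skew[OF W] show ?thesis
      unfolding l by (intro iffI) linarith+
  qed
  with assms show ?thesis unfolding einstein_weyl_function_def by blast
qed

end


section \<open>Weyl screen structures\<close>

context lightlike begin

lemma scaleR_xi_eq_eta: "v = c *\<^sub>R \<xi> p \<Longrightarrow> v = \<eta> p v *\<^sub>R \<xi> p"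
  using linear_scale[OF one_form_linear[OF eta(1)], of p c "\<xi> p"] by (simp add: eta)

lemma screen_proj_eq:
  assumes "\<And>p. S p = {v. \<eta> p v = 0}"
  shows "screen_proj g S X p = X p - \<eta> p (X p) *\<^sub>R \<xi> p"
  unfolding screen_proj_def
proof (rule the_equality)
  note l = one_form_linear[OF eta(1), of p]
  show "X p - \<eta> p (X p) *\<^sub>R \<xi> p \<in> S p \<and> X p - (X p - \<eta> p (X p) *\<^sub>R \<xi> p) \<in> form_kernel (g p)"
    using sym_tensor_bilinear[OF g, of p]
    by (simp add: assms linear_diff[OF l] linear_scale[OF l] eta form_kernel_def bilinear_lmul g_xi)
  fix s assume s: "s \<in> S p \<and> X p - s \<in> form_kernel (g p)"
  then obtain c where "X p - s = c *\<^sub>R \<xi> p" using kernel[of p "X p - s"] by (auto simp: form_kernel_def)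
  from scaleR_xi_eq_eta[OF this] s show "s = X p - \<eta> p (X p) *\<^sub>R \<xi> p"
    by (simp add: assms linear_diff[OF l] algebra_simps)
qed

lemma screen_form_eq:
  assumes "\<And>p. S p = {v. \<eta> p v = 0}"
  shows "screen_form S \<xi> D X Y p = \<eta> p (D X Y p)"
  unfolding screen_form_def assms
  using linear_diff[OF one_form_linear[OF eta(1)], of p] linear_scale[OF one_form_linear[OF eta(1)], of p]
  by (intro the_equality) (auto simp: eta)

lemma weyl_screen_imp_formula:
  assumes S: "\<And>p. S p = {v. \<eta> p v = 0}"
    and D: "connection A D" "torsion_free A D" "\<And>p. D \<xi> \<xi> p = 0"
    and \<theta>: "one_form A \<theta>"
    and weyl: "\<And>W X Y Z p. open W \<Longrightarrow> X \<in> vfields A W \<Longrightarrow> Y \<in> vfields A W \<Longrightarrow> Z \<in> vfields A W \<Longrightarrow> p \<in> W \<Longrightarrow>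
       cov2 A D g X Y Z p = - 2 * \<theta> p (X p) * g p (Y p) (Z p)"
    and screen: "\<And>W X Y p. open W \<Longrightarrow> X \<in> vfields A W \<Longrightarrow> Y \<in> vfields A W \<Longrightarrow> p \<in> W \<Longrightarrow> D X (screen_proj g S Y) p \<in> S p"
  shows "\<exists>T. weyl_formula A n g \<xi> \<eta> Dg \<phi> D \<theta> T \<and> associated_tensor A S \<xi> \<eta> Dg \<theta> T"
proof -
  interpret W: mfd_connection A D by unfold_locales (rule D)
  define a where "a p u v = W.chris p u v - G.chris p u v" for p u v
  have aD: "D X Y p = Dg X Y p + a p (X p) (Y p)"
    if "open W" "X \<in> vfields A W" "Y \<in> vfields A W" "p \<in> W" for W X Y p
    using W.conn_chris[OF that] G.conn_chris[OF that] by (simp add: a_def)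
  have W_sym: "W.chris p u v = W.chris p v u" for p u v
    using D(2)[unfolded torsion_free_def, rule_format, OF open_cdom vfields_coord_field vfields_coord_field mem_cdom]
      lie_bracket_coord_field[OF mem_cdom] by (simp add: W.chris_def)
  have a_sym: "a p u v = a p v u" for p u v using W_sym chris_sym by (simp add: a_def)
  have a_bil: "bilinear (a p)" for p
    using W.bilinear_chris[of p] G.bilinear_chris[of p] by (simp add: a_def bilinear_def linear_iff algebra_simps)
  note l\<theta> = one_form_linear[OF \<theta>] and l\<eta> = one_form_linear[OF eta(1)]
  have lg: "linear (g p w)" "linear (\<lambda>w'. g p w' w)" for p w
    using sym_tensor_bilinear[OF g, of p] by (auto simp: bilinear_def)
  have g_sym: "g p u v = g p v u" for p u v by (rule sym_tensor_sym[OF g])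
  have compat: "g p (a p x y) z + g p y (a p x z) = 2 * \<theta> p x * g p y z" for p x y z
    using weyl[OF open_cdom vfields_coord_field[of p x] vfields_coord_field[of p y] vfields_coord_field[of p z] mem_cdom]
      Dg_metric'[OF open_cdom vfields_coord_field[of p x] vfields_coord_field[of p y] vfields_coord_field[of p z] mem_cdom]
      aD[OF open_cdom vfields_coord_field[of p x] vfields_coord_field[of p y] mem_cdom]
      aD[OF open_cdom vfields_coord_field[of p x] vfields_coord_field[of p z] mem_cdom]
    by (simp add: cov2_def linear_add[OF lg(1)] linear_add[OF lg(2)])
  \<comment> \<open>With y = \<xi> every other term of \<open>compat\<close> contains g(\<xi>, .)
    and vanishes.\<close>
  have a_xi: "g p (a p x (\<xi> p)) z = 0" for p x z
    using compat[of p x "\<xi> p" z] by (simp add: g_xi)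
  have \<theta>_xi: "\<theta> p (\<xi> p) = 0" for p
  proof -
    \<comment> \<open>With x = \<xi> the left side of \<open>compat\<close> is zero by symmetry of
      \<open>a\<close> and \<open>a_xi\<close>, so 2 \<theta>(\<xi>) g(y, z) = 0; a pair with g(y,
      z) nonzero decides.\<close>
    obtain y z where yz: "g p y z \<noteq> 0" using g_nonzero by blast
    then show ?thesis
      using compat[of p "\<xi> p" y z] a_xi[of p y z] a_xi[of p z y] a_sym[of p "\<xi> p"] g_sym[of p y "a p (\<xi> p) z"] by simp
  qed
  \<comment> \<open>Add two cyclic instances of \<open>compat\<close>, subtract the third, and
    halve.\<close>
  have koszul: "g p (a p x y) z = \<theta> p x * g p y z + \<theta> p y * g p x z - \<theta> p z * g p x y" for p x y z
    using compat[of p x y z] compat[of p y z x] compat[of p z x y]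
      a_sym[of p x y] a_sym[of p x z] a_sym[of p y z] g_sym[of p y "a p x z"] g_sym[of p z "a p x y"] g_sym[of p z "a p y x"]
      g_sym[of p x "a p y z"] g_sym[of p x "a p z y"] g_sym[of p y "a p z x"] g_sym[of p z x] g_sym[of p z y] g_sym[of p y x]
    by simp
  \<comment> \<open>The \<eta>-component of what separates \<open>a\<close> from the terms visible
    to \<open>g\<close>. The term with the sharp is absent because \<eta> kills it.\<close>
  define T where "T p u v = \<eta> p (\<theta> p u *\<^sub>R v + \<theta> p v *\<^sub>R u - a p u v)" for p u v
  have a_formula: "a p x y = \<theta> p x *\<^sub>R y + \<theta> p y *\<^sub>R x - g p x y *\<^sub>R sharp g \<eta> \<theta> p - T p x y *\<^sub>R \<xi> p" for p x y
  proof -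
    \<comment> \<open>By \<open>koszul\<close> this remainder is in the kernel of \<open>g\<close>,
      hence a multiple of \<xi>, and \<eta> reads off the factor.\<close>
    let ?r = "\<theta> p x *\<^sub>R y + \<theta> p y *\<^sub>R x - g p x y *\<^sub>R sharp g \<eta> \<theta> p - a p x y"
    have "g p ?r z = 0" for z
      using koszul[of p x y z] g_sharp[of \<theta> p, OF l\<theta> \<theta>_xi, of z]
      by (simp add: linear_add[OF lg(2)] linear_diff[OF lg(2)] linear_scale[OF lg(2)])
    then obtain c where "?r = c *\<^sub>R \<xi> p" using kernel by blast
    from scaleR_xi_eq_eta[OF this] have "?r = \<eta> p ?r *\<^sub>R \<xi> p" .
    also have "\<eta> p ?r = T p x y"
      using eta_sharp[of \<theta> p, OF l\<theta> \<theta>_xi]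
      by (simp add: T_def linear_add[OF l\<eta>] linear_diff[OF l\<eta>] linear_scale[OF l\<eta>])
    finally show ?thesis by (simp add: algebra_simps)
  qed
  have T_eq: "T p (X p) (Y p) = \<eta> p (\<theta> p (X p) *\<^sub>R Y p + \<theta> p (Y p) *\<^sub>R X p - (D X Y p - Dg X Y p))"
    if "open W" "X \<in> vfields A W" "Y \<in> vfields A W" "p \<in> W" for W X Y p
    using aD[OF that] by (simp add: T_def)
  have T_tensor: "sym_tensor A T"
    unfolding sym_tensor_def
  proof (intro conjI allI impI ballI)
    fix p u v
    have "bilinear (a p)" by (rule a_bil)
    then show "bilinear (T p)"
      unfolding bilinear_def linear_iff T_def
      by (simp add: linear_add[OF l\<eta>] linear_diff[OF l\<eta>] linear_scale[OF l\<eta>] linear_add[OF l\<theta>] linear_scale[OF l\<theta>] algebra_simps)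
    show "T p u v = T p v u" using a_sym[of p u v] by (simp add: T_def add.commute)
    fix W X Y assume W: "open W" "X \<in> vfields A W" "Y \<in> vfields A W"
    have "(\<lambda>q. \<eta> q (\<theta> q (X q) *\<^sub>R Y q + \<theta> q (Y q) *\<^sub>R X q - (D X Y q - Dg X Y q))) \<in> smooth_funs A W"
      by (rule one_form_smooth[OF eta(1) W(1)], intro vfields_diff vfields_add vfields_scaleR one_form_smooth[OF \<theta>] W.vfields_conn G.vfields_conn W)
    then show "(\<lambda>q. T q (X q) (Y q)) \<in> smooth_funs A W"
      by (subst smooth_funs_cong[OF W(1)]) (use T_eq[OF W] in auto)
  qed
  \<comment> \<open>Both connections are normalised by D_\<xi> \<xi> = 0, so their difference
    vanishes on (\<xi>, \<xi>).\<close>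
  have "T p (\<xi> p) (\<xi> p) = 0" for p
    using T_eq[OF open_UNIV xi xi UNIV_I, of p] D(3)[of p] Dg_xi_xi[of p] \<theta>_xi[of p] linear_0[OF l\<eta>] by simp
  moreover have "D X Y p = Dg X Y p + \<theta> p (X p) *\<^sub>R Y p + \<theta> p (Y p) *\<^sub>R X p
        - g p (X p) (Y p) *\<^sub>R sharp g \<eta> \<theta> p - T p (X p) (Y p) *\<^sub>R \<xi> p"
    if "open W" "X \<in> vfields A W" "Y \<in> vfields A W" "p \<in> W" for W X Y p
    using aD[OF that] a_formula[of p "X p" "Y p"] by (simp add: algebra_simps)
  moreover have "T p (X p) (Y p) = screen_form S \<xi> Dg X Y p + \<eta> p (X p) * \<theta> p (Y p)"
    if W: "open W" "X \<in> vfields A W" "Y \<in> vfields A W" "p \<in> W" and Y: "\<forall>q\<in>W. Y q \<in> S q" for W X Y p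
  proof -
    \<comment> \<open>A field in the screen over \<open>W\<close> agrees there with its projection,
      and connections are local.\<close>
    have "D X (screen_proj g S Y) p = D X Y p"
      by (rule W.conn_cong[OF W]) (use Y in \<open>auto simp: screen_proj_eq[OF S] S\<close>)
    then have "\<eta> p (D X Y p) = 0" using screen[OF W] by (simp add: S)
    moreover have "\<eta> p (Y p) = 0" using Y W(4) by (simp add: S)
    ultimately show ?thesis
      unfolding T_eq[OF W] screen_form_eq[OF S]
      by (simp add: linear_add[OF l\<eta>] linear_diff[OF l\<eta>] linear_scale[OF l\<eta>])
  qed
  ultimately show ?thesis
    using D(1) \<theta> \<theta>_xi T_tensor
    by (intro exI[of _ T] conjI weyl_formula.intro[OF lightlike_axioms] weyl_formula_axioms.intro)
       (auto simp: associated_tensor_def)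
qed

end

context weyl_formula begin

text \<open>For a field Z in the screen, \<eta> of the formula is C(X, Z) + \<eta>(X) \<theta>(Z) -
  T(X, Z), which the associated tensor makes zero.\<close>

lemma D_screen:
  assumes "\<And>p. S p = {v. \<eta> p v = 0}" "associated_tensor A S \<xi> \<eta> Dg \<theta> T"
    "open W" "X \<in> vfields A W" "Y \<in> vfields A W" "p \<in> W"
  shows "D X (screen_proj g S Y) p \<in> S p"
proof -
  let ?Z = "\<lambda>q. Y q - \<eta> q (Y q) *\<^sub>R \<xi> q"
  note l\<eta> = one_form_linear[OF eta(1)]
  have Z: "?Z \<in> vfields A W"
    by (intro vfields_diff vfields_scaleR one_form_smooth[OF eta(1)] xi_vfields assms)
  have \<eta>Z: "\<eta> q (?Z q) = 0" for q by (simp add: linear_diff[OF l\<eta>] linear_scale[OF l\<eta>] eta)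
  have "T p (X p) (?Z p) = screen_form S \<xi> Dg X ?Z p + \<eta> p (X p) * \<theta> p (?Z p)"
    by (rule assms(2)[unfolded associated_tensor_def, THEN conjunct2, THEN conjunct2, rule_format, OF assms(3,4) Z _ assms(6)])
       (simp add: assms(1) \<eta>Z)
  then have "\<eta> p (D X ?Z p) = 0"
    unfolding D_formula[OF assms(3,4) Z assms(6)] screen_form_eq[OF assms(1)]
    using \<eta>Z[of p]
    by (simp only: linear_add[OF l\<eta>] linear_diff[OF l\<eta>, of p _ "_ *\<^sub>R _"] linear_scale[OF l\<eta>] eta_theta_sharp eta) simp
  moreover have "screen_proj g S Y = ?Z" by (rule ext) (rule screen_proj_eq[OF assms(1)])
  ultimately show ?thesis by (simp add: assms(1))
qed

text \<open>Evaluating on a pair with g(v, w) nonzero recovers the form at each point.\<close>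

lemma weyl_form_unique:
  "\<exists>!\<theta>. one_form A \<theta> \<and> (\<forall>W. open W \<longrightarrow> (\<forall>X\<in>vfields A W. \<forall>Y\<in>vfields A W. \<forall>Z\<in>vfields A W. \<forall>p\<in>W.
     cov2 A D g X Y Z p = - 2 * \<theta> p (X p) * g p (Y p) (Z p)))"
proof (rule ex1I[of _ \<theta>])
  fix \<theta>' assume *: "one_form A \<theta>' \<and> (\<forall>W. open W \<longrightarrow> (\<forall>X\<in>vfields A W. \<forall>Y\<in>vfields A W. \<forall>Z\<in>vfields A W. \<forall>p\<in>W.
     cov2 A D g X Y Z p = - 2 * \<theta>' p (X p) * g p (Y p) (Z p)))"
  have "\<theta>' p u = \<theta> p u" for p u
  proof -
    obtain v w where vw: "g p v w \<noteq> 0" using g_nonzero by blast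
    have "cov2 A D g (coord_field A p u) (coord_field A p v) (coord_field A p w) p = - 2 * \<theta>' p u * g p v w"
      using *[THEN conjunct2, rule_format, OF open_cdom vfields_coord_field[of p u] vfields_coord_field[of p v] vfields_coord_field[of p w] mem_cdom]
      by simp
    then show ?thesis
      using D_weyl[OF open_cdom vfields_coord_field[of p u] vfields_coord_field[of p v] vfields_coord_field[of p w] mem_cdom] vw
      by simp
  qed
  then show "\<theta>' = \<theta>" by blast
qed (use theta D_weyl in blast)

end

section \<open>Pullback along the immersion and smoothness of the induced metric\<close>

lemma smooth_map_smooth_funs:
  "smooth_map A B F \<Longrightarrow> cmap B q \<circ> F \<in> smooth_funs A (F -` cdom B q)"
  by (simp add: smooth_map_def smooth_funs_def)

lemma smooth_funs_pullback:
  assumes "smooth_mfd A" "smooth_mfd B" "smooth_map A B F" "f \<in> smooth_funs B (cdom B q)"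
  shows "(\<lambda>x. f (F x)) \<in> smooth_funs A (F -` cdom B q)"
  unfolding smooth_funs_def
proof (intro CollectI allI)
  fix p
  interpret A: smooth_mfd A by fact
  interpret B: smooth_mfd B by fact
  have oF: "open (F -` cdom B q)"
    using assms(3) by (auto simp: smooth_map_def intro!: open_vimage)
  have o: "open (cmap A p ` (cdom A p \<inter> F -` cdom B q))" by (rule A.open_chart_image[OF oF])
  have o': "open (cmap B q ` cdom B q)" using B.open_chart_image[OF open_UNIV, of q] by simp
  have f: "smooth_on (cmap B q ` cdom B q) (f \<circ> chart_inv B q)"
    using B.smooth_fun_on[OF assms(4), of q] by simp
  have F: "smooth_on (cmap A p ` (cdom A p \<inter> F -` cdom B q)) (cmap B q \<circ> F \<circ> chart_inv A p)"
    using assms(3) by (simp add: smooth_map_def)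
  have "smooth_on (cmap A p ` (cdom A p \<inter> F -` cdom B q)) (\<lambda>y. (f \<circ> chart_inv B q) ((cmap B q \<circ> F \<circ> chart_inv A p) y))"
    by (rule smooth_on_compose[OF o o' _ F f]) auto
  then show "smooth_on (cmap A p ` (cdom A p \<inter> F -` cdom B q)) ((\<lambda>x. f (F x)) \<circ> chart_inv A p)"
    by (subst smooth_on_cong[OF o]) auto
qed

text \<open>\<open>differential\<close> uses the target chart of \<open>F x\<close>, which jumps
  with \<open>x\<close>. Through the chain rule it is rewritten with one fixed chart, where the
  components depend smoothly on \<open>x\<close>.\<close>

lemma differential_chart:
  assumes "smooth_mfd A" "smooth_mfd B" "smooth_map A B F" "F x \<in> cdom B q"
  shows "differential A B F x v = coord_field B q (dfun A (cmap B q \<circ> F) x v) (F x)"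
proof -
  interpret A: smooth_mfd A by fact
  interpret B: smooth_mfd B by fact
  let ?\<tau> = "cmap B (F x) \<circ> chart_inv B q" and ?f = "cmap B q \<circ> F \<circ> chart_inv A x"
  have oF: "open (F -` cdom B q)"
    using assms(3) by (auto simp: smooth_map_def intro!: open_vimage)
  have d: "?f differentiable at (cmap A x x)"
    using A.smooth_fun_differentiable[OF smooth_map_smooth_funs[OF assms(3)] oF _ A.mem_cdom, of x] assms(4) by simp
  have "(?\<tau> has_derivative B.transit q (F x) (F x)) (at (?f (cmap A x x)))"
    using B.transition_has_derivative[OF assms(4) B.mem_cdom] by simp
  from diff_chain_at[OF d[unfolded frechet_derivative_works] this]
  have "((cmap B (F x) \<circ> F) \<circ> chart_inv A x has_derivative B.transit q (F x) (F x) \<circ> frechet_derivative ?f (at (cmap A x x))) (at (cmap A x x))"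
    by (rule has_derivative_transform_within_open[OF _ A.open_chart_image[OF oF]]) (use assms(4) in auto)
  from frechet_derivative_at[OF this] show ?thesis
    by (simp add: differential_def dfun_def B.coord_field_transit flip: comp_assoc) (metis comp_apply)
qed

lemma linear_differential:
  assumes "smooth_mfd A" "smooth_mfd B" "smooth_map A B F" shows "linear (differential A B F x)"
proof -
  interpret A: smooth_mfd A by fact
  interpret B: smooth_mfd B by fact
  have oF: "open (F -` cdom B (F x))"
    using assms(3) by (auto simp: smooth_map_def intro!: open_vimage)
  show ?thesis
    unfolding differential_def
    by (rule A.linear_dfun[OF smooth_map_smooth_funs[OF assms(3)] oF]) simp
qed

text \<open>Near \<open>p\<close> everything is expanded in the coordinate frame of the fixed chart
  at \<open>F p\<close>: components of the differential times pulled-back coefficients of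
  \<open>h\<close>, all smooth.\<close>

lemma sym_tensor_induced_metric:
  fixes A :: "('m::t2_space, 'e::euclidean_space) atlas" and B :: "('n::t2_space, 'f::euclidean_space) atlas"
  assumes "smooth_mfd A" "smooth_mfd B" "smooth_map A B F" "sym_tensor B h"
  shows "sym_tensor A (induced_metric A B F h)"
  unfolding sym_tensor_def
proof (intro conjI allI impI ballI)
  interpret A: smooth_mfd A by fact
  interpret B: smooth_mfd B by fact
  have lh: "linear (h q w)" "linear (\<lambda>w'. h q w' w)" for q w
    using B.sym_tensor_bilinear[OF assms(4), of q] by (auto simp: bilinear_def)
  note ld = linear_differential[OF assms(1-3)]
  show "bilinear (induced_metric A B F h p)" for p
    unfolding bilinear_def linear_iff induced_metric_def
    by (simp add: linear_add[OF lh(1)] linear_add[OF lh(2)] linear_scale[OF lh(1)] linear_scale[OF lh(2)] linear_add[OF ld] linear_scale[OF ld])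
  show "induced_metric A B F h p u v = induced_metric A B F h p v u" for p u v
    using B.sym_tensor_sym[OF assms(4)] by (simp add: induced_metric_def)
  fix W X Y assume W: "open W" "X \<in> vfields A W" "Y \<in> vfields A W"
  show "(\<lambda>p. induced_metric A B F h p (X p) (Y p)) \<in> smooth_funs A W"
  proof (rule A.smooth_funs_local[OF W(1)])
    fix p assume p: "p \<in> W"
    let ?q = "F p"
    let ?V = "W \<inter> F -` cdom B ?q"
    let ?c = "\<lambda>Z a x. dfun A (cmap B ?q \<circ> F) x (Z x) \<bullet> a"
    let ?h = "\<lambda>a b x. h (F x) (coord_field B ?q a (F x)) (coord_field B ?q b (F x))"
    have V: "open ?V" using assms(3) W(1) by (auto simp: smooth_map_def intro!: open_vimage)
    have c: "?c Z a \<in> smooth_funs A ?V" if "Z \<in> vfields A W" for Z a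
      by (intro A.smooth_funs_inner A.smooth_funs_dfun A.smooth_funs_const V A.vfields_mono[OF that]
          A.smooth_funs_mono[OF smooth_map_smooth_funs[OF assms(3)]]) auto
    have hs: "?h a b \<in> smooth_funs A ?V" for a b
      by (rule A.smooth_funs_mono[OF smooth_funs_pullback[OF assms(1-3)
            B.sym_tensor_smooth[OF assms(4) B.open_cdom B.vfields_coord_field B.vfields_coord_field]]]) auto
    have "(\<lambda>x. \<Sum>a\<in>Basis. \<Sum>b\<in>Basis. ?c X a x * ?c Y b x * ?h a b x) \<in> smooth_funs A ?V"
      by (intro A.smooth_funs_sum A.smooth_funs_mult V c hs W)
    moreover have "induced_metric A B F h x (X x) (Y x) = (\<Sum>a\<in>Basis. \<Sum>b\<in>Basis. ?c X a x * ?c Y b x * ?h a b x)"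
      if x: "x \<in> ?V" for x
    proof -
      have Fx: "F x \<in> cdom B ?q" using x by simp
      note lE = B.coord_field_linear[OF Fx]
      have l1: "linear (\<lambda>u. h (F x) (coord_field B ?q u (F x)) w)" for w
        using linear_compose[OF lE lh(2)] by (simp add: o_def)
      have l2: "linear (\<lambda>u. h (F x) w (coord_field B ?q u (F x)))" for w
        using linear_compose[OF lE lh(1)] by (simp add: o_def)
      have "h (F x) (coord_field B ?q u (F x)) (coord_field B ?q v (F x)) = (\<Sum>a\<in>Basis. \<Sum>b\<in>Basis. (u \<bullet> a) * (v \<bullet> b) * ?h a b x)" for u v
      proof -
        have "h (F x) (coord_field B ?q u (F x)) (coord_field B ?q v (F x)) =
          (\<Sum>a\<in>Basis. (u \<bullet> a) * h (F x) (coord_field B ?q a (F x)) (coord_field B ?q v (F x)))"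
          using linear_euclidean_expand[OF l1, where v=u] by simp
        also have "\<dots> = (\<Sum>a\<in>Basis. (u \<bullet> a) * (\<Sum>b\<in>Basis. (v \<bullet> b) * ?h a b x))"
        proof (rule sum.cong[OF refl])
          fix a
          show "(u \<bullet> a) * h (F x) (coord_field B ?q a (F x)) (coord_field B ?q v (F x)) = (u \<bullet> a) * (\<Sum>b\<in>Basis. (v \<bullet> b) * ?h a b x)"
            using linear_euclidean_expand[OF l2[of "coord_field B ?q a (F x)"], where v=v] by simp
        qed
        finally show ?thesis by (simp add: sum_distrib_left mult.assoc)
      qed
      then show ?thesis
        unfolding induced_metric_def differential_chart[OF assms(1-3) Fx] by this
    qed
    ultimately have "(\<lambda>p. induced_metric A B F h p (X p) (Y p)) \<in> smooth_funs A ?V"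
      by (subst A.smooth_funs_cong[OF V]) auto
    then show "\<exists>V. open V \<and> p \<in> V \<and> (\<lambda>p. induced_metric A B F h p (X p) (Y p)) \<in> smooth_funs A V"
      using V p by (intro exI[of _ ?V]) auto
  qed
qed

lemma smooth_manifold_mfd: "smooth_manifold A \<Longrightarrow> smooth_mfd A"
  by (rule smooth_mfd.intro)

lemma sym_tensor_conformal:
  assumes "smooth_mfd A" "sym_tensor A g" "f \<in> smooth_funs A UNIV" and g': "\<And>p u v. g' p u v = exp (- 2 * f p) * g p u v"
  shows "sym_tensor A g'"
  unfolding sym_tensor_def
proof (intro conjI allI impI ballI)
  interpret smooth_mfd A by fact
  show "bilinear (g' p)" for p
    using sym_tensor_bilinear[OF assms(2), of p] by (simp add: g' bilinear_def linear_iff algebra_simps)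
  show "g' p u v = g' p v u" for p u v using sym_tensor_sym[OF assms(2)] by (simp add: g')
  fix W X Y assume W: "open W" "X \<in> vfields A W" "Y \<in> vfields A W"
  show "(\<lambda>p. g' p (X p) (Y p)) \<in> smooth_funs A W"
    unfolding g'
    by (intro smooth_funs_mult smooth_funs_exp smooth_funs_const smooth_funs_mono[OF assms(3)] W sym_tensor_smooth[OF assms(2)])
       auto
qed

text \<open>Rank n in dimension n + 1 leaves a kernel of dimension 1, so any nonzero vector in it
  spans it; n \<ge> 1 makes this kernel proper, hence the form nonzero.\<close>

lemma form_kernel_corank_one:
  fixes h :: "'e::euclidean_space \<Rightarrow> 'e \<Rightarrow> real"
  assumes "bilinear h" "form_rank h = n" "DIM('e) = n + 1" "n \<ge> 1" "x \<noteq> 0" "x \<in> form_kernel h"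
  shows "form_kernel h = {c *\<^sub>R x |c. True}" "\<exists>u v. h u v \<noteq> 0"
proof -
  have sub: "subspace (form_kernel h)"
    using assms(1) by (auto simp: form_kernel_def subspace_def bilinear_ladd bilinear_lmul bilinear_lzero)
  have dim: "dim (form_kernel h) = 1"
    using assms(2-4) dim_subset_UNIV[of "form_kernel h"] by (simp add: form_rank_def)
  have "dim (span {x}) = 1" using assms(5) by (simp add: dim_span)
  then have "span {x} = form_kernel h"
    using subspace_dim_equal[OF subspace_span sub, of "{x}"] dim assms(6) sub by (simp add: span_minimal)
  then show "form_kernel h = {c *\<^sub>R x |c. True}" by (auto simp: span_singleton)
  show "\<exists>u v. h u v \<noteq> 0"
  proof (rule ccontr)
    assume "\<not> ?thesis"
    then have "form_kernel h = UNIV" by (auto simp: form_kernel_def)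
    then show False using dim assms(3,4) by simp
  qed
qed

theorem proposition4p1:
  fixes A :: "('m::{t2_space,second_countable_topology}, 'e::euclidean_space) atlas"
    and B :: "('n::{t2_space,second_countable_topology}, 'f::euclidean_space) atlas"
    and n :: nat
    and i :: "'m \<Rightarrow> 'n"
    and gbar :: "'n \<Rightarrow> 'f \<Rightarrow> 'f \<Rightarrow> real"
    and Dbar :: "('n \<Rightarrow> 'f) \<Rightarrow> ('n \<Rightarrow> 'f) \<Rightarrow> 'n \<Rightarrow> 'f"
    and g0 :: "'m \<Rightarrow> 'e \<Rightarrow> 'e \<Rightarrow> real"
    and c :: "('m \<Rightarrow> 'e \<Rightarrow> 'e \<Rightarrow> real) set"
    and \<xi> :: "'m \<Rightarrow> 'e"
    and S :: "'m \<Rightarrow> 'e set"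
    and \<eta> :: "'m \<Rightarrow> 'e \<Rightarrow> real"
    and D :: "('m \<Rightarrow> 'e) \<Rightarrow> ('m \<Rightarrow> 'e) \<Rightarrow> 'm \<Rightarrow> 'e"
    and Dg :: "('m \<Rightarrow> 'e \<Rightarrow> 'e \<Rightarrow> real) \<Rightarrow> ('m \<Rightarrow> 'e) \<Rightarrow> ('m \<Rightarrow> 'e) \<Rightarrow> 'm \<Rightarrow> 'e"
    and \<phi> :: "('m \<Rightarrow> 'e \<Rightarrow> 'e \<Rightarrow> real) \<Rightarrow> 'm \<Rightarrow> 'e \<Rightarrow> real"
  assumes "n \<ge> 1"
    and "smooth_manifold A" and "DIM('e) = n + 1"
    and "smooth_manifold B" and "DIM('f) = n + 2"
    and "lorentzian_metric B gbar" and "levi_civita B gbar Dbar"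
    and "immersion A B i"
    and "g0 = induced_metric A B i gbar" and "\<forall>p. form_rank (g0 p) = n"
    and "\<xi> \<in> vfields A UNIV" and "\<forall>p. \<xi> p \<noteq> 0 \<and> \<xi> p \<in> form_kernel (g0 p)"
    and "totally_geodesic A B i gbar Dbar \<xi>"
    and "screen_distribution A g0 n S" and "integrable_distribution A S"
    and "one_form A \<eta>" and "\<forall>p. \<eta> p (\<xi> p) = 1 \<and> {v. \<eta> p v = 0} = S p"
    and "c = conformal_class A g0"
    and "connection A D" and "\<forall>p. D \<xi> \<xi> p = 0"
    and "\<forall>g\<in>c. connection A (Dg g) \<and> torsion_free A (Dg g) \<and> metric_connection A g (Dg g) \<and>
           (\<forall>p. Dg g \<xi> \<xi> p = 0)"
    and "\<forall>g\<in>c. one_form A (\<phi> g) \<and>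
           (\<forall>W. open W \<longrightarrow> (\<forall>X\<in>vfields A W. \<forall>p\<in>W. Dg g X \<xi> p = \<phi> g p (X p) *\<^sub>R \<xi> p))"
  shows
    "let R = (\<lambda>g \<Lambda>. \<exists>\<theta> T.
           one_form A \<theta> \<and> (\<forall>p. \<forall>v\<in>form_kernel (g0 p). \<theta> p v = 0) \<and>
           associated_tensor A S \<xi> \<eta> (Dg g) \<theta> T \<and>
           (\<forall>W. open W \<longrightarrow> (\<forall>X\<in>vfields A W. \<forall>Y\<in>vfields A W. \<forall>p\<in>W.
              D X Y p = Dg g X Y p + \<theta> p (X p) *\<^sub>R Y p + \<theta> p (Y p) *\<^sub>R X p
                        - g p (X p) (Y p) *\<^sub>R sharp g \<eta> \<theta> p - T p (X p) (Y p) *\<^sub>R \<xi> p)) \<and>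
           (\<forall>W. open W \<longrightarrow> (\<forall>X\<in>vfields A W. \<forall>Y\<in>vfields A W. \<forall>p\<in>W.
              ricci A (Dg g) X Y p = - ext_d A (\<phi> g) X Y p - calD A n \<xi> (Dg g) (\<phi> g) \<theta> T X Y p / 2
                        + Lambda_bar A n g \<xi> \<eta> (Dg g) \<theta> T \<Lambda> p * g p (X p) (Y p))))
     in (einstein_weyl_screen_structure A c S D \<longleftrightarrow> (\<forall>g\<in>c. \<exists>\<Lambda>\<in>smooth_funs A UNIV. R g \<Lambda>)) \<and>
        (einstein_weyl_screen_structure A c S D \<longrightarrow>
           (\<forall>g\<in>c. \<forall>\<Lambda>\<in>smooth_funs A UNIV. einstein_weyl_function A D g \<Lambda> \<longleftrightarrow> R g \<Lambda>))"
proof -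
  note M = smooth_manifold_mfd[OF assms(2)]
  interpret smooth_mfd A by (rule M)
  have imm: "smooth_map A B i" using assms(8) by (simp add: immersion_def)
  have g0: "sym_tensor A g0"
    unfolding assms(9)
    using sym_tensor_induced_metric[OF M smooth_manifold_mfd[OF assms(4)] imm] assms(6) by (simp add: lorentzian_metric_def)
  have ker0: "form_kernel (g0 p) = {c *\<^sub>R \<xi> p |c. True}" "\<exists>u v. g0 p u v \<noteq> 0" for p
    using form_kernel_corank_one[OF sym_tensor_bilinear[OF g0] assms(10)[rule_format] assms(3,1), of "\<xi> p" p] assms(12)
    by blast+
  have S: "S p = {v. \<eta> p v = 0}" for p using assms(17) by auto
  have L: "lightlike A n g \<xi> \<eta> (Dg g) (\<phi> g)" if g: "g \<in> c" for g
  proof -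
    obtain f where f: "f \<in> smooth_funs A UNIV" "\<And>p u v. g p u v = exp (- 2 * f p) * g0 p u v"
      using g assms(18) by (auto simp: conformal_class_def)
    \<comment> \<open>The conformal factor is an exponential, so all metrics of the class share the
      kernel of \<open>g0\<close>.\<close>
    have z: "g p u v = 0 \<longleftrightarrow> g0 p u v = 0" for p u v by (simp add: f(2))
    have k: "(\<forall>w. g0 p v w = 0) \<longleftrightarrow> (\<exists>c. v = c *\<^sub>R \<xi> p)" for p v
      using ker0(1)[of p] by (auto simp: form_kernel_def)
    have y: "\<exists>c. v = c *\<^sub>R \<xi> p" if "\<And>w. g0 p v w = 0" for p v using that k by blast
    have "\<exists>c. \<xi> p = c *\<^sub>R \<xi> p" for p by (rule exI[of _ 1]) simp
    then have x: "g0 p (\<xi> p) w = 0" for p w using k by blast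
    show ?thesis
      using assms(3,11,16,17,21,22) g sym_tensor_conformal[OF M g0 f] ker0(2) x
      by unfold_locales (auto simp: z intro: y)
  qed
  \<comment> \<open>The kernel is spanned by \<xi>, so horizontality is the single condition
    \<theta>(\<xi>) = 0 at each point.\<close>
  have hor: "(\<forall>v\<in>form_kernel (g0 p). \<theta> p v = 0) \<longleftrightarrow> \<theta> p (\<xi> p) = 0" if "one_form A \<theta>" for \<theta> p
  proof -
    have "\<xi> p \<in> form_kernel (g0 p)" using assms(12) by blast
    then show ?thesis using linear_scale[OF one_form_linear[OF that]] by (auto simp: ker0(1))
  qed
  define F where "F g \<theta> T \<longleftrightarrow> one_form A \<theta> \<and> (\<forall>p. \<forall>v\<in>form_kernel (g0 p). \<theta> p v = 0) \<and>
           associated_tensor A S \<xi> \<eta> (Dg g) \<theta> T \<and>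
           (\<forall>W. open W \<longrightarrow> (\<forall>X\<in>vfields A W. \<forall>Y\<in>vfields A W. \<forall>p\<in>W.
              D X Y p = Dg g X Y p + \<theta> p (X p) *\<^sub>R Y p + \<theta> p (Y p) *\<^sub>R X p
                        - g p (X p) (Y p) *\<^sub>R sharp g \<eta> \<theta> p - T p (X p) (Y p) *\<^sub>R \<xi> p))" for g \<theta> T
  define E where "E g \<theta> T \<Lambda> \<longleftrightarrow> (\<forall>W. open W \<longrightarrow> (\<forall>X\<in>vfields A W. \<forall>Y\<in>vfields A W. \<forall>p\<in>W.
              ricci A (Dg g) X Y p = - ext_d A (\<phi> g) X Y p - calD A n \<xi> (Dg g) (\<phi> g) \<theta> T X Y p / 2
                        + Lambda_bar A n g \<xi> \<eta> (Dg g) \<theta> T \<Lambda> p * g p (X p) (Y p)))" for g \<theta> T \<Lambda>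
  have F: "F g \<theta> T \<longleftrightarrow> weyl_formula A n g \<xi> \<eta> (Dg g) (\<phi> g) D \<theta> T \<and> associated_tensor A S \<xi> \<eta> (Dg g) \<theta> T"
    if g: "g \<in> c" for g \<theta> T
  proof
    assume F: "F g \<theta> T"
    then have T: "sym_tensor A T" "\<And>p. T p (\<xi> p) (\<xi> p) = 0" by (auto simp: F_def associated_tensor_def)
    have "\<theta> p (\<xi> p) = 0" for p using F hor by (auto simp: F_def)
    then show "weyl_formula A n g \<xi> \<eta> (Dg g) (\<phi> g) D \<theta> T \<and> associated_tensor A S \<xi> \<eta> (Dg g) \<theta> T"
      using F T assms(19) by (intro conjI weyl_formula.intro[OF L[OF g]] weyl_formula_axioms.intro) (auto simp: F_def)
  next
    assume *: "weyl_formula A n g \<xi> \<eta> (Dg g) (\<phi> g) D \<theta> T \<and> associated_tensor A S \<xi> \<eta> (Dg g) \<theta> T"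
    then interpret wf: weyl_formula A n g \<xi> \<eta> "Dg g" "\<phi> g" D \<theta> T by simp
    show "F g \<theta> T" unfolding F_def using * wf.theta hor[OF wf.theta(1)] wf.D_formula by auto
  qed
  \<comment> \<open>\<open>F\<close> does not mention \<Lambda>: one pair \<theta>, T with
    \<open>F\<close> tests every smooth \<Lambda>. This is what links the two parts of the
    conclusion.\<close>
  have FE: "einstein_weyl_function A D g \<Lambda> \<longleftrightarrow> E g \<theta> T \<Lambda>"
    if "g \<in> c" "F g \<theta> T" "\<Lambda> \<in> smooth_funs A UNIV" for g \<theta> T \<Lambda>
  proof -
    have "weyl_formula A n g \<xi> \<eta> (Dg g) (\<phi> g) D \<theta> T" using F[OF that(1)] that(2) by simp
    from weyl_formula.einstein_weyl_function_iff[OF this that(3)] show ?thesis unfolding E_def .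
  qed
  \<comment> \<open>The exponent f = 0. A member of \<open>c\<close> is needed because
    torsion-freeness is asked of \<open>D\<close> itself, not per metric, and is read off the
    formula for \<open>g0\<close>.\<close>
  have g0c: "g0 \<in> c"
    unfolding assms(18) conformal_class_def
    using smooth_funs_const[of "0::real" UNIV] by (auto intro!: bexI[of _ "\<lambda>_. 0"])
  have FW: "weyl_screen_structure A c S D" if "\<forall>g\<in>c. \<exists>\<theta> T. F g \<theta> T"
  proof -
    have "\<exists>\<theta> T. weyl_formula A n g \<xi> \<eta> (Dg g) (\<phi> g) D \<theta> T \<and> associated_tensor A S \<xi> \<eta> (Dg g) \<theta> T" if "g \<in> c" for g
      using \<open>\<forall>g\<in>c. \<exists>\<theta> T. F g \<theta> T\<close> F that by blast
    note w = this
    obtain \<theta>0 T0 where "weyl_formula A n g0 \<xi> \<eta> (Dg g0) (\<phi> g0) D \<theta>0 T0" using w[OF g0c] by blast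
    then have tf: "torsion_free A D" by (rule weyl_formula.D_torsion_free)
    have un: "\<exists>!\<theta>. one_form A \<theta> \<and> (\<forall>W. open W \<longrightarrow> (\<forall>X\<in>vfields A W. \<forall>Y\<in>vfields A W. \<forall>Z\<in>vfields A W. \<forall>p\<in>W.
           cov2 A D g X Y Z p = - 2 * \<theta> p (X p) * g p (Y p) (Z p)))" if g: "g \<in> c" for g
    proof -
      obtain \<theta> T where "weyl_formula A n g \<xi> \<eta> (Dg g) (\<phi> g) D \<theta> T" using w[OF g] by blast
      then show ?thesis by (rule weyl_formula.weyl_form_unique)
    qed
    have sc: "D X (screen_proj g S Y) p \<in> S p"
      if g: "g \<in> c" and W: "open W" "X \<in> vfields A W" "Y \<in> vfields A W" "p \<in> W" for g W X Y p
    proof -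
      obtain \<theta> T where "weyl_formula A n g \<xi> \<eta> (Dg g) (\<phi> g) D \<theta> T" "associated_tensor A S \<xi> \<eta> (Dg g) \<theta> T"
        using w[OF g] by blast
      from weyl_formula.D_screen[OF this(1) S this(2) W] show ?thesis .
    qed
    show ?thesis
      unfolding weyl_screen_structure_def weyl_structure_def
      by (intro conjI ballI allI impI assms(19) tf un sc)
  qed
  have WF: "\<exists>\<theta> T. F g \<theta> T" if ws: "weyl_screen_structure A c S D" and g: "g \<in> c" for g
  proof -
    obtain \<theta> where \<theta>: "one_form A \<theta>" "\<And>W X Y Z p. open W \<Longrightarrow> X \<in> vfields A W \<Longrightarrow> Y \<in> vfields A W \<Longrightarrow> Z \<in> vfields A W \<Longrightarrow> p \<in> W \<Longrightarrow>
       cov2 A D g X Y Z p = - 2 * \<theta> p (X p) * g p (Y p) (Z p)"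
      using ws g unfolding weyl_screen_structure_def weyl_structure_def by meson
    have "\<exists>T. weyl_formula A n g \<xi> \<eta> (Dg g) (\<phi> g) D \<theta> T \<and> associated_tensor A S \<xi> \<eta> (Dg g) \<theta> T"
      using ws g assms(20)
      by (intro lightlike.weyl_screen_imp_formula[OF L[OF g] S _ _ _ \<theta>])
         (auto simp: weyl_screen_structure_def weyl_structure_def)
    then show ?thesis using F[OF g] by blast
  qed
  have R: "(\<exists>\<theta> T. one_form A \<theta> \<and> (\<forall>p. \<forall>v\<in>form_kernel (g0 p). \<theta> p v = 0) \<and>
           associated_tensor A S \<xi> \<eta> (Dg g) \<theta> T \<and>
           (\<forall>W. open W \<longrightarrow> (\<forall>X\<in>vfields A W. \<forall>Y\<in>vfields A W. \<forall>p\<in>W.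
              D X Y p = Dg g X Y p + \<theta> p (X p) *\<^sub>R Y p + \<theta> p (Y p) *\<^sub>R X p
                        - g p (X p) (Y p) *\<^sub>R sharp g \<eta> \<theta> p - T p (X p) (Y p) *\<^sub>R \<xi> p)) \<and>
           (\<forall>W. open W \<longrightarrow> (\<forall>X\<in>vfields A W. \<forall>Y\<in>vfields A W. \<forall>p\<in>W.
              ricci A (Dg g) X Y p = - ext_d A (\<phi> g) X Y p - calD A n \<xi> (Dg g) (\<phi> g) \<theta> T X Y p / 2
                        + Lambda_bar A n g \<xi> \<eta> (Dg g) \<theta> T \<Lambda> p * g p (X p) (Y p)))) \<longleftrightarrow>
      (\<exists>\<theta> T. F g \<theta> T \<and> E g \<theta> T \<Lambda>)" for g \<Lambda>
    unfolding F_def E_def by (simp only: conj_assoc)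
  show ?thesis
    unfolding Let_def R
  proof (intro conjI iffI impI ballI)
    assume ew: "einstein_weyl_screen_structure A c S D"
    then have ws: "weyl_screen_structure A c S D" by (simp add: einstein_weyl_screen_structure_def)
    show "\<exists>\<Lambda>\<in>smooth_funs A UNIV. \<exists>\<theta> T. F g \<theta> T \<and> E g \<theta> T \<Lambda>" if g: "g \<in> c" for g
    proof -
      obtain \<Lambda> where \<Lambda>: "einstein_weyl_function A D g \<Lambda>"
        using ew g unfolding einstein_weyl_screen_structure_def by blast
      then have "\<Lambda> \<in> smooth_funs A UNIV" by (simp add: einstein_weyl_function_def)
      then show ?thesis using \<Lambda> WF[OF ws g] FE[OF g] by blast
    qed
    show "\<exists>\<theta> T. F g \<theta> T \<and> E g \<theta> T \<Lambda>" if "g \<in> c" "\<Lambda> \<in> smooth_funs A UNIV" "einstein_weyl_function A D g \<Lambda>" for g \<Lambda>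
      using WF[OF ws that(1)] FE[OF that(1)] that by blast
    show "einstein_weyl_function A D g \<Lambda>" if "g \<in> c" "\<Lambda> \<in> smooth_funs A UNIV" "\<exists>\<theta> T. F g \<theta> T \<and> E g \<theta> T \<Lambda>" for g \<Lambda>
      using FE[OF that(1)] that by blast
  next
    assume *: "\<forall>g\<in>c. \<exists>\<Lambda>\<in>smooth_funs A UNIV. \<exists>\<theta> T. F g \<theta> T \<and> E g \<theta> T \<Lambda>"
    then have "weyl_screen_structure A c S D" using FW by blast
    moreover have "\<exists>\<Lambda>. einstein_weyl_function A D g \<Lambda>" if "g \<in> c" for g
      using * FE[OF that] that by blast
    ultimately show "einstein_weyl_screen_structure A c S D" by (simp add: einstein_weyl_screen_structure_def)
  qed
qed

end
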